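(* In the domain $\{\beta>0,\ c\ge c^{cj}\}$ the following holds. (i) There exists a function $\beta_0:[c^{cj},+\infty)\to\mathbb R^+$, of class $\big[\frac1{1-\alpha}\big]$, such that there is a strong reactive solution of special type for $\beta=\beta_0(c)$. (ii) There exists a function $\beta_1:[c^{cj},c_* )\to\mathbb R^+$, of class $\big[\frac1{1-\alpha}\big]$, such that there is a weak reactive solution of special type for $\beta=\beta_1(c)$. (iii) The curves $\beta_0(c)$ and $\beta_1(c)$ enjoy the following properties: (a) $\beta_0(c)<\beta_1(c)$ for all $c\in(c^{cj},c_* )$; (b) $\beta_0(c)\to+\infty$ as $c\to+\infty$; (c) $\beta_1'(c)>0$ for $c\in(c^{cj},c_* )$, and moreover $\beta_1(c)\to+\infty$ as $c\to c_*$. (iv) For $c>c^{cj}$ and $0<\beta<\beta_0(c)$, there is a strong reactive solution with a bump; for $c\in(c^{cj},c_* )$ and $\beta_0(c)<\beta<\beta_1(c)$, there is a strong reactive wave of monotonic type; finally, when $c^{cj}<c<c_*$ and $\beta\ge\beta_1(c)$, there is no solution.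
   Context: Fix real numbers $q_0>0$, $K>0$, $0\le\alpha<1$ and $T_i$ with $0<T_i<\sqrt{2q_0}$. The function $\varphi:[0,\infty)\to[0,\infty)$ vanishes on $[0,T_i)$, is discontinuous at $T_i$, and is sufficiently smooth and positive on $[T_i,\infty)$; moreover the function $\psi(V)=\varphi(1/V)$ is smooth at $V=0$ with a value $\psi(0)>0$. (Examples: $\varphi(T)=H(T-T_i)$ with $H$ the Heaviside function, and $\varphi(T)=H(T-T_i)e^{-T_a/T}$ with $T_a>0$.) Notation: $\mathbb R^+=(0,\infty)$; "of class $\big[\frac1{1-\alpha}\big]$" means of class $C^k$ with $k$ the integer part of $\frac1{1-\alpha}$; $c^{cj}=\sqrt{2q_0}$; $c_*=\frac{T_i^2+2q_0}{2T_i}$ (so $c_*>c^{cj}$); and for $c\ge c^{cj}$, $T_0(c)=c+\sqrt{c^2-2q_0}$, $T_1(c)=c-\sqrt{c^2-2q_0}$. For $\beta>0$ and $c\ge c^{cj}$, a solution (reactive traveling wave of speed $c$ with viscosity $\beta$) is a pair $(T,Z)\in C^1(\mathbb R)\times C^0(\mathbb R)$ for which there is $\ell\in(0,\infty)$ with: - $T(0)=T_i$, $T(\xi)<T_i$ for $\xi>0$, $T(\xi)>T_i$ for $\xi<0$; - for $\xi>0$: $Z\equiv1$, $\beta T_\xi=-cT+\frac{T^2}{2}$, and $T(\xi)\to0$ as $\xi\to+\infty$; - for $-\ell<\xi<0$ (reaction zone): $Z>0$, $\beta T_\xi=-cT+\frac{T^2}2+q_0(1-Z)$, $Z_\xi=K\varphi(T)Z^\alpha$,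 with $Z(0)=1$ and $Z(-\ell)=0$; - for $\xi<-\ell$: $Z\equiv0$, $\beta T_\xi=-cT+\frac{T^2}2+q_0$, and $T(\xi)$ has a limit $T_-$ as $\xi\to-\infty$, with $T_-\in\{T_0(c),T_1(c)\}$. A solution is strong if $T_-=T_0(c)$ and weak if $T_-=T_1(c)$; when $c=c^{cj}$ both notions coincide ($T_-=\sqrt{2q_0}$) and the solution is called Chapman–Jouguet. A strong (respectively weak) solution is of special type if $T\equiv T_0(c)$ (respectively $T\equiv T_1(c)$) on $\{\xi\le-\ell\}$. For $c>c^{cj}$, a strong solution is of monotonic type if it is not of special type, $T$ is monotonic, and $T(\xi)\to T_0(c)$ exponentially as $\xi\to-\infty$; it is a solution with a bump if $T$ is non-monotonic with a bump (a maximum) in the reaction zone and $T(\xi)\to T_0(c)$ exponentially as $\xi\to-\infty$.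
   Formalization: β0, β1 are of class [1/(1-α)] for c>c^cj and only continuous at c^cj, where their one-sided derivatives are infinite; in (iv), at β=β1(c) only solutions other than the weak ones of special type are excluded, since (ii) gives such a wave. *)

theory Defs
  imports "HOL-Analysis.Analysis"
begin

(* Class C^n on S; derivatives are taken within S, hence one-sided at the endpoints of an
   interval. Meant for nondegenerate intervals S. *)
primrec Ck_on :: "nat \<Rightarrow> (real \<Rightarrow> real) \<Rightarrow> real set \<Rightarrow> bool" where
  "Ck_on 0 f S \<longleftrightarrow> continuous_on S f"
| "Ck_on (Suc n) f S \<longleftrightarrow>
     (\<exists>f'. (\<forall>x\<in>S. (f has_real_derivative f' x) (at x within S)) \<and> Ck_on n f' S)"

definition c_cj :: "real \<Rightarrow> real" where
  "c_cj q0 = sqrt (2 * q0)"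

definition c_star :: "real \<Rightarrow> real \<Rightarrow> real" where
  "c_star q0 Ti = (Ti\<^sup>2 + 2 * q0) / (2 * Ti)"

definition T_0 :: "real \<Rightarrow> real \<Rightarrow> real" where
  "T_0 q0 c = c + sqrt (c\<^sup>2 - 2 * q0)"

definition T_1 :: "real \<Rightarrow> real \<Rightarrow> real" where
  "T_1 q0 c = c - sqrt (c\<^sup>2 - 2 * q0)"

(* Ignition rate \<phi> with smoothness of order N; only its values on [0,\<infinity>) matter.
   \<psi>(V) = \<phi>(1/V) for V > 0 must be extended separately to V = 0, because 1/0 = 0 in HOL. *)
definition ignition_rate :: "real \<Rightarrow> nat \<Rightarrow> (real \<Rightarrow> real) \<Rightarrow> bool" where
  "ignition_rate Ti N \<phi> \<longleftrightarrow>
     (\<forall>T\<in>{0..<Ti}. \<phi> T = 0) \<and>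
     \<not> continuous (at Ti within {0..}) \<phi> \<and>
     (\<forall>T\<ge>Ti. \<phi> T > 0) \<and>
     Ck_on N \<phi> {Ti..} \<and>
     (\<exists>\<psi> \<delta>. \<delta> > 0 \<and> (\<forall>V>0. \<psi> V = \<phi> (1 / V)) \<and> \<psi> 0 > 0 \<and> Ck_on N \<psi> {0..<\<delta>})"

(* A travelling wave (T, Z) whose reaction zone is (-l, 0). *)
definition wave ::
  "real \<Rightarrow> real \<Rightarrow> real \<Rightarrow> real \<Rightarrow> (real \<Rightarrow> real) \<Rightarrow> real \<Rightarrow> real \<Rightarrow> real
     \<Rightarrow> (real \<Rightarrow> real) \<Rightarrow> (real \<Rightarrow> real) \<Rightarrow> bool" where
  "wave q0 K \<alpha> Ti \<phi> \<beta> c l T Z \<longleftrightarrow>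
     l > 0 \<and>
     T C1_differentiable_on UNIV \<and> continuous_on UNIV Z \<and>
     T 0 = Ti \<and> (\<forall>\<xi>>0. T \<xi> < Ti) \<and> (\<forall>\<xi><0. T \<xi> > Ti) \<and>
     (\<forall>\<xi>>0. Z \<xi> = 1 \<and> \<beta> * deriv T \<xi> = - c * T \<xi> + (T \<xi>)\<^sup>2 / 2) \<and>
     (T \<longlongrightarrow> 0) at_top \<and>
     (\<forall>\<xi>. - l < \<xi> \<and> \<xi> < 0 \<longrightarrow>
        Z \<xi> > 0 \<and>
        \<beta> * deriv T \<xi> = - c * T \<xi> + (T \<xi>)\<^sup>2 / 2 + q0 * (1 - Z \<xi>) \<and>
        (Z has_real_derivative K * \<phi> (T \<xi>) * Z \<xi> powr \<alpha>) (at \<xi>)) \<and>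
     Z 0 = 1 \<and> Z (- l) = 0 \<and>
     (\<forall>\<xi> < - l. Z \<xi> = 0 \<and> \<beta> * deriv T \<xi> = - c * T \<xi> + (T \<xi>)\<^sup>2 / 2 + q0) \<and>
     (\<exists>T_minus\<in>{T_0 q0 c, T_1 q0 c}. (T \<longlongrightarrow> T_minus) at_bot)"

definition solution ::
  "real \<Rightarrow> real \<Rightarrow> real \<Rightarrow> real \<Rightarrow> (real \<Rightarrow> real) \<Rightarrow> real \<Rightarrow> real
     \<Rightarrow> (real \<Rightarrow> real) \<Rightarrow> (real \<Rightarrow> real) \<Rightarrow> bool" where
  "solution q0 K \<alpha> Ti \<phi> \<beta> c T Z \<longleftrightarrow> (\<exists>l. wave q0 K \<alpha> Ti \<phi> \<beta> c l T Z)"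

definition strong_solution ::
  "real \<Rightarrow> real \<Rightarrow> real \<Rightarrow> real \<Rightarrow> (real \<Rightarrow> real) \<Rightarrow> real \<Rightarrow> real
     \<Rightarrow> (real \<Rightarrow> real) \<Rightarrow> (real \<Rightarrow> real) \<Rightarrow> bool" where
  "strong_solution q0 K \<alpha> Ti \<phi> \<beta> c T Z \<longleftrightarrow>
     solution q0 K \<alpha> Ti \<phi> \<beta> c T Z \<and> (T \<longlongrightarrow> T_0 q0 c) at_bot"

definition weak_solution ::
  "real \<Rightarrow> real \<Rightarrow> real \<Rightarrow> real \<Rightarrow> (real \<Rightarrow> real) \<Rightarrow> real \<Rightarrow> real
     \<Rightarrow> (real \<Rightarrow> real) \<Rightarrow> (real \<Rightarrow> real) \<Rightarrow> bool" where
  "weak_solution q0 K \<alpha> Ti \<phi> \<beta> c T Z \<longleftrightarrow>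
     solution q0 K \<alpha> Ti \<phi> \<beta> c T Z \<and> (T \<longlongrightarrow> T_1 q0 c) at_bot"

definition strong_special ::
  "real \<Rightarrow> real \<Rightarrow> real \<Rightarrow> real \<Rightarrow> (real \<Rightarrow> real) \<Rightarrow> real \<Rightarrow> real
     \<Rightarrow> (real \<Rightarrow> real) \<Rightarrow> (real \<Rightarrow> real) \<Rightarrow> bool" where
  "strong_special q0 K \<alpha> Ti \<phi> \<beta> c T Z \<longleftrightarrow>
     strong_solution q0 K \<alpha> Ti \<phi> \<beta> c T Z \<and>
     (\<exists>l. wave q0 K \<alpha> Ti \<phi> \<beta> c l T Z \<and> (\<forall>\<xi> \<le> - l. T \<xi> = T_0 q0 c))"

definition weak_special ::
  "real \<Rightarrow> real \<Rightarrow> real \<Rightarrow> real \<Rightarrow> (real \<Rightarrow> real) \<Rightarrow> real \<Rightarrow> real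
     \<Rightarrow> (real \<Rightarrow> real) \<Rightarrow> (real \<Rightarrow> real) \<Rightarrow> bool" where
  "weak_special q0 K \<alpha> Ti \<phi> \<beta> c T Z \<longleftrightarrow>
     weak_solution q0 K \<alpha> Ti \<phi> \<beta> c T Z \<and>
     (\<exists>l. wave q0 K \<alpha> Ti \<phi> \<beta> c l T Z \<and> (\<forall>\<xi> \<le> - l. T \<xi> = T_1 q0 c))"

definition exp_convergent_at_bot :: "(real \<Rightarrow> real) \<Rightarrow> real \<Rightarrow> bool" where
  "exp_convergent_at_bot T L \<longleftrightarrow>
     (\<exists>C>0. \<exists>\<kappa>>0. eventually (\<lambda>\<xi>. \<bar>T \<xi> - L\<bar> \<le> C * exp (\<kappa> * \<xi>)) at_bot)"

definition strong_monotonic ::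
  "real \<Rightarrow> real \<Rightarrow> real \<Rightarrow> real \<Rightarrow> (real \<Rightarrow> real) \<Rightarrow> real \<Rightarrow> real
     \<Rightarrow> (real \<Rightarrow> real) \<Rightarrow> (real \<Rightarrow> real) \<Rightarrow> bool" where
  "strong_monotonic q0 K \<alpha> Ti \<phi> \<beta> c T Z \<longleftrightarrow>
     strong_solution q0 K \<alpha> Ti \<phi> \<beta> c T Z \<and>
     \<not> strong_special q0 K \<alpha> Ti \<phi> \<beta> c T Z \<and>
     (mono T \<or> antimono T) \<and>
     exp_convergent_at_bot T (T_0 q0 c)"

definition strong_bump ::
  "real \<Rightarrow> real \<Rightarrow> real \<Rightarrow> real \<Rightarrow> (real \<Rightarrow> real) \<Rightarrow> real \<Rightarrow> real
     \<Rightarrow> (real \<Rightarrow> real) \<Rightarrow> (real \<Rightarrow> real) \<Rightarrow> bool" where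
  "strong_bump q0 K \<alpha> Ti \<phi> \<beta> c T Z \<longleftrightarrow>
     strong_solution q0 K \<alpha> Ti \<phi> \<beta> c T Z \<and>
     \<not> (mono T \<or> antimono T) \<and>
     (\<exists>l m. wave q0 K \<alpha> Ti \<phi> \<beta> c l T Z \<and> - l < m \<and> m < 0 \<and> (\<forall>\<xi>. T \<xi> \<le> T m)) \<and>
     exp_convergent_at_bot T (T_0 q0 c)"

(* "Of class C^k" for a function of the wave speed on an interval whose left endpoint is c_cj:
   C^k in the interior and continuous at the endpoint. One-sided differentiability at c_cj
   cannot be demanded: T_0 and T_1 have a square-root singularity there, and \<beta>_0, \<beta>_1 inherit
   it (their difference quotients tend to -\<infinity> and +\<infinity>). *)
definition class_Ck_speed :: "nat \<Rightarrow> (real \<Rightarrow> real) \<Rightarrow> real set \<Rightarrow> bool" where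
  "class_Ck_speed k f S \<longleftrightarrow> continuous_on S f \<and> Ck_on k f (interior S)"

end

theory Submission
  imports Defs
begin

text \<open>
  In the reaction zone \<open>(Z powr (1 - \<alpha>))' = (1 - \<alpha>) K \<phi>(T)\<close>, so the progress variable
  \<open>y = 1 - Z powr (1 - \<alpha>)\<close> runs from 0 at the ignition front to 1 where the fuel is exhausted, and
  it can replace \<open>\<xi>\<close> as independent variable; then \<open>Z = (1 - y) powr (1 / (1 - \<alpha>))\<close> is a known
  function of \<open>y\<close>. Measuring the temperature by \<open>g = G(T)\<close>, where \<open>G\<close> is the primitive of \<open>\<phi>\<close>
  that vanishes at \<open>Ti\<close>, and writing \<open>b = 1 / (\<beta> K (1 - \<alpha>))\<close>, the wave equations become one scalar
  initial value problem on the unit interval: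
  \<open>g' = b F(c, T, y)\<close>, \<open>g(0) = 0\<close>, with
  \<open>F(c, T, y) = c T - T^2/2 - q0 (1 - Z) = (T - T1) (T0 - T) / 2 + q0 Z\<close>.
  Its solution \<open>sol b c\<close> determines the wave. Ahead of the front and behind the reaction zone the
  temperature solves an explicit logistic equation, so everything depends on where the end value
  \<open>T(1)\<close> lies relative to \<open>T1 = T_1 q0 c\<close> and \<open>T0 = T_0 q0 c\<close>: the special waves are those with
  \<open>T(1)\<close> equal to \<open>T0\<close> or \<open>T1\<close>; above \<open>T0\<close> there is a bump; strictly between them the wave is
  monotonic; below \<open>T1\<close> the burnt gas cools away from both equilibria and there is no wave.

  The end value is controlled by comparison arguments. Since \<open>F > 0\<close> on \<open>T = T0\<close> before the end, a
  profile that reaches \<open>T0\<close> early ends above it; since \<open>F\<close> decreases in \<open>y\<close>, a profile that stops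
  rising below \<open>T1\<close> stays below. Hence \<open>F\<close> is positive along every profile that ends in
  \<open>[T1, T0]\<close> (\<open>F_sol_pos\<close>), and therefore \<open>T(1)\<close> is strictly monotone in \<open>b\<close> across such a
  profile (\<open>sol_compare_b\<close>). The intermediate value theorem in \<open>b\<close> gives exactly one value of \<open>b\<close>,
  called \<open>shoot t c\<close>, that hits a target \<open>t\<close>; \<open>\<beta>0\<close> and \<open>\<beta>1\<close> are the viscosities that belong to the
  targets \<open>T0\<close> and \<open>T1\<close>, and the ordering \<open>\<beta>0 < \<beta>1\<close> and statement (iv) follow. For the absence
  of waves at \<open>\<beta> \<ge> \<beta>1\<close> an arbitrary wave is compared in the variable \<open>\<xi>\<close> with the profile
  belonging to \<open>\<beta>1\<close>.

  For the smoothness of the shooting parameter as a function of \<open>c\<close>, subtract the equations for two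
  speeds. The difference of the two solutions satisfies a linear equation with a continuous
  coefficient (\<open>g_difference\<close>), which is solved by an integrating factor. Evaluating it at \<open>y = 1\<close>
  gives a formula for the difference quotient of \<open>b\<close>, hence for \<open>b'\<close> and for the \<open>c\<close>-derivative of
  the profile, in terms of integrals of \<open>b\<close> and the profile themselves. So if these are
  \<open>k\<close> times differentiable in \<open>c\<close>, then so are their derivatives, as long as \<open>\<phi>\<close> is of class
  \<open>C^k\<close> (\<open>Ck_param_bootstrap\<close>). The sign of \<open>\<beta>1'\<close> can be read off from the same formula. The limits
  of \<open>\<beta>1\<close> at \<open>c_star\<close> and of \<open>\<beta>0\<close> at infinity state that \<open>b\<close> tends to 0: at \<open>c = c_star\<close> one has
  \<open>T1 = Ti\<close>, so that every profile ends above the target; for large \<open>c\<close> the logistic growth rate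
  is of order \<open>c\<close>, and every fixed \<open>b\<close> overshoots.
\<close>

section \<open>Comparison for scalar differential inequalities\<close>

text \<open>The inequality is required only where \<open>w\<close> is negative: on such an interval
  \<open>exp (- L y) w y\<close> is nondecreasing, so \<open>w\<close> cannot become negative after
  the last point where it is not. Because the condition is one-sided, it applies to differences of solutions of an equation that is
  merely Lipschitz.\<close>
lemma comparison_nonneg:
  fixes w d :: "real \<Rightarrow> real"
  assumes "a \<le> b" and cont: "continuous_on {a..b} w"
    and der: "\<And>y. a < y \<Longrightarrow> y < b \<Longrightarrow> (w has_real_derivative d y) (at y)"
    and ineq: "\<And>y. a < y \<Longrightarrow> y < b \<Longrightarrow> w y < 0 \<Longrightarrow> d y \<ge> L * w y"
    and "w a \<ge> 0"
  shows "w b \<ge> 0"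
proof (rule ccontr)
  assume neg: "\<not> w b \<ge> 0"
  define A where "A = {x\<in>{a..b}. w x \<ge> 0}"
  have "closed A"
    unfolding A_def using continuous_closed_preimage[OF cont, of "{0..}"]
    by (simp add: vimage_def Int_def)
  have ne: "A \<noteq> {}" "bdd_above A"
    using assms(1,5) unfolding A_def by (auto intro!: bdd_aboveI[of _ b])
  \<comment> \<open>the last point at which \<open>w\<close> is nonnegative\<close>
  define e where "e = Sup A"
  have "e \<in> A" unfolding e_def using closed_contains_Sup[OF ne \<open>closed A\<close>] .
  hence e: "a \<le> e" "e < b" "w e \<ge> 0" using neg unfolding A_def
    by (auto simp: le_less)
  have lt: "w x < 0" if "e < x" "x \<le> b" for x
  proof (rule ccontr)
    assume "\<not> w x < 0"
    hence "x \<in> A" using that e by (simp add: A_def)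
    hence "x \<le> e" unfolding e_def using cSup_upper ne by blast
    thus False using that by simp
  qed
  have "exp (-L*e) * w e \<le> exp (-L*b) * w b"
  proof (rule DERIV_nonneg_imp_increasing_open[of e b])
    show "e \<le> b" using e by simp
    fix x assume x: "e < x" "x < b"
    have "((\<lambda>x. exp (-L*x) * w x) has_real_derivative exp (-L*x) * (d x - L * w x)) (at x)"
      using der[of x] x e by (auto intro!: derivative_eq_intros simp: algebra_simps)
    moreover have "0 \<le> exp (-L*x) * (d x - L * w x)"
      using ineq[of x] lt[of x] x e by simp
    ultimately show "\<exists>y. ((\<lambda>x. exp (-L*x) * w x) has_real_derivative y) (at x) \<and> 0 \<le> y" by blast
  next
    show "continuous_on {e..b} (\<lambda>x. exp (-L*x) * w x)"
      using cont e by (auto intro!: continuous_intros elim: continuous_on_subset)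
  qed
  moreover have "exp (-L*b) * w b < 0" using neg by (simp add: mult_less_0_iff)
  moreover have "0 \<le> exp (-L*e) * w e" using e(3) by simp
  ultimately show False by linarith
qed

lemma comparison_nonneg_abs:
  fixes w d :: "real \<Rightarrow> real"
  assumes "a \<le> b" and "continuous_on {a..b} w"
    and "\<And>y. a < y \<Longrightarrow> y < b \<Longrightarrow> (w has_real_derivative d y) (at y)"
    and "\<And>y. a < y \<Longrightarrow> y < b \<Longrightarrow> d y \<ge> - L * \<bar>w y\<bar>"
    and "w a \<ge> 0"
  shows "w b \<ge> 0"
proof (rule comparison_nonneg[where L=L and d=d and w=w and a=a])
  fix y assume "a < y" "y < b" "w y < 0"
  thus "L * w y \<le> d y" using assms(4)[of y] by simp
qed (use assms in auto)

text \<open>Where \<open>w\<close> is nonnegative, the strict inequality makes \<open>exp (L y) w y\<close> strictly increasing.\<close>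
lemma comparison_strict:
  fixes w d :: "real \<Rightarrow> real"
  assumes ab: "a < b" and cont: "continuous_on {a..b} w"
    and der: "\<And>y. a < y \<Longrightarrow> y < b \<Longrightarrow> (w has_real_derivative d y) (at y)"
    and ineq: "\<And>y. a < y \<Longrightarrow> y < b \<Longrightarrow> d y > - L * \<bar>w y\<bar>"
    and "w a \<ge> 0"
  shows "w b > 0"
proof -
  have "exp (L*a) * w a < exp (L*b) * w b"
  proof (rule DERIV_pos_imp_increasing_open[OF ab])
    fix x assume x: "a < x" "x < b"
    have "w x \<ge> 0"
    proof (rule comparison_nonneg_abs[of a x w d L])
      show "continuous_on {a..x} w" using cont x by (auto elim: continuous_on_subset)
    qed (use assms x in \<open>auto intro: less_imp_le\<close>)
    hence "0 < exp (L*x) * (d x + L * w x)" using ineq[of x] x by simp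
    moreover have "((\<lambda>x. exp (L*x) * w x) has_real_derivative exp (L*x) * (d x + L * w x)) (at x)"
      using der[of x] x by (auto intro!: derivative_eq_intros simp: algebra_simps)
    ultimately show "\<exists>y. ((\<lambda>x. exp (L*x) * w x) has_real_derivative y) (at x) \<and> 0 < y" by blast
  qed (use assms in \<open>auto intro!: continuous_intros\<close>)
  moreover have "0 \<le> exp (L*a) * w a" using assms by simp
  ultimately have "exp (L * b) * w b > 0" by linarith
  thus ?thesis by (simp add: zero_less_mult_iff)
qed

text \<open>The bound is itself a supersolution: compare \<open>e y exp (L y)\<close> with \<open>w\<close> and with \<open>- w\<close>.\<close>
lemma gronwall:
  fixes w d :: "real \<Rightarrow> real"
  assumes "0 \<le> x" and cont: "continuous_on {0..x} w"
    and der: "\<And>y. 0 < y \<Longrightarrow> y < x \<Longrightarrow> (w has_real_derivative d y) (at y)"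
    and ineq: "\<And>y. 0 < y \<Longrightarrow> y < x \<Longrightarrow> \<bar>d y\<bar> \<le> L * \<bar>w y\<bar> + e"
    and "w 0 = 0" "L \<ge> 0" "e \<ge> 0"
  shows "\<bar>w x\<bar> \<le> e * x * exp (L * x)"
proof -
  have half: "v x \<le> e * x * exp (L * x)" if v: "continuous_on {0..x} v"
     "\<And>y. 0 < y \<Longrightarrow> y < x \<Longrightarrow> (v has_real_derivative d y) (at y)"
     "\<And>y. 0 < y \<Longrightarrow> y < x \<Longrightarrow> \<bar>d y\<bar> \<le> L * \<bar>v y\<bar> + e" "v 0 = 0" for v d
  proof -
    have "0 \<le> e * x * exp (L * x) - v x"
    proof (rule comparison_nonneg[where L=L and a = 0 and b = x and w = "\<lambda>y. e * y * exp (L * y) - v y"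
          and d = "\<lambda>y. e * exp (L*y) + L * (e * y * exp (L*y)) - d y"])
      fix y assume y: "0 < y" "y < x"
      show "((\<lambda>y. e * y * exp (L * y) - v y) has_real_derivative
          e * exp (L*y) + L * (e * y * exp (L*y)) - d y) (at y)"
        using v(2)[OF y] by (auto intro!: derivative_eq_intros simp: algebra_simps)
      assume n: "e * y * exp (L * y) - v y < 0"
      have "0 \<le> e * y * exp (L*y)" using y assms by simp
      hence "\<bar>v y\<bar> = v y" using n by simp
      moreover have "e * 1 \<le> e * exp (L*y)" using y assms by (intro mult_left_mono) auto
      ultimately show "L * (e * y * exp (L * y) - v y) \<le> e * exp (L*y) + L * (e * y * exp (L*y)) - d y"
        using v(3)[OF y] by (simp add: algebra_simps)
    qed (use v assms in \<open>auto intro!: continuous_intros\<close>)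
    thus ?thesis by simp
  qed
  have "w x \<le> e * x * exp (L * x)" by (rule half[of w d]) (use assms in auto)
  moreover have "(\<lambda>y. - w y) x \<le> e * x * exp (L * x)"
    by (rule half[of _ "\<lambda>y. - d y"]) (use assms in \<open>auto intro!: derivative_eq_intros continuous_intros\<close>)
  ultimately show ?thesis by auto
qed

section \<open>Scalar initial value problems and primitives\<close>

text \<open>A Lipschitz right-hand side gives a solution on the whole unit interval in one step
  if the integral operator acts on \<open>u y = exp (- L y) g y\<close>: in the sup norm of \<open>u\<close> it contracts with
  factor \<open>1 - exp (- L)\<close>. Functions on the interval are
  represented by bounded continuous functions on the line through clamping.\<close>
lemma picard_unit_interval:
  fixes f :: "real \<Rightarrow> real \<Rightarrow> real"
  assumes cont: "continuous_on ({0..1} \<times> UNIV) (\<lambda>(y, x). f y x)"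
    and lip: "\<And>y x x'. y \<in> {0..1} \<Longrightarrow> \<bar>f y x - f y x'\<bar> \<le> L * \<bar>x - x'\<bar>" and L: "L > 0"
  shows "\<exists>g. g 0 = 0 \<and> (\<forall>y\<in>{0..1}. (g has_real_derivative f y (g y)) (at y within {0..1}))"
proof -
  \<comment> \<open>the retraction of the line onto the unit interval\<close>
  define cl where "cl y = max 0 (min 1 y)" for y :: real
  have cl: "cl y \<in> {0..1}" "y \<in> {0..1} \<Longrightarrow> cl y = y" for y by (auto simp: cl_def)
  define h where "h u s = f s (exp (L * s) * u s)" for u :: "real \<Rightarrow> real" and s
  define Q where "Q u y = exp (- L * cl y) * integral {0..cl y} (h u)" for u y
  have h_cont: "continuous_on {0..1} (h u)" if "continuous_on UNIV u" for u
    unfolding h_def using that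
    by (intro continuous_on_compose2[OF cont, of _ "\<lambda>s. (s, exp (L * s) * u s)", simplified])
      (auto intro!: continuous_intros elim: continuous_on_subset)
  have h_int: "h u integrable_on {0..cl y}" if "continuous_on UNIV u" for u y
    by (rule integrable_continuous_interval) (use h_cont[OF that] cl(1)[of y] in \<open>auto elim!: continuous_on_subset\<close>)
  have Q_eq: "Q u y = Q u (cl y)" for u y using cl(1)[of y] cl(2)[of "cl y"] by (simp add: Q_def)
  have Q_cont: "continuous_on UNIV (Q u)" if u: "continuous_on UNIV u" for u
  proof -
    have "continuous_on {0..1} (\<lambda>y. integral {0..y} (h u))"
      by (rule indefinite_integral_continuous_1)
        (intro integrable_continuous_interval h_cont u)
    hence "continuous_on UNIV (\<lambda>y. integral {0..cl y} (h u))"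
      by (rule continuous_on_compose2) (use cl in \<open>auto simp: cl_def[abs_def] intro!: continuous_intros\<close>)
    thus ?thesis unfolding Q_def by (auto simp: cl_def[abs_def] intro!: continuous_intros)
  qed
  have Q_b: "Q u \<in> bcontfun" if u: "continuous_on UNIV u" for u
  proof -
    have "compact (Q u ` {0..1})"
      using Q_cont[OF u] by (intro compact_continuous_image) (auto elim: continuous_on_subset)
    moreover have "range (Q u) \<subseteq> Q u ` {0..1}" using Q_eq[of u] cl(1) by (metis image_subsetI rev_image_eqI)
    ultimately show ?thesis using Q_cont[OF u]
      by (auto simp: bcontfun_def intro: bounded_subset compact_imp_bounded)
  qed
  define P where "P u = Bcontfun (Q (apply_bcontfun u))" for u :: "real \<Rightarrow>\<^sub>C real"
  have P: "apply_bcontfun (P u) = Q (apply_bcontfun u)" for u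
    unfolding P_def by (rule Bcontfun_inverse) (rule Q_b, simp)
  have contr: "dist (P u) (P v) \<le> (1 - exp (-L)) * dist u v" for u v
  proof (rule dist_bound)
    fix y
    let ?t = "cl y"
    have t: "0 \<le> ?t" "?t \<le> 1" using cl(1)[of y] by auto
    have eint: "((\<lambda>s. L * exp (L * s) * dist u v) has_integral (exp (L * ?t) - 1) * dist u v) {0..?t}"
    proof -
      have "((\<lambda>s. L * exp (L * s) * dist u v) has_integral exp (L * ?t) * dist u v - exp (L*0) * dist u v) {0..?t}"
        by (rule fundamental_theorem_of_calculus)
          (use t in \<open>auto simp flip: has_real_derivative_iff_has_vector_derivative
            intro!: derivative_eq_intros\<close>)
      thus ?thesis by (simp add: algebra_simps)
    qed
    have "\<bar>integral {0..?t} (h u) - integral {0..?t} (h v)\<bar> = \<bar>integral {0..?t} (\<lambda>s. h u s - h v s)\<bar>"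
      by (subst integral_diff) (auto intro: h_int)
    also have "\<dots> \<le> integral {0..?t} (\<lambda>s. L * exp (L * s) * dist u v)"
    proof -
      have "\<bar>h u s - h v s\<bar> \<le> L * exp (L * s) * dist u v" if s: "s \<in> {0..?t}" for s
      proof -
        have "\<bar>h u s - h v s\<bar> \<le> L * \<bar>exp (L * s) * u s - exp (L * s) * v s\<bar>"
          unfolding h_def using s t by (intro lip) auto
        also have "\<dots> = L * exp (L * s) * dist (u s) (v s)"
          by (simp add: dist_real_def abs_mult flip: right_diff_distrib)
        also have "\<dots> \<le> L * exp (L * s) * dist u v"
          using L by (intro mult_left_mono dist_bounded) auto
        finally show ?thesis .
      qed
      thus ?thesis using h_int[of "apply_bcontfun u" y] h_int[of "apply_bcontfun v" y] eint
        by (intro integral_norm_bound_integral[where 'a=real, unfolded real_norm_def])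
          (auto intro!: integrable_diff simp: has_integral_integrable)
    qed
    also have "\<dots> = (exp (L * ?t) - 1) * dist u v" using eint by (rule integral_unique)
    finally have I: "\<bar>integral {0..?t} (h u) - integral {0..?t} (h v)\<bar> \<le> (exp (L * ?t) - 1) * dist u v" .
    have "dist (P u y) (P v y) = exp (- L * ?t) * \<bar>integral {0..?t} (h u) - integral {0..?t} (h v)\<bar>"
      by (simp add: P Q_def dist_real_def abs_mult flip: right_diff_distrib)
    also have "\<dots> \<le> exp (- L * ?t) * ((exp (L * ?t) - 1) * dist u v)"
      by (rule mult_left_mono[OF I]) simp
    also have "\<dots> = (1 - exp (-L * ?t)) * dist u v"
      by (simp add: algebra_simps flip: exp_add)
    also have "\<dots> \<le> (1 - exp (-L)) * dist u v"
      using t L by (intro mult_right_mono) auto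
    finally show "dist (P u y) (P v y) \<le> (1 - exp (-L)) * dist u v" .
  qed
  obtain u where u: "P u = u"
    using banach_fix_type[of "1 - exp (-L)" P] contr L by auto
  define g where "g y = integral {0..y} (h u)" for y
  have g: "g y = exp (L * y) * u y" if "y \<in> {0..1}" for y
  proof -
    have "u y = exp (- L * y) * g y" using fun_cong[OF P[of u, unfolded u], of y] cl(2)[OF that] unfolding Q_def g_def by simp
    thus ?thesis by (simp add: exp_minus)
  qed
  show ?thesis
  proof (intro exI[of _ g] conjI ballI)
    show "g 0 = 0" by (simp add: g_def)
    fix y :: real assume y: "y \<in> {0..1}"
    have "(g has_real_derivative h u y) (at y within {0..1})"
      unfolding g_def[abs_def] using y by (intro integral_has_real_derivative h_cont) auto
    thus "(g has_real_derivative f y (g y)) (at y within {0..1})"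
      using g[OF y] by (simp add: h_def)
  qed
qed

text \<open>The substitution \<open>s = t y\<close> moves the variable upper limit into the integrand and so reduces
  the claim to an integral over a fixed interval.\<close>
lemma continuous_on_indefinite_integral_param:
  fixes f :: "'a::topological_space \<Rightarrow> real \<Rightarrow> real"
  assumes cont: "continuous_on (U \<times> {0..1}) (\<lambda>(x, y). f x y)"
  shows "continuous_on (U \<times> {0..1}) (\<lambda>(x, y). integral {0..y} (f x))"
proof -
  have eq: "integral {0..y} (f x) = integral (cbox 0 1) (\<lambda>t. y * f x (t * y))"
    if xy: "x \<in> U" "y \<in> {0..1}" for x y
  proof -
    have c: "continuous_on {0..1} (f x)"
      by (rule continuous_on_compose2[OF cont, of _ "\<lambda>y. (x, y)", simplified])
        (use xy in \<open>auto intro!: continuous_intros\<close>)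
    have "((\<lambda>t. y * f x (t * y)) has_integral
            integral {0..1 * y} (f x) - integral {0..0 * y} (f x)) {0..1}"
    proof (rule fundamental_theorem_of_calculus)
      fix t :: real assume t: "t \<in> {0..1}"
      have ty: "t * y \<in> {0..1}" using t xy by (auto intro: mult_le_one)
      have "((\<lambda>t. integral {0..t} (f x)) has_real_derivative f x (t * y)) (at (t * y) within (\<lambda>t. t * y) ` {0..1})"
        by (rule DERIV_subset[OF integral_has_real_derivative[OF c ty]])
          (use xy in \<open>auto intro: mult_le_one\<close>)
      from DERIV_image_chain[OF this, of y]
      have "((\<lambda>t. integral {0..t * y} (f x)) has_real_derivative f x (t * y) * y) (at t within {0..1})"
        by (simp add: o_def DERIV_cmult_Id[of y, unfolded mult.commute[of y]])
      thus "((\<lambda>t. integral {0..t * y} (f x)) has_vector_derivative y * f x (t * y)) (at t within {0..1})"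
        by (simp add: has_real_derivative_iff_has_vector_derivative mult.commute)
    qed simp
    hence "((\<lambda>t. y * f x (t * y)) has_integral integral {0..y} (f x)) (cbox 0 1)" by simp
    thus ?thesis by (rule integral_unique[symmetric])
  qed
  have "continuous_on (U \<times> {0..1}) (\<lambda>z. integral (cbox 0 1) (\<lambda>t. snd z * f (fst z) (t * snd z)))"
  proof (rule integral_continuous_on_param)
    have "continuous_on ((U \<times> {0..1}) \<times> cbox 0 1) (\<lambda>w. case (fst (fst w), snd w * snd (fst w)) of (x, y) \<Rightarrow> f x y)"
      by (rule continuous_on_compose2[OF cont]) (auto intro!: continuous_intros intro: mult_le_one)
    thus "continuous_on ((U \<times> {0..1}) \<times> cbox 0 (1::real)) (\<lambda>(z, t). snd z * f (fst z) (t * snd z))"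
      by (auto simp: case_prod_beta intro!: continuous_intros)
  qed
  thus ?thesis
    by (rule continuous_on_cong[THEN iffD1, rotated -1]) (auto simp: eq)
qed

lemma continuous_on_integral_unit_param:
  fixes f :: "'a::topological_space \<Rightarrow> real \<Rightarrow> real"
  assumes cont: "continuous_on (U \<times> {0..1}) (\<lambda>(x, y). f x y)"
  shows "continuous_on U (\<lambda>x. integral {0..1} (f x))"
  using integral_continuous_on_param[of U 0 "1::real" f] assms by simp

text \<open>\<open>S\<close> inverts the primitive \<open>G\<close> of a density \<open>h \<ge> m > 0\<close> on \<open>[a, \<infinity>)\<close>. The construction is used twice:
  for the change of the temperature scale (with \<open>h = \<phi>\<close>) and for the return from the progress
  variable to space.\<close>
definition inverse_of_primitive ::
  "real \<Rightarrow> (real \<Rightarrow> real) \<Rightarrow> real \<Rightarrow> (real \<Rightarrow> real) \<Rightarrow> (real \<Rightarrow> real) \<Rightarrow> bool" where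
  "inverse_of_primitive a h m G S \<longleftrightarrow> S 0 = a \<and> (\<forall>g\<ge>0. S g \<ge> a \<and> G (S g) = g) \<and> (\<forall>t\<ge>a. G t \<ge> 0 \<and> S (G t) = t)
     \<and> (\<forall>g\<ge>0. \<forall>g'\<ge>0. \<bar>S g - S g'\<bar> \<le> \<bar>g - g'\<bar> / m)
     \<and> (\<forall>g\<ge>0. \<forall>g'. g < g' \<longrightarrow> S g < S g')
     \<and> (\<forall>t\<ge>a. (G has_real_derivative h t) (at t within {a..}))
     \<and> (\<forall>g\<ge>0. (S has_real_derivative 1 / h (S g)) (at g within {0..}))"

lemma inverse_of_primitive_exists:
  fixes h :: "real \<Rightarrow> real"
  assumes cont: "continuous_on {a..} h" and m: "m > 0" and hm: "\<And>t. t \<ge> a \<Longrightarrow> h t \<ge> m"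
  defines "G \<equiv> \<lambda>t. integral {a..t} h"
  shows "\<exists>S. inverse_of_primitive a h m G S"
proof -
  have contab: "continuous_on {a..t} h" for t using cont by (auto elim: continuous_on_subset)
  have Gd: "(G has_real_derivative h t) (at t within {a..})" if "t \<ge> a" for t
  proof -
    have "(G has_real_derivative h t) (at t within {a..t+1})"
      unfolding G_def by (rule integral_has_real_derivative[OF contab]) (use that in auto)
    moreover have "at t within {a..t+1} = at t within {a..}"
      by (rule at_within_nhd[of t "{..<t+1}"]) auto
    ultimately show ?thesis by simp
  qed
  have Gm: "G t' - G t \<ge> m * (t' - t)" if "a \<le> t" "t \<le> t'" for t t'
  proof -
    have "G t' = G t + integral {t..t'} h" unfolding G_def
      using that by (intro Henstock_Kurzweil_Integration.integral_combine[symmetric]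
          integrable_continuous_interval contab) auto
    moreover have "integral {t..t'} h \<ge> integral {t..t'} (\<lambda>_. m)"
      using that hm by (intro integral_le integrable_continuous_interval)
        (auto intro!: continuous_intros continuous_on_subset[OF cont])
    ultimately show ?thesis using that by (simp add: mult.commute)
  qed
  have Ga: "G a = 0" by (simp add: G_def)
  have Gcont: "continuous_on {a..} G"
    using Gd by (intro DERIV_continuous_on) auto
  have Gmono: "G t < G t'" if "a \<le> t" "t < t'" for t t'
  proof -
    have "0 < m * (t' - t)" using that m by simp
    thus ?thesis using Gm[of t t'] that by linarith
  qed
  have ex: "\<exists>t\<ge>a. G t = g" if g: "g \<ge> 0" for g
  proof -
    have "G (a + g/m) \<ge> g" using Gm[of a "a + g/m"] g m by (simp add: Ga)
    then obtain t where "a \<le> t" "t \<le> a + g/m" "G t = g"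
      using IVT'[of G a g "a + g/m"] g m Ga continuous_on_subset[OF Gcont, of "{a..a+g/m}"] by auto
    thus ?thesis by auto
  qed
  define S where "S g = (SOME t. t \<ge> a \<and> G t = g)" for g
  have S: "S g \<ge> a" "G (S g) = g" if "g \<ge> 0" for g
    using someI_ex[of "\<lambda>t. t \<ge> a \<and> G t = g"] ex[OF that] unfolding S_def by auto
  have Gpos: "G t \<ge> 0" if "t \<ge> a" for t using Gmono[of a t] Ga that by (cases "t = a") auto
  have inj: "t = t'" if "t \<ge> a" "t' \<ge> a" "G t = G t'" for t t'
    using Gmono[of t t'] Gmono[of t' t] that by (cases t t' rule: linorder_cases) auto
  have SG: "S (G t) = t" if "t \<ge> a" for t
    using S[OF Gpos[OF that]] inj that by auto
  have Smono: "S g < S g'" if "0 \<le> g" "g < g'" for g g'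
  proof (rule ccontr)
    assume "\<not> ?thesis"
    hence "S g' = S g \<or> S g' < S g" by auto
    thus False using Gmono[of "S g'" "S g"] S[of g] S[of g'] that by auto
  qed
  have Slip: "\<bar>S g - S g'\<bar> \<le> \<bar>g - g'\<bar> / m" if "0 \<le> g" "0 \<le> g'" for g g'
  proof -
    have *: "\<bar>S g - S g'\<bar> \<le> \<bar>g - g'\<bar> / m" if "0 \<le> g" "g \<le> g'" for g g'
    proof -
      have "S g \<le> S g'" using Smono[of g g'] that by (cases "g = g'") auto
      thus ?thesis using Gm[of "S g" "S g'"] S[of g] S[of g'] that m by (auto simp: field_simps)
    qed
    show ?thesis using *[of g g'] *[of g' g] that by (cases "g \<le> g'") (auto simp: abs_minus_commute)
  qed
  have Scont: "continuous_on {0..} S"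
  proof (rule continuous_onI)
    fix g e :: real assume g: "g \<in> {0..}" and "e > 0"
    show "\<exists>d>0. \<forall>g'\<in>{0..}. dist g' g < d \<longrightarrow> dist (S g') (S g) \<le> e"
    proof (intro exI[of _ "e * m"] conjI ballI impI)
      fix g' assume g': "g' \<in> {0..}" "dist g' g < e * m"
      have "dist (S g') (S g) \<le> \<bar>g' - g\<bar> / m" using Slip[of g' g] g g' by (simp add: dist_real_def)
      also have "\<dots> \<le> e" using g' m by (simp add: dist_real_def divide_le_eq)
      finally show "dist (S g') (S g) \<le> e" .
    qed (use m \<open>e > 0\<close> in auto)
  qed
  have Sd: "(S has_real_derivative 1 / h (S g)) (at g within {0..})" if g: "g \<ge> 0" for g
  proof -
    have "((\<lambda>t. (G t - G (S g)) / (t - S g)) \<longlongrightarrow> h (S g)) (at (S g) within {a..})"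
      using Gd[OF S(1)[OF g]] by (simp add: has_field_derivative_iff)
    moreover have "filterlim S (at (S g) within {a..}) (at g within {0..})"
    proof -
      have "(S \<longlongrightarrow> S g) (at g within {0..})" using Scont g by (auto simp: continuous_on_def)
      moreover have "\<forall>\<^sub>F x in at g within {0..}. S x \<in> {a..} \<and> S x \<noteq> S g"
        unfolding eventually_at_filter
        by (rule always_eventually) (use S g in \<open>metis atLeast_iff\<close>)
      ultimately show ?thesis by (simp add: filterlim_at)
    qed
    ultimately have "((\<lambda>x. (G (S x) - G (S g)) / (S x - S g)) \<longlongrightarrow> h (S g)) (at g within {0..})"
      by (rule filterlim_compose)
    moreover have "\<forall>\<^sub>F x in at g within {0..}. (G (S x) - G (S g)) / (S x - S g) = (x - g) / (S x - S g)"
      unfolding eventually_at_filter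
      by (rule always_eventually) (use S g in auto)
    ultimately have "((\<lambda>x. (x - g) / (S x - S g)) \<longlongrightarrow> h (S g)) (at g within {0..})"
      by (rule Lim_transform_eventually)
    hence "((\<lambda>x. inverse ((x - g) / (S x - S g))) \<longlongrightarrow> inverse (h (S g))) (at g within {0..})"
      using hm[OF S(1)[OF g]] m by (intro tendsto_inverse) auto
    thus ?thesis by (simp add: has_field_derivative_iff inverse_eq_divide)
  qed
  have "S 0 = a" using SG[of a] Ga by simp
  thus ?thesis using S SG Gpos Slip Smono Gd Sd unfolding inverse_of_primitive_def by (intro exI[of _ S]) blast
qed

section \<open>Differentiability with respect to a parameter\<close>

text \<open>Functions \<open>u c y\<close> with \<open>y\<close> in the unit interval that are \<open>k\<close> times differentiable in \<open>c\<close>, all these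
  derivatives being jointly continuous.\<close>
primrec Ck_param :: "nat \<Rightarrow> real set \<Rightarrow> (real \<Rightarrow> real \<Rightarrow> real) \<Rightarrow> bool" where
  "Ck_param 0 I u \<longleftrightarrow> continuous_on (I \<times> {0..1}) (\<lambda>(c, y). u c y)"
| "Ck_param (Suc k) I u \<longleftrightarrow> continuous_on (I \<times> {0..1}) (\<lambda>(c, y). u c y) \<and>
     (\<exists>u'. (\<forall>c\<in>I. \<forall>y\<in>{0..1}. ((\<lambda>c. u c y) has_real_derivative u' c y) (at c)) \<and> Ck_param k I u')"

lemma Ck_on_continuous: "Ck_on k h A \<Longrightarrow> continuous_on A h"
  by (cases k) (auto intro: DERIV_continuous_on)

lemma Ck_on_Suc_imp: "Ck_on (Suc k) h A \<Longrightarrow> Ck_on k h A"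
proof (induction k arbitrary: h)
  case 0 show ?case using Ck_on_continuous[OF 0] by simp
next
  case (Suc k)
  from Suc.prems obtain h' where "\<forall>x\<in>A. (h has_real_derivative h' x) (at x within A)" "Ck_on (Suc k) h' A"
    by (subst (asm) Ck_on.simps(2)) blast
  thus ?case using Suc.IH[of h'] by auto
qed

lemma Ck_param_continuous:
  "Ck_param k I u \<Longrightarrow> continuous_on (I \<times> {0..1}) (\<lambda>(c, y). u c y)"
  by (cases k) auto

lemma Ck_param_Suc_imp: "Ck_param (Suc k) I u \<Longrightarrow> Ck_param k I u"
proof (induction k arbitrary: u)
  case 0 thus ?case by simp
next
  case (Suc k)
  from Suc.prems obtain u' where "continuous_on (I \<times> {0..1}) (\<lambda>(c, y). u c y)"
    "\<forall>c\<in>I. \<forall>y\<in>{0..1}. ((\<lambda>c. u c y) has_real_derivative u' c y) (at c)" "Ck_param (Suc k) I u'"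
    by (subst (asm) Ck_param.simps(2)) blast
  thus ?case using Suc.IH[of u'] by (subst Ck_param.simps(2)) blast
qed

lemma Ck_param_cong:
  assumes "open I" and eq: "\<And>c y. c \<in> I \<Longrightarrow> y \<in> {0..1} \<Longrightarrow> u c y = v c y" and u: "Ck_param k I u"
  shows "Ck_param k I v"
proof -
  have cont_v: "continuous_on (I \<times> {0..1}) (\<lambda>(c, y). v c y)"
    by (rule continuous_on_cong[THEN iffD1, OF _ _ Ck_param_continuous[OF u]]) (auto simp: eq)
  have der_v: "((\<lambda>c. v c y) has_real_derivative d) (at c)"
    if "((\<lambda>c. u c y) has_real_derivative d) (at c)" "c \<in> I" "y \<in> {0..1}" for c y d
    by (rule has_field_derivative_transform_within_open[OF that(1) \<open>open I\<close> that(2)]) (use eq that in auto)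
  show ?thesis
  proof (cases k)
    case 0 thus ?thesis using cont_v by simp
  next
    case (Suc n)
    then obtain u' where "\<forall>c\<in>I. \<forall>y\<in>{0..1}. ((\<lambda>c. u c y) has_real_derivative u' c y) (at c)" "Ck_param n I u'"
      using u by auto
    thus ?thesis using cont_v der_v Suc by (auto intro!: exI[of _ u'])
  qed
qed

lemma Ck_param_indep:
  "continuous_on {0..1} v \<Longrightarrow> Ck_param k I (\<lambda>c y. v y)"
proof (induction k arbitrary: v)
  case 0
  have "continuous_on (I \<times> {0..1}) (\<lambda>z. v (snd z))"
    by (rule continuous_on_compose2[OF 0]) (auto intro!: continuous_intros)
  thus ?case by (simp add: case_prod_beta)
next
  case (Suc k)
  have "continuous_on (I \<times> {0..1}) (\<lambda>z. v (snd z))"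
    by (rule continuous_on_compose2[OF Suc.prems]) (auto intro!: continuous_intros)
  moreover have "Ck_param k I (\<lambda>c y. 0)" using Suc.IH[of "\<lambda>_. 0"] by simp
  ultimately show ?case by (auto simp: case_prod_beta intro!: exI[of _ "\<lambda>c y. 0"])
qed

lemma Ck_param_const: "Ck_param k I (\<lambda>c y. v)"
  using Ck_param_indep[of "\<lambda>_. v"] by simp

lemma Ck_param_param: "Ck_param k I (\<lambda>c y. c)"
  by (cases k) (auto simp: case_prod_beta intro!: continuous_intros exI[of _ "\<lambda>c y. 1"] Ck_param_const)

lemma Ck_param_add:
  "Ck_param k I u \<Longrightarrow> Ck_param k I v \<Longrightarrow> Ck_param k I (\<lambda>c y. u c y + v c y)"
proof (induction k arbitrary: u v)
  case 0 thus ?case by (auto simp: case_prod_beta intro!: continuous_intros)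
next
  case (Suc k)
  from Suc.prems obtain u' v' where
    "\<forall>c\<in>I. \<forall>y\<in>{0..1}. ((\<lambda>c. u c y) has_real_derivative u' c y) (at c)" "Ck_param k I u'"
    "\<forall>c\<in>I. \<forall>y\<in>{0..1}. ((\<lambda>c. v c y) has_real_derivative v' c y) (at c)" "Ck_param k I v'" by auto
  thus ?case using Suc.prems Suc.IH[of u' v']
    by (auto simp: case_prod_beta intro!: continuous_intros exI[of _ "\<lambda>c y. u' c y + v' c y"] derivative_intros)
qed

lemma Ck_param_mult:
  "Ck_param k I u \<Longrightarrow> Ck_param k I v \<Longrightarrow> Ck_param k I (\<lambda>c y. u c y * v c y)"
proof (induction k arbitrary: u v)
  case 0 thus ?case by (auto simp: case_prod_beta intro!: continuous_intros)
next
  case (Suc k)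
  from Suc.prems obtain u' v' where d:
    "\<forall>c\<in>I. \<forall>y\<in>{0..1}. ((\<lambda>c. u c y) has_real_derivative u' c y) (at c)" "Ck_param k I u'"
    "\<forall>c\<in>I. \<forall>y\<in>{0..1}. ((\<lambda>c. v c y) has_real_derivative v' c y) (at c)" "Ck_param k I v'" by auto
  have "Ck_param k I (\<lambda>c y. u' c y * v c y + v' c y * u c y)"
    using Suc.prems[THEN Ck_param_Suc_imp] d by (intro Ck_param_add Suc.IH)
  thus ?case using Suc.prems d
    by (auto simp: case_prod_beta intro!: continuous_intros DERIV_mult
        exI[of _ "\<lambda>c y. u' c y * v c y + v' c y * u c y"])
qed

lemma Ck_param_minus: "Ck_param k I u \<Longrightarrow> Ck_param k I (\<lambda>c y. - u c y)"
  using Ck_param_mult[OF Ck_param_const[of k I "-1"], of u] by simp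

lemma Ck_param_diff:
  "Ck_param k I u \<Longrightarrow> Ck_param k I v \<Longrightarrow> Ck_param k I (\<lambda>c y. u c y - v c y)"
  using Ck_param_add[OF _ Ck_param_minus, of k I u v] by simp

text \<open>The outer function may live on a set with boundary, such as \<open>[Ti, \<infinity>)\<close>: a value on the boundary
  is harmless since \<open>u\<close> maps a neighbourhood into the set and one-sided derivatives chain.\<close>
lemma Ck_param_compose:
  assumes "open I"
  shows "Ck_on k h A \<Longrightarrow> Ck_param k I u \<Longrightarrow> (\<And>c y. c \<in> I \<Longrightarrow> y \<in> {0..1} \<Longrightarrow> u c y \<in> A)
    \<Longrightarrow> Ck_param k I (\<lambda>c y. h (u c y))"
proof (induction k arbitrary: h)
  case 0
  have "continuous_on (I \<times> {0..1}) (\<lambda>z. h (case z of (c, y) \<Rightarrow> u c y))"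
    by (rule continuous_on_compose2[of A h]) (use 0 in auto)
  thus ?case by (simp add: case_prod_beta)
next
  case (Suc k)
  have "continuous_on (I \<times> {0..1}) (\<lambda>z. h (case z of (c, y) \<Rightarrow> u c y))"
    by (rule continuous_on_compose2[of A h])
      (use Suc.prems(3) Ck_on_continuous[OF Suc.prems(1)] Ck_param_continuous[OF Suc.prems(2)] in auto)
  hence c: "continuous_on (I \<times> {0..1}) (\<lambda>(c, y). h (u c y))" by (simp add: case_prod_beta)
  from Suc.prems(2) obtain u' where u': "\<forall>c\<in>I. \<forall>y\<in>{0..1}. ((\<lambda>c. u c y) has_real_derivative u' c y) (at c)"
    "Ck_param k I u'" by auto
  from Suc.prems(1) obtain h' where h': "\<forall>x\<in>A. (h has_real_derivative h' x) (at x within A)" "Ck_on k h' A"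
    by auto
  note d = u'(1)[rule_format] u'(2) h'(1)[rule_format] h'(2)
  have "Ck_param k I (\<lambda>c y. h' (u c y) * u' c y)"
    by (rule Ck_param_mult[OF Suc.IH[OF d(4) Ck_param_Suc_imp[OF Suc.prems(2)] Suc.prems(3)] d(2)])
  moreover have "((\<lambda>c. h (u c y)) has_real_derivative h' (u c y) * u' c y) (at c)"
    if cy: "c \<in> I" "y \<in> {0..1}" for c y
  proof -
    have "(h has_real_derivative h' (u c y)) (at (u c y) within (\<lambda>c. u c y) ` I)"
      by (rule DERIV_subset[OF d(3)]) (use Suc.prems(3) cy in auto)
    moreover have "((\<lambda>c. u c y) has_real_derivative u' c y) (at c within I)"
      using d(1)[OF cy] by (rule has_field_derivative_at_within)
    ultimately have "((\<lambda>c. h (u c y)) has_real_derivative h' (u c y) * u' c y) (at c within I)"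
      using DERIV_image_chain[of h "h' (u c y)" "\<lambda>c. u c y" c I] by (simp add: o_def)
    thus ?thesis using at_within_open[OF cy(1) \<open>open I\<close>] by simp
  qed
  ultimately show ?case using c by (auto intro!: exI[of _ "\<lambda>c y. h' (u c y) * u' c y"])
qed

text \<open>Leibniz' rule, applied once per derivative.\<close>
lemma Ck_param_integral:
  assumes "open I"
  shows "Ck_param k I u \<Longrightarrow> Ck_param k I (\<lambda>c y. integral {0..y} (u c))"
proof (induction k arbitrary: u)
  case 0 thus ?case using continuous_on_indefinite_integral_param[of I u] by simp
next
  case (Suc k)
  from Suc.prems obtain u' where u': "\<forall>c\<in>I. \<forall>y\<in>{0..1}. ((\<lambda>c. u c y) has_real_derivative u' c y) (at c)"
    "Ck_param k I u'" by auto
  note d = u'(1)[rule_format] u'(2)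
  have cont: "continuous_on (I \<times> {0..1}) (\<lambda>(c, y). u c y)" using Suc.prems by simp
  have "((\<lambda>c. integral {0..y} (u c)) has_real_derivative integral {0..y} (u' c)) (at c)"
    if cy: "c \<in> I" "y \<in> {0..1}" for c y
  proof -
    obtain e where e: "e > 0" "ball c e \<subseteq> I" using \<open>open I\<close> cy open_contains_ball by blast
    have "((\<lambda>c. integral (cbox 0 y) (u c)) has_field_derivative integral (cbox 0 y) (u' c)) (at c within ball c e)"
    proof (rule leibniz_rule_field_derivative)
      fix x t assume xt: "x \<in> ball c e" "t \<in> cbox 0 y"
      show "((\<lambda>x. u x t) has_real_derivative u' x t) (at x within ball c e)"
        by (rule has_field_derivative_at_within[OF d(1)]) (use xt e cy in auto)
    next
      fix x assume x: "x \<in> ball c e"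
      have "continuous_on {0..y} (\<lambda>t. case (x, t) of (c, y) \<Rightarrow> u c y)"
        by (rule continuous_on_compose2[OF cont]) (use x e cy in \<open>auto intro!: continuous_intros\<close>)
      thus "u x integrable_on cbox 0 y" using integrable_continuous_real by simp
    next
      show "continuous_on (ball c e \<times> cbox 0 y) (\<lambda>(x, t). u' x t)"
        using e cy by (intro continuous_on_subset[OF Ck_param_continuous[OF d(2)]]) auto
    qed (use e in auto)
    thus ?thesis using e at_within_open[of c "ball c e"] by simp
  qed
  thus ?case using continuous_on_indefinite_integral_param[of I u] cont Suc.IH[OF d(2)]
    by (auto intro!: exI[of _ "\<lambda>c y. integral {0..y} (u' c)"])
qed

lemma Ck_param_eval_1:
  "Ck_param k I u \<Longrightarrow> Ck_param k I (\<lambda>c y. u c 1)"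
proof -
  have *: "continuous_on (I \<times> {0..1}) (\<lambda>z. v (fst z) 1)"
    if "continuous_on (I \<times> {0..1}) (\<lambda>(c, y). v c y)" for v :: "real \<Rightarrow> real \<Rightarrow> real"
  proof -
    have "continuous_on (I \<times> {0..1}) (\<lambda>z. case (fst z, 1) of (c, y) \<Rightarrow> v c y)"
      by (rule continuous_on_compose2[OF that]) (auto intro!: continuous_intros)
    thus ?thesis by simp
  qed
  show "Ck_param k I u \<Longrightarrow> Ck_param k I (\<lambda>c y. u c 1)"
  proof (induction k arbitrary: u)
    case 0 thus ?case using *[of u] by (simp add: case_prod_beta)
  next
    case (Suc k)
    then obtain u' where "\<forall>c\<in>I. \<forall>y\<in>{0..1}. ((\<lambda>c. u c y) has_real_derivative u' c y) (at c)" "Ck_param k I u'"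
      by auto
    thus ?case using *[of u] Suc.prems Suc.IH[of u']
      by (auto simp: case_prod_beta intro!: exI[of _ "\<lambda>c y. u' c 1"])
  qed
qed

lemma Ck_param_imp_Ck_on:
  assumes "open I" shows "Ck_param k I u \<Longrightarrow> Ck_on k (\<lambda>c. u c 1) I"
proof (induction k arbitrary: u)
  case 0
  have "continuous_on I (\<lambda>c. case (c, 1) of (c, y) \<Rightarrow> u c y)"
    by (rule continuous_on_compose2[of "I \<times> {0..1}"]) (use 0 in \<open>auto intro!: continuous_intros\<close>)
  thus ?case by simp
next
  case (Suc k)
  then obtain u' where "\<forall>c\<in>I. \<forall>y\<in>{0..1}. ((\<lambda>c. u c y) has_real_derivative u' c y) (at c)" "Ck_param k I u'"
    by auto
  thus ?case using Suc.IH[of u'] by (auto intro!: exI[of _ "\<lambda>c. u' c 1"] intro: has_field_derivative_at_within)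
qed

lemma Ck_on_cmult: "Ck_on k h A \<Longrightarrow> Ck_on k (\<lambda>x. r * h x) A"
proof (induction k arbitrary: h)
  case 0 thus ?case by (auto intro!: continuous_intros)
next
  case (Suc k)
  then obtain h' where "\<forall>x\<in>A. (h has_real_derivative h' x) (at x within A)" "Ck_on k h' A" by auto
  thus ?case using Suc.IH[of h'] by (auto intro!: exI[of _ "\<lambda>x. r * h' x"] DERIV_cmult)
qed

text \<open>Real powers are closed under differentiation up to a factor, which yields square roots and
  reciprocals at once.\<close>
lemma Ck_on_powr: "Ck_on k (\<lambda>x. x powr r) {0<..}"
proof (induction k arbitrary: r)
  case 0 thus ?case by (auto intro!: continuous_intros)
next
  case (Suc k)
  have "((\<lambda>x. x powr r) has_real_derivative r * x powr (r - 1)) (at x within {0<..})" if "x > 0" for x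
    by (rule has_field_derivative_at_within[OF has_real_derivative_powr[OF that]])
  thus ?case using Ck_on_cmult[OF Suc[of "r-1"], of r]
    by (auto intro!: exI[of _ "\<lambda>x. r * x powr (r - 1)"])
qed

lemma Ck_on_exp: "Ck_on k exp A"
  by (induction k) (auto intro!: continuous_intros exI[of _ exp] has_field_derivative_at_within[OF DERIV_exp])

lemma Ck_param_inverse:
  assumes "open I" "Ck_param k I u" and pos: "\<And>c y. c \<in> I \<Longrightarrow> y \<in> {0..1} \<Longrightarrow> u c y > 0"
  shows "Ck_param k I (\<lambda>c y. inverse (u c y))"
proof (rule Ck_param_cong[OF \<open>open I\<close>])
  show "Ck_param k I (\<lambda>c y. u c y powr (-1))"
    by (rule Ck_param_compose[OF \<open>open I\<close> Ck_on_powr assms(2)]) (use pos in auto)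
qed (use pos in \<open>auto simp: powr_minus less_imp_le\<close>)

lemma Ck_param_divide:
  assumes "open I" "Ck_param k I v" "Ck_param k I u" "\<And>c y. c \<in> I \<Longrightarrow> y \<in> {0..1} \<Longrightarrow> u c y > 0"
  shows "Ck_param k I (\<lambda>c y. v c y / u c y)"
  unfolding divide_inverse by (intro Ck_param_mult Ck_param_inverse assms)

lemma Ck_param_sqrt:
  assumes "open I" "Ck_param k I u" and pos: "\<And>c y. c \<in> I \<Longrightarrow> y \<in> {0..1} \<Longrightarrow> u c y > 0"
  shows "Ck_param k I (\<lambda>c y. sqrt (u c y))"
proof (rule Ck_param_cong[OF \<open>open I\<close>])
  show "Ck_param k I (\<lambda>c y. u c y powr (1/2))"
    by (rule Ck_param_compose[OF \<open>open I\<close> Ck_on_powr assms(2)]) (use pos in auto)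
qed (use pos in \<open>auto simp: powr_half_sqrt less_imp_le\<close>)

section \<open>The reaction zone as an initial value problem\<close>

text \<open>The two bounds on \<open>\<phi>\<close> hold because \<open>\<phi>\<close> is positive and continuous on \<open>[Ti, \<infinity>)\<close> with a positive limit
  at infinity (\<open>ignition_rate_bounds\<close>); they make the temperature scale \<open>G\<close> bi-Lipschitz.\<close>
locale reactive_flow =
  fixes q0 K \<alpha> Ti m M :: real and \<phi> :: "real \<Rightarrow> real"
  assumes q0: "q0 > 0" and K: "K > 0" and \<alpha>0: "0 \<le> \<alpha>" and \<alpha>1: "\<alpha> < 1"
    and Ti: "0 < Ti" and Ti_less: "Ti < sqrt (2 * q0)"
    and \<phi>_cont: "continuous_on {Ti..} \<phi>" and m: "m > 0"
    and \<phi>_ge: "\<And>T. T \<ge> Ti \<Longrightarrow> \<phi> T \<ge> m" and \<phi>_le: "\<And>T. T \<ge> Ti \<Longrightarrow> \<phi> T \<le> M"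
begin

definition G where "G T = integral {Ti..T} \<phi>"

definition S where "S = (SOME S. inverse_of_primitive Ti \<phi> m G S)"

lemma S_spec: "inverse_of_primitive Ti \<phi> m G S"
proof -
  have "\<exists>S. inverse_of_primitive Ti \<phi> m G S"
    unfolding G_def[abs_def] using inverse_of_primitive_exists[OF \<phi>_cont m \<phi>_ge] .
  thus ?thesis unfolding S_def by (rule someI_ex)
qed

lemma S_0: "S 0 = Ti" and S_ge: "g \<ge> 0 \<Longrightarrow> S g \<ge> Ti" and G_S: "g \<ge> 0 \<Longrightarrow> G (S g) = g"
  and G_nonneg: "t \<ge> Ti \<Longrightarrow> G t \<ge> 0" and S_G: "t \<ge> Ti \<Longrightarrow> S (G t) = t"
  and S_lipschitz: "g \<ge> 0 \<Longrightarrow> g' \<ge> 0 \<Longrightarrow> \<bar>S g - S g'\<bar> \<le> \<bar>g - g'\<bar> / m"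
  and S_strict: "g \<ge> 0 \<Longrightarrow> g < g' \<Longrightarrow> S g < S g'"
  and G_deriv: "t \<ge> Ti \<Longrightarrow> (G has_real_derivative \<phi> t) (at t within {Ti..})"
  and S_deriv: "g \<ge> 0 \<Longrightarrow> (S has_real_derivative 1 / \<phi> (S g)) (at g within {0..})"
  using S_spec unfolding inverse_of_primitive_def by simp_all

lemma S_mono: "g \<ge> 0 \<Longrightarrow> g \<le> g' \<Longrightarrow> S g \<le> S g'"
  using S_strict[of g g'] by (cases "g = g'") auto

lemma S_less_iff: "g \<ge> 0 \<Longrightarrow> g' \<ge> 0 \<Longrightarrow> S g < S g' \<longleftrightarrow> g < g'"
  using S_strict[of g g'] S_mono[of g' g] by linarith

lemma S_gt: "g > 0 \<Longrightarrow> S g > Ti" using S_strict[of 0 g] S_0 by simp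

lemma G_less_iff: "t \<ge> Ti \<Longrightarrow> t' \<ge> Ti \<Longrightarrow> G t < G t' \<longleftrightarrow> t < t'"
  using S_less_iff[of "G t" "G t'"] G_nonneg S_G by auto

lemma G_le_iff: "t \<ge> Ti \<Longrightarrow> t' \<ge> Ti \<Longrightarrow> G t \<le> G t' \<longleftrightarrow> t \<le> t'"
  using G_less_iff[of t' t] by linarith

lemma G_Ti: "G Ti = 0" by (simp add: G_def)

lemma G_cont: "continuous_on {Ti..} G" using G_deriv by (intro DERIV_continuous_on) auto

lemma S_cont: "continuous_on {0..} S" using S_deriv by (intro DERIV_continuous_on) auto

definition p where "p = 1 / (1 - \<alpha>)"

lemma p_pos: "p > 0" using \<alpha>1 by (simp add: p_def)

text \<open>The mass fraction as a function of the progress variable.\<close>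
definition Zf where "Zf y = (1 - y) powr p"

lemma Zf_0: "Zf 0 = 1" and Zf_1: "Zf 1 = 0" by (auto simp: Zf_def)

lemma Zf_nonneg: "Zf y \<ge> 0" by (simp add: Zf_def)

lemma Zf_pos: "y < 1 \<Longrightarrow> Zf y > 0" by (simp add: Zf_def)

lemma Zf_antimono: "y \<le> y' \<Longrightarrow> y' \<le> 1 \<Longrightarrow> Zf y' \<le> Zf y"
  using p_pos unfolding Zf_def by (intro powr_mono2) auto

lemma Zf_le_1: "0 \<le> y \<Longrightarrow> y \<le> 1 \<Longrightarrow> Zf y \<le> 1"
  using Zf_antimono[of 0 y] Zf_0 by simp

lemma Zf_cont: "continuous_on {..1} Zf"
  unfolding Zf_def[abs_def] using p_pos by (intro continuous_on_powr') (auto intro!: continuous_intros)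

text \<open>In the wave equations \<open>\<beta> T_\<xi> = - F c T y\<close>, so \<open>F > 0\<close> means that the temperature rises towards the
  burnt side.\<close>
definition F where "F c T y = c * T - T\<^sup>2 / 2 - q0 * (1 - Zf y)"

lemma c_cj: "c_cj q0 > 0" "Ti < c_cj q0" "(c_cj q0)\<^sup>2 = 2 * q0"
  using q0 Ti_less by (auto simp: c_cj_def)

context
  fixes c assumes c: "c \<ge> c_cj q0"
begin

lemma c_pos: "c > 0" and Ti_less_c: "Ti < c" using c c_cj by auto

lemma disc_nonneg: "c\<^sup>2 - 2 * q0 \<ge> 0"
  using c c_cj power_mono[OF c, of 2] by auto

lemma T01: "T_1 q0 c \<le> c" "c \<le> T_0 q0 c" "T_0 q0 c \<le> 2 * c" "T_0 q0 c > Ti" "T_1 q0 c \<ge> 0"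
proof -
  have "sqrt (c\<^sup>2 - 2 * q0) \<le> sqrt (c\<^sup>2)" using q0 by (intro real_sqrt_le_mono) auto
  hence "sqrt (c\<^sup>2 - 2 * q0) \<le> c" using c_pos by simp
  thus "T_1 q0 c \<le> c" "c \<le> T_0 q0 c" "T_0 q0 c \<le> 2 * c" "T_0 q0 c > Ti" "T_1 q0 c \<ge> 0"
    using Ti_less_c real_sqrt_ge_zero[OF disc_nonneg] unfolding T_0_def T_1_def by linarith+
qed

lemma T01_le: "T_1 q0 c \<le> T_0 q0 c" using T01 by linarith

lemma T01_sum: "T_0 q0 c + T_1 q0 c = 2 * c" and T01_prod: "T_0 q0 c * T_1 q0 c = 2 * q0"
  using disc_nonneg by (auto simp: T_0_def T_1_def algebra_simps power2_eq_square[symmetric])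

lemma quadratic_factor: "c * T - T\<^sup>2 / 2 - q0 = (T - T_1 q0 c) * (T_0 q0 c - T) / 2"
proof -
  have "(T - T_1 q0 c) * (T_0 q0 c - T) = T * (T_0 q0 c + T_1 q0 c) - T\<^sup>2 - T_0 q0 c * T_1 q0 c"
    by (simp add: algebra_simps power2_eq_square)
  also have "\<dots> = 2 * (c * T - T\<^sup>2 / 2 - q0)" by (simp add: T01_sum T01_prod algebra_simps)
  finally have eq: "(T - T_1 q0 c) * (T_0 q0 c - T) = 2 * (c * T - T\<^sup>2 / 2 - q0)" .
  show ?thesis unfolding eq by simp
qed

lemma F_factor: "F c T y = (T - T_1 q0 c) * (T_0 q0 c - T) / 2 + q0 * Zf y"
  unfolding quadratic_factor[symmetric] by (simp add: F_def algebra_simps)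

end

lemma F_antimono: "y \<le> y' \<Longrightarrow> y' \<le> 1 \<Longrightarrow> F c T y' \<le> F c T y"
  using Zf_antimono[of y y'] q0 by (simp add: F_def)

lemma F_diff: "F c' T' y - F c T y = (c' - c) * T + (c' - (T + T') / 2) * (T' - T)"
  by (simp add: F_def field_simps power2_eq_square)

lemma F_lipschitz:
  assumes "0 \<le> T" "T \<le> 2 * c" "0 \<le> T'" "T' \<le> 2 * c"
  shows "\<bar>F c T' y - F c T y\<bar> \<le> c * \<bar>T' - T\<bar>"
proof -
  have "\<bar>F c T' y - F c T y\<bar> = \<bar>c - (T + T') / 2\<bar> * \<bar>T' - T\<bar>"
    by (simp add: F_diff abs_mult)
  also have "\<dots> \<le> c * \<bar>T' - T\<bar>" using assms by (intro mult_right_mono) (auto simp: abs_le_iff)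
  finally show ?thesis .
qed

text \<open>The temperature belonging to \<open>g\<close>, clamped to \<open>[Ti, 2 c]\<close>. This makes the quadratic \<open>F\<close> globally
  Lipschitz and gives negative \<open>g\<close> a meaning; \<open>Tc_sol\<close> shows that the clamp is inactive along every
  profile that ends above \<open>Ti\<close>.\<close>
definition Tc where "Tc c g = min (2 * c) (S (max 0 g))"

lemma Tc_range:
  assumes "c \<ge> c_cj q0" shows "Tc c g \<ge> Ti" "Tc c g \<le> 2 * c"
  using assms S_ge[of "max 0 g"] c_cj Ti_less_c[of c] c_pos[of c] by (auto simp: Tc_def)

lemma S_max_lipschitz: "\<bar>S (max 0 g) - S (max 0 g')\<bar> \<le> \<bar>g - g'\<bar> / m"
proof -
  have "\<bar>S (max 0 g) - S (max 0 g')\<bar> \<le> \<bar>max 0 g - max 0 g'\<bar> / m" by (rule S_lipschitz) auto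
  also have "\<dots> \<le> \<bar>g - g'\<bar> / m" using m by (intro divide_right_mono) auto
  finally show ?thesis .
qed

lemma Tc_lipschitz: "\<bar>Tc c g - Tc c g'\<bar> \<le> \<bar>g - g'\<bar> / m"
  using S_max_lipschitz[of g g'] unfolding Tc_def by (auto simp: min_def)

lemma Tc_cont: "continuous_on UNIV (Tc c)"
proof -
  have "continuous_on UNIV (\<lambda>g. S (max 0 g))"
    by (rule continuous_on_compose2[OF S_cont]) (auto intro!: continuous_intros)
  thus ?thesis unfolding Tc_def[abs_def] by (auto intro!: continuous_intros)
qed

lemma Tc_G: "Ti \<le> T \<Longrightarrow> T \<le> 2 * c \<Longrightarrow> Tc c (G T) = T"
  using G_nonneg[of T] S_G[of T] by (simp add: Tc_def max_def)

lemma F_Tc_lipschitz: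
  assumes "c \<ge> c_cj q0"
  shows "\<bar>F c (Tc c g') y - F c (Tc c g) y\<bar> \<le> c / m * \<bar>g' - g\<bar>"
proof -
  have "\<bar>F c (Tc c g') y - F c (Tc c g) y\<bar> \<le> c * \<bar>Tc c g' - Tc c g\<bar>"
    using Tc_range[OF assms] Ti by (intro F_lipschitz) (auto intro: order_trans[OF less_imp_le])
  also have "\<dots> \<le> c * (\<bar>g' - g\<bar> / m)" using c_pos[OF assms] by (intro mult_left_mono Tc_lipschitz) auto
  finally show ?thesis by simp
qed

lemma sol_exists:
  assumes "c \<ge> c_cj q0" "b > 0"
  shows "\<exists>g. g 0 = 0 \<and> (\<forall>y\<in>{0..1}. (g has_real_derivative b * F c (Tc c (g y)) y) (at y within {0..1}))"
proof (rule picard_unit_interval[where L = "b * (c / m)"])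
  have "continuous_on ({0..1} \<times> UNIV) (\<lambda>z. Tc c (snd z))"
    by (rule continuous_on_compose2[OF Tc_cont]) (auto intro!: continuous_intros)
  moreover have "continuous_on ({0..1} \<times> (UNIV :: real set)) (\<lambda>z. Zf (fst z))"
    by (rule continuous_on_compose2[OF Zf_cont]) (auto intro!: continuous_intros)
  ultimately show "continuous_on ({0..1} \<times> UNIV) (\<lambda>(y, x). b * F c (Tc c x) y)"
    unfolding F_def case_prod_beta by (auto intro!: continuous_intros)
  show "b * (c / m) > 0" using assms m c_pos by simp
  fix y x x' :: real
  have "\<bar>b * F c (Tc c x) y - b * F c (Tc c x') y\<bar> = b * \<bar>F c (Tc c x) y - F c (Tc c x') y\<bar>"
    using assms by (simp add: abs_mult flip: right_diff_distrib)
  also have "\<dots> \<le> b * (c / m * \<bar>x - x'\<bar>)"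
    using assms by (intro mult_left_mono F_Tc_lipschitz) auto
  finally show "\<bar>b * F c (Tc c x) y - b * F c (Tc c x') y\<bar> \<le> b * (c / m) * \<bar>x - x'\<bar>" by simp
qed

definition sol where "sol b c = (SOME g. g 0 = 0 \<and>
  (\<forall>y\<in>{0..1}. (g has_real_derivative b * F c (Tc c (g y)) y) (at y within {0..1})))"

context
  fixes b c :: real assumes c: "c \<ge> c_cj q0" and b: "b > 0"
begin

lemma sol_0: "sol b c 0 = 0"
  and sol_deriv_within: "y \<in> {0..1} \<Longrightarrow>
    (sol b c has_real_derivative b * F c (Tc c (sol b c y)) y) (at y within {0..1})"
  using someI_ex[OF sol_exists[OF c b]] unfolding sol_def by auto

lemma sol_cont: "continuous_on {0..1} (sol b c)"
  using sol_deriv_within by (rule DERIV_continuous_on)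

lemma sol_cont_subset: "A \<subseteq> {0..1} \<Longrightarrow> continuous_on A (sol b c)"
  using sol_cont continuous_on_subset by blast

lemma sol_deriv: "0 < y \<Longrightarrow> y < 1 \<Longrightarrow>
    (sol b c has_real_derivative b * F c (Tc c (sol b c y)) y) (at y)"
  using sol_deriv_within[of y] at_within_interior[of y "{0..1}"] by simp

text \<open>A constant temperature \<open>T\<close> with \<open>F c T y \<le> 0\<close> is a supersolution.\<close>
lemma sol_le_const:
  assumes y: "0 \<le> y0" "y0 \<le> y1" "y1 \<le> 1" and T: "Ti \<le> T" "T \<le> 2 * c"
    and le: "sol b c y0 \<le> G T" and F: "\<And>y. y0 < y \<Longrightarrow> y < y1 \<Longrightarrow> F c T y \<le> 0"
  shows "sol b c y1 \<le> G T"
proof -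
  have "0 \<le> G T - sol b c y1"
  proof (rule comparison_nonneg_abs[where a = y0 and b = y1 and w = "\<lambda>y. G T - sol b c y"
      and d = "\<lambda>y. - (b * F c (Tc c (sol b c y)) y)" and L = "b * (c / m)"])
    show "continuous_on {y0..y1} (\<lambda>y. G T - sol b c y)"
      using y by (intro continuous_intros sol_cont_subset) auto
    fix y assume y': "y0 < y" "y < y1"
    show "((\<lambda>y. G T - sol b c y) has_real_derivative - (b * F c (Tc c (sol b c y)) y)) (at y)"
      using sol_deriv[of y] y y' by (auto intro!: derivative_eq_intros)
    have "F c (Tc c (sol b c y)) y - F c T y \<le> c / m * \<bar>G T - sol b c y\<bar>"
      using F_Tc_lipschitz[OF c, of "sol b c y" y "G T"] Tc_G[OF T] by (simp add: abs_minus_commute)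
    hence "F c (Tc c (sol b c y)) y \<le> c / m * \<bar>G T - sol b c y\<bar>" using F[OF y'] by linarith
    hence "b * F c (Tc c (sol b c y)) y \<le> b * (c / m * \<bar>G T - sol b c y\<bar>)"
      using b by (intro mult_left_mono) auto
    thus "- (b * (c / m)) * \<bar>G T - sol b c y\<bar> \<le> - (b * F c (Tc c (sol b c y)) y)" by simp
  qed (use y le in auto)
  thus ?thesis by simp
qed

lemma sol_gt_const:
  assumes y: "0 \<le> y0" "y0 < y1" "y1 \<le> 1" and T: "Ti \<le> T" "T \<le> 2 * c"
    and le: "sol b c y0 \<ge> G T" and F: "\<And>y. y0 < y \<Longrightarrow> y < y1 \<Longrightarrow> F c T y > 0"
  shows "sol b c y1 > G T"
proof -
  have "0 < sol b c y1 - G T"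
  proof (rule comparison_strict[where a = y0 and b = y1 and w = "\<lambda>y. sol b c y - G T"
      and d = "\<lambda>y. b * F c (Tc c (sol b c y)) y" and L = "b * (c / m)"])
    show "continuous_on {y0..y1} (\<lambda>y. sol b c y - G T)"
      using y by (intro continuous_intros sol_cont_subset) auto
    fix y assume y': "y0 < y" "y < y1"
    show "((\<lambda>y. sol b c y - G T) has_real_derivative b * F c (Tc c (sol b c y)) y) (at y)"
      using sol_deriv[of y] y y' by (auto intro!: derivative_eq_intros)
    have "F c T y - F c (Tc c (sol b c y)) y \<le> c / m * \<bar>sol b c y - G T\<bar>"
      using F_Tc_lipschitz[OF c, of "G T" y "sol b c y"] Tc_G[OF T] by (simp add: abs_minus_commute)
    hence "F c (Tc c (sol b c y)) y > - (c / m * \<bar>sol b c y - G T\<bar>)" using F[OF y'] by linarith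
    hence "b * F c (Tc c (sol b c y)) y > b * - (c / m * \<bar>sol b c y - G T\<bar>)"
      using b by (intro mult_strict_left_mono) auto
    thus "- (b * (c / m)) * \<bar>sol b c y - G T\<bar> < b * F c (Tc c (sol b c y)) y" by simp
  qed (use y le in auto)
  thus ?thesis by simp
qed

text \<open>At \<open>T = 2 c\<close> only the heat-release term of \<open>F\<close> is left, and it is nonpositive.\<close>
lemma sol_upper: assumes "y \<in> {0..1}" shows "sol b c y \<le> G (2 * c)"
proof (rule sol_le_const[of 0])
  show "sol b c 0 \<le> G (2 * c)" using G_nonneg[of "2*c"] c_pos[OF c] Ti_less_c[OF c] sol_0 by simp
  fix t assume "0 < t" "t < y"
  thus "F c (2 * c) t \<le> 0" using assms Zf_le_1[of t] q0 by (simp add: F_def power2_eq_square)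
qed (use assms c_pos[OF c] Ti_less_c[OF c] in auto)

text \<open>Consider the sign of \<open>F c Ti\<close> at \<open>y\<close>. If it is positive there, it was positive before, and the
  profile has risen above \<open>Ti\<close>; otherwise it stays nonpositive, and a profile that has come down to
  \<open>Ti\<close> can never leave it upwards.\<close>
lemma sol_positive:
  assumes "sol b c 1 > 0" "0 < y" "y \<le> 1"
  shows "sol b c y > 0"
proof (rule ccontr)
  assume neg: "\<not> sol b c y > 0"
  have r: "Ti \<le> 2 * c" using Ti_less_c[OF c] c_pos[OF c] by simp
  show False
  proof (cases "F c Ti y \<le> 0")
    case True
    have "sol b c 1 \<le> G Ti"
    proof (rule sol_le_const[of y])
      fix t assume "y < t" "t < 1"
      thus "F c Ti t \<le> 0" using True F_antimono[of y t c Ti] by simp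
    qed (use assms neg r in \<open>auto simp: G_Ti\<close>)
    thus False using assms by (simp add: G_Ti)
  next
    case False
    have "sol b c y > G Ti"
    proof (rule sol_gt_const[of 0])
      fix t assume "0 < t" "t < y"
      thus "F c Ti t > 0" using False F_antimono[of t y c Ti] assms by simp
    qed (use assms neg r in \<open>auto simp: G_Ti sol_0\<close>)
    thus False using neg by (simp add: G_Ti)
  qed
qed

lemma sol_nonneg:
  assumes "sol b c 1 > 0" "y \<in> {0..1}"
  shows "sol b c y \<ge> 0"
  using sol_positive[OF assms(1), of y] assms(2) sol_0 by (cases "y = 0") auto

lemma Tc_sol:
  assumes "sol b c 1 > 0" "y \<in> {0..1}"
  shows "Tc c (sol b c y) = S (sol b c y)"
proof -
  have "S (sol b c y) \<le> S (G (2 * c))" using sol_upper sol_nonneg assms by (intro S_mono) auto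
  also have "\<dots> = 2 * c" using Ti_less_c[OF c] c_pos[OF c] by (intro S_G) auto
  finally show ?thesis using sol_nonneg[OF assms] by (simp add: Tc_def)
qed

lemma F_T0_pos: "y < 1 \<Longrightarrow> F c (T_0 q0 c) y > 0"
  using Zf_pos[of y] q0 by (simp add: F_factor[OF c])

text \<open>\<open>F c T0 y = q0 Zf y\<close> is positive as long as fuel is left, so the level \<open>T0\<close> can only be crossed
  upwards.\<close>
lemma sol_above_T0:
  assumes "0 \<le> y" "y < 1" "sol b c y \<ge> G (T_0 q0 c)"
  shows "sol b c 1 > G (T_0 q0 c)"
  by (rule sol_gt_const[of y]) (use assms T01[OF c] F_T0_pos in auto)

text \<open>If \<open>F \<le> 0\<close> at some \<open>y < 1\<close>, the factorised form puts the temperature outside \<open>[T1, T0]\<close>. Above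
  \<open>T0\<close> it remains above; below \<open>T1\<close>, the value reached is a supersolution from then on, because \<open>F\<close>
  decreases in \<open>y\<close>, and the end value is below \<open>T1\<close>.\<close>
lemma F_sol_pos:
  assumes pos: "sol b c 1 > 0" and lo: "T_1 q0 c \<le> S (sol b c 1)" and hi: "S (sol b c 1) \<le> T_0 q0 c"
    and y: "0 \<le> y" "y < 1"
  shows "F c (S (sol b c y)) y > 0"
proof (rule ccontr)
  assume neg: "\<not> F c (S (sol b c y)) y > 0"
  define T where "T = S (sol b c y)"
  have nn: "sol b c y \<ge> 0" using sol_nonneg pos y by simp
  have T: "Ti \<le> T" "T \<le> 2 * c" "G T = sol b c y"
    unfolding T_def using S_ge[OF nn] Tc_sol[OF pos, of y] Tc_range[OF c, of "sol b c y"] G_S[OF nn] y by auto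
  have "(T - T_1 q0 c) * (T_0 q0 c - T) / 2 < 0"
  proof -
    have "q0 * Zf y > 0" using q0 Zf_pos y by simp
    moreover have "(T - T_1 q0 c) * (T_0 q0 c - T) / 2 + q0 * Zf y \<le> 0"
      using neg by (simp add: F_factor[OF c] T_def)
    ultimately show ?thesis by linarith
  qed
  hence "T < T_1 q0 c \<or> T > T_0 q0 c" using T01_le[OF c] by (auto simp: mult_less_0_iff)
  thus False
  proof
    assume "T > T_0 q0 c"
    hence "G T > G (T_0 q0 c)" using T T01[OF c] by (subst G_less_iff) auto
    hence "sol b c 1 > G (T_0 q0 c)" using sol_above_T0 y T by simp
    hence "S (sol b c 1) > S (G (T_0 q0 c))" using G_nonneg T01[OF c] by (intro S_strict) auto
    thus False using hi S_G T01[OF c] by simp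
  next
    assume *: "T < T_1 q0 c"
    have "sol b c 1 \<le> G T"
    proof (rule sol_le_const[of y])
      fix t assume "y < t" "t < 1"
      thus "F c T t \<le> 0" using F_antimono[of y t c T] neg by (simp add: T_def)
    qed (use T y in auto)
    hence "S (sol b c 1) \<le> S (G T)" using pos by (intro S_mono) auto
    thus False using * lo S_G[OF T(1)] by linarith
  qed
qed

end

text \<open>The difference of the two solutions is driven by \<open>(b' - b) F\<close>, taken along the first of them,
  where \<open>F\<close> is positive.\<close>
lemma sol_compare_b:
  assumes c: "c \<ge> c_cj q0" and b: "b > 0" "b' > 0"
    and F: "\<And>y. 0 < y \<Longrightarrow> y < 1 \<Longrightarrow> F c (Tc c (sol b c y)) y > 0"
  shows "b < b' \<Longrightarrow> sol b c 1 < sol b' c 1" and "b' < b \<Longrightarrow> sol b' c 1 < sol b c 1"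
proof -
  \<comment> \<open>the factor \<open>s\<close> treats both signs of \<open>b' - b\<close> at once\<close>
  define s where "s = sgn (b' - b)"
  have "0 < s * (sol b' c 1 - sol b c 1)" if "b \<noteq> b'"
  proof (rule comparison_strict[where a = 0 and b = 1 and w = "\<lambda>y. s * (sol b' c y - sol b c y)"
      and d = "\<lambda>y. s * (b' * F c (Tc c (sol b' c y)) y - b * F c (Tc c (sol b c y)) y)" and L = "b' * (c / m)"])
    show "continuous_on {0..1} (\<lambda>y. s * (sol b' c y - sol b c y))"
      using b c by (intro continuous_intros sol_cont)
    show "0 \<le> s * (sol b' c 0 - sol b c 0)" by (simp add: sol_0 b c)
    fix y :: real assume y: "0 < y" "y < 1"
    show "((\<lambda>y. s * (sol b' c y - sol b c y)) has_real_derivative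
        s * (b' * F c (Tc c (sol b' c y)) y - b * F c (Tc c (sol b c y)) y)) (at y)"
      using sol_deriv[OF c b(1) y] sol_deriv[OF c b(2) y] by (auto intro!: derivative_eq_intros)
    have s1: "\<bar>s\<bar> = 1" using that by (simp add: s_def)
    have "\<bar>s * (b' * (F c (Tc c (sol b' c y)) y - F c (Tc c (sol b c y)) y))\<bar>
        = b' * \<bar>F c (Tc c (sol b' c y)) y - F c (Tc c (sol b c y)) y\<bar>"
      using s1 b by (simp add: abs_mult)
    also have "\<dots> \<le> b' * (c / m * \<bar>sol b' c y - sol b c y\<bar>)"
      using b by (intro mult_left_mono F_Tc_lipschitz c) auto
    also have "\<dots> = b' * (c / m) * \<bar>s * (sol b' c y - sol b c y)\<bar>" using s1 by (simp add: abs_mult)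
    finally have 1: "\<bar>s * (b' * (F c (Tc c (sol b' c y)) y - F c (Tc c (sol b c y)) y))\<bar>
        \<le> b' * (c / m) * \<bar>s * (sol b' c y - sol b c y)\<bar>" .
    have "s * (b' - b) > 0" using that by (simp add: s_def sgn_if)
    hence "s * (b' - b) * F c (Tc c (sol b c y)) y > 0" using F[OF y] by simp
    moreover have "s * (b' * F c (Tc c (sol b' c y)) y - b * F c (Tc c (sol b c y)) y) =
       s * (b' - b) * F c (Tc c (sol b c y)) y +
       s * (b' * (F c (Tc c (sol b' c y)) y - F c (Tc c (sol b c y)) y))" by (simp add: algebra_simps)
    ultimately show "- (b' * (c / m)) * \<bar>s * (sol b' c y - sol b c y)\<bar> <
        s * (b' * F c (Tc c (sol b' c y)) y - b * F c (Tc c (sol b c y)) y)" using 1 by (simp add: abs_le_iff)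
  qed simp
  thus "b < b' \<Longrightarrow> sol b c 1 < sol b' c 1" and "b' < b \<Longrightarrow> sol b' c 1 < sol b c 1"
    by (auto simp: s_def sgn_if split: if_splits)
qed

lemma sol_small_b:
  assumes c: "c \<ge> c_cj q0" and b: "b > 0"
  shows "sol b c 1 \<le> b * (2 * c\<^sup>2)"
proof -
  have "0 \<le> b * (2 * c\<^sup>2) * 1 - sol b c 1"
  proof (rule comparison_nonneg_abs[where a = 0 and b = 1 and w = "\<lambda>y. b * (2 * c\<^sup>2) * y - sol b c y"
      and d = "\<lambda>y. b * (2 * c\<^sup>2) - b * F c (Tc c (sol b c y)) y" and L = 0])
    fix y :: real assume y: "0 < y" "y < 1"
    show "((\<lambda>y. b * (2 * c\<^sup>2) * y - sol b c y) has_real_derivative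
       b * (2 * c\<^sup>2) - b * F c (Tc c (sol b c y)) y) (at y)"
      using sol_deriv[OF c b y] by (auto intro!: derivative_eq_intros)
    have "0 \<le> q0 * (1 - Zf y)" using q0 Zf_le_1[of y] y by simp
    hence "F c (Tc c (sol b c y)) y \<le> c * Tc c (sol b c y)"
      using zero_le_power2[of "Tc c (sol b c y)"] unfolding F_def by linarith
    also have "\<dots> \<le> c * (2 * c)" using c_pos[OF c] Tc_range(2)[OF c] by (intro mult_left_mono) auto
    finally show "- 0 * \<bar>b * (2 * c\<^sup>2) * y - sol b c y\<bar> \<le> b * (2 * c\<^sup>2) - b * F c (Tc c (sol b c y)) y"
      using b by (simp add: power2_eq_square)
  qed (use sol_0[OF c b] sol_cont[OF c b] in \<open>auto intro!: continuous_intros\<close>)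
  thus ?thesis by simp
qed

text \<open>While little fuel has been burnt, \<open>F\<close> is bounded below by a positive constant on \<open>[Ti, T0]\<close>, so a
  large \<open>b\<close> drives the profile to \<open>T0\<close> before the end.\<close>
lemma sol_large_b:
  assumes c: "c \<ge> c_cj q0"
  shows "\<exists>B>0. \<forall>b\<ge>B. sol b c 1 > G (T_0 q0 c)"
proof -
  \<comment> \<open>on \<open>[Ti, T0]\<close> the concave function \<open>c T - T^2/2\<close> is at least the smaller of its values at the end
    points \<open>Ti\<close> and \<open>T0\<close>; the latter value is \<open>q0\<close>\<close>
  define r where "r = min (c * Ti - Ti\<^sup>2 / 2) q0"
  have "Ti * (c - Ti / 2) > 0" using Ti Ti_less_c[OF c] by (intro mult_pos_pos) auto
  hence r: "r > 0" using q0 by (simp add: r_def algebra_simps power2_eq_square)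
  have F0: "c * T - T\<^sup>2 / 2 \<ge> r" if T: "Ti \<le> T" "T \<le> T_0 q0 c" for T
  proof (cases "T \<ge> T_1 q0 c")
    case True
    hence "(T - T_1 q0 c) * (T_0 q0 c - T) / 2 \<ge> 0" using T by simp
    thus ?thesis using quadratic_factor[OF c, of T] unfolding r_def by linarith
  next
    case False
    hence "T \<le> c" using T01[OF c] by linarith
    hence "(T - Ti) * (c - (T + Ti) / 2) \<ge> 0" using T Ti_less_c[OF c] by (intro mult_nonneg_nonneg) auto
    moreover have "(T - Ti) * (c - (T + Ti) / 2) = (c * T - T\<^sup>2 / 2) - (c * Ti - Ti\<^sup>2 / 2)"
      by (simp add: field_simps power2_eq_square)
    ultimately show ?thesis unfolding r_def by linarith
  qed
  obtain y0 where y0: "0 < y0" "y0 < 1" "q0 * (1 - Zf y0) \<le> r / 2"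
  proof -
    have "continuous_on {..1} (\<lambda>y. q0 * (1 - Zf y))" by (intro continuous_intros Zf_cont)
    from this[unfolded continuous_on_iff, rule_format, of 0 "r / 2"]
    obtain d where d: "d > 0" "\<And>y. y \<le> 1 \<Longrightarrow> \<bar>y\<bar> < d \<Longrightarrow> \<bar>q0 * (1 - Zf y)\<bar> < r / 2"
      using r by (auto simp: Zf_0 dist_real_def)
    define y0 where "y0 = min (1/2) (d/2)"
    have "0 < y0" "y0 < 1" "y0 < d" using d(1) by (auto simp: y0_def)
    thus ?thesis using d(2)[of y0] by (intro that[of y0]) auto
  qed
  define B where "B = 2 * G (T_0 q0 c) / (r * y0)"
  have GT: "G (T_0 q0 c) > 0" using G_less_iff[of Ti "T_0 q0 c"] T01[OF c] G_Ti by simp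
  have B: "B > 0" unfolding B_def using r y0 GT by simp
  have "sol b c 1 > G (T_0 q0 c)" if b: "b \<ge> B" for b
  proof -
    have b0: "b > 0" using b B by simp
    show ?thesis
    proof (cases "\<exists>y. 0 \<le> y \<and> y \<le> y0 \<and> sol b c y \<ge> G (T_0 q0 c)")
      case True
      thus ?thesis using sol_above_T0[OF c b0] y0 by force
    next
      case False
      have "0 \<le> sol b c y0 - b * (r / 2) * y0"
      proof (rule comparison_nonneg_abs[where a = 0 and b = y0 and w = "\<lambda>y. sol b c y - b * (r / 2) * y"
          and d = "\<lambda>y. b * F c (Tc c (sol b c y)) y - b * (r / 2)" and L = 0])
        show "continuous_on {0..y0} (\<lambda>y. sol b c y - b * (r / 2) * y)"
          using y0 by (intro continuous_intros sol_cont_subset c b0) auto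
        fix y :: real assume y: "0 < y" "y < y0"
        show "((\<lambda>y. sol b c y - b * (r / 2) * y) has_real_derivative
           b * F c (Tc c (sol b c y)) y - b * (r / 2)) (at y)"
          using sol_deriv[OF c b0 y(1)] y y0 by (auto intro!: derivative_eq_intros)
        have "\<not> G (T_0 q0 c) \<le> sol b c y" using False y by (meson less_imp_le)
        hence "sol b c y < G (T_0 q0 c)" by simp
        hence "S (max 0 (sol b c y)) \<le> S (G (T_0 q0 c))" using GT by (intro S_mono) auto
        hence "Tc c (sol b c y) \<le> T_0 q0 c" using S_G T01[OF c] by (simp add: Tc_def)
        from F0[OF Tc_range(1)[OF c] this]
        have "r \<le> c * Tc c (sol b c y) - (Tc c (sol b c y))\<^sup>2 / 2" .
        moreover have "q0 * (1 - Zf y) \<le> r / 2"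
        proof -
          have "q0 * (1 - Zf y) \<le> q0 * (1 - Zf y0)"
            using Zf_antimono[of y y0] y y0 q0 by (intro mult_left_mono) auto
          thus ?thesis using y0 by simp
        qed
        ultimately have "F c (Tc c (sol b c y)) y \<ge> r / 2" unfolding F_def by linarith
        thus "- 0 * \<bar>sol b c y - b * (r / 2) * y\<bar> \<le> b * F c (Tc c (sol b c y)) y - b * (r / 2)"
          using b0 by simp
      qed (use y0 sol_0[OF c b0] in auto)
      moreover have "b * (r / 2) * y0 \<ge> G (T_0 q0 c)"
      proof -
        have "B * (r / 2) * y0 \<le> b * (r / 2) * y0" using b r y0 by (intro mult_right_mono) auto
        thus ?thesis using r y0 by (simp add: B_def)
      qed
      ultimately show ?thesis using sol_above_T0[OF c b0, of y0] y0 by simp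
    qed
  qed
  thus ?thesis using B by blast
qed

text \<open>Gronwall's inequality, after splitting the difference of the right-hand sides into the parts due
  to \<open>g\<close>, to \<open>c\<close> (including the \<open>c\<close>-dependent clamp) and to \<open>b\<close>.\<close>
lemma sol_lipschitz_params:
  assumes c: "c \<ge> c_cj q0" and b: "b > 0"
  shows "\<exists>C>0. \<forall>b' c' y. 0 < b' \<and> b' \<le> b + 1 \<and> c_cj q0 \<le> c' \<and> c' \<le> c + 1 \<and> y \<in> {0..1} \<longrightarrow>
           \<bar>sol b' c' y - sol b c y\<bar> \<le> C * (\<bar>b' - b\<bar> + \<bar>c' - c\<bar>)"
proof -
  define C1 where "C1 = (b + 1) * (6 * c + 2) + (2 * c\<^sup>2 + q0)"
  define L where "L = (b + 1) * ((c + 1) / m)"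
  have cp: "c > 0" using c_pos[OF c] .
  have C1: "C1 > 0" unfolding C1_def using b cp q0 by (intro add_pos_pos mult_pos_pos) auto
  have L: "L > 0" unfolding L_def using b cp m by simp
  have "\<bar>sol b' c' y - sol b c y\<bar> \<le> C1 * exp L * (\<bar>b' - b\<bar> + \<bar>c' - c\<bar>)"
    if b': "0 < b'" "b' \<le> b + 1" and c': "c_cj q0 \<le> c'" "c' \<le> c + 1" and y: "y \<in> {0..1}" for b' c' y
  proof -
    define e where "e = C1 * (\<bar>b' - b\<bar> + \<bar>c' - c\<bar>)"
    have e: "e \<ge> 0" unfolding e_def using C1 by simp
    have "\<bar>(\<lambda>y. sol b' c' y - sol b c y) y\<bar> \<le> e * y * exp (L * y)"
    proof (rule gronwall[where d = "\<lambda>y. b' * F c' (Tc c' (sol b' c' y)) y - b * F c (Tc c (sol b c y)) y"])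
      show "continuous_on {0..y} (\<lambda>y. sol b' c' y - sol b c y)"
        using y by (intro continuous_intros sol_cont_subset c b c' b') auto
      fix t assume t: "0 < t" "t < y"
      show "((\<lambda>y. sol b' c' y - sol b c y) has_real_derivative
         b' * F c' (Tc c' (sol b' c' t)) t - b * F c (Tc c (sol b c t)) t) (at t)"
        using sol_deriv[OF c b t(1)] sol_deriv[OF c'(1) b'(1) t(1)] t y
        by (auto intro!: derivative_eq_intros)
      define x where "x = Tc c (sol b c t)"
      define x' where "x' = Tc c' (sol b c t)"
      have x: "0 \<le> x" "x \<le> 2 * c" "0 \<le> x'" "x' \<le> 2 * c'"
        using Tc_range[OF c, of "sol b c t"] Tc_range[OF c'(1), of "sol b c t"] Ti
        by (auto simp: x_def x'_def)
      have "2 * \<bar>c' - c\<bar> = \<bar>2 * c' - 2 * c\<bar>" by (simp add: abs_if)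
      hence xx: "\<bar>x' - x\<bar> \<le> 2 * \<bar>c' - c\<bar>" by (auto simp: x_def x'_def Tc_def min_def)
      have "\<bar>F c' (Tc c' (sol b' c' t)) t - F c' x' t\<bar> \<le> c' / m * \<bar>sol b' c' t - sol b c t\<bar>"
        unfolding x'_def by (rule F_Tc_lipschitz[OF c'(1)])
      also have "\<dots> \<le> (c + 1) / m * \<bar>sol b' c' t - sol b c t\<bar>"
        using c' m by (intro mult_right_mono divide_right_mono) auto
      finally have "b' * \<bar>F c' (Tc c' (sol b' c' t)) t - F c' x' t\<bar>
          \<le> (b + 1) * ((c + 1) / m * \<bar>sol b' c' t - sol b c t\<bar>)"
        using b' b by (intro mult_mono) auto
      hence 1: "\<bar>b' * (F c' (Tc c' (sol b' c' t)) t - F c' x' t)\<bar> \<le> L * \<bar>sol b' c' t - sol b c t\<bar>"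
        using b' by (simp add: abs_mult L_def)
      have "\<bar>F c' x' t - F c x t\<bar> \<le> \<bar>c' - c\<bar> * (2 * c) + (2 * c + 1) * (2 * \<bar>c' - c\<bar>)"
      proof -
        have "\<bar>F c' x' t - F c x t\<bar> \<le> \<bar>c' - c\<bar> * x + \<bar>c' - (x + x') / 2\<bar> * \<bar>x' - x\<bar>"
          using x by (simp add: F_diff) (metis abs_mult abs_of_nonneg abs_triangle_ineq)
        also have "\<bar>c' - c\<bar> * x + \<bar>c' - (x + x') / 2\<bar> * \<bar>x' - x\<bar> \<le> \<bar>c' - c\<bar> * (2 * c) + (2 * c + 1) * (2 * \<bar>c' - c\<bar>)"
        proof -
          have "(x + x') / 2 \<ge> 0" "(x + x') / 2 \<le> c + c'" using x by simp_all
          hence "\<bar>c' - (x + x') / 2\<bar> \<le> 2 * c + 1" using c' cp by (intro abs_leI) linarith+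
          thus "\<bar>c' - c\<bar> * x + \<bar>c' - (x + x') / 2\<bar> * \<bar>x' - x\<bar> \<le> \<bar>c' - c\<bar> * (2 * c) + (2 * c + 1) * (2 * \<bar>c' - c\<bar>)"
            using x xx c' cp c_pos[OF c'(1)] by (intro add_mono mult_mono) auto
        qed
        finally show ?thesis .
      qed
      hence "b' * \<bar>F c' x' t - F c x t\<bar> \<le> (b + 1) * (\<bar>c' - c\<bar> * (6 * c + 2))"
        using b' b by (intro mult_mono) (auto simp: algebra_simps)
      hence 2: "\<bar>b' * (F c' x' t - F c x t)\<bar> \<le> (b + 1) * (6 * c + 2) * \<bar>c' - c\<bar>"
        using b' by (simp only: abs_mult abs_of_pos mult_ac)
      have "\<bar>F c x t\<bar> \<le> 2 * c\<^sup>2 + q0"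
      proof -
        have "0 \<le> x * (c - x / 2)" "x * (c - x / 2) \<le> (2 * c) * c"
          using x cp by (auto intro!: mult_nonneg_nonneg mult_mono)
        moreover have "0 \<le> q0 * (1 - Zf t)" "q0 * (1 - Zf t) \<le> q0 * 1"
          using q0 Zf_le_1[of t] Zf_nonneg[of t] t y by (auto intro!: mult_left_mono)
        moreover have "F c x t = x * (c - x / 2) - q0 * (1 - Zf t)"
          by (simp add: F_def algebra_simps power2_eq_square)
        moreover have "2 * c * c = 2 * c\<^sup>2" by (simp add: power2_eq_square)
        ultimately show ?thesis using q0 by linarith
      qed
      hence 3: "\<bar>(b' - b) * F c x t\<bar> \<le> (2 * c\<^sup>2 + q0) * \<bar>b' - b\<bar>"
        using mult_left_mono[of "\<bar>F c x t\<bar>" "2 * c\<^sup>2 + q0" "\<bar>b' - b\<bar>"] by (simp add: abs_mult mult.commute)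
      have "b' * F c' (Tc c' (sol b' c' t)) t - b * F c (Tc c (sol b c t)) t =
        b' * (F c' (Tc c' (sol b' c' t)) t - F c' x' t) + b' * (F c' x' t - F c x t) + (b' - b) * F c x t"
        by (simp add: x_def algebra_simps)
      hence 4: "\<bar>b' * F c' (Tc c' (sol b' c' t)) t - b * F c (Tc c (sol b c t)) t\<bar> \<le>
         L * \<bar>sol b' c' t - sol b c t\<bar> + ((b + 1) * (6 * c + 2) * \<bar>c' - c\<bar> + (2 * c\<^sup>2 + q0) * \<bar>b' - b\<bar>)"
        using 1 2 3 by linarith
      have "(b + 1) * (6 * c + 2) * \<bar>c' - c\<bar> + (2 * c\<^sup>2 + q0) * \<bar>b' - b\<bar> \<le>
          C1 * \<bar>c' - c\<bar> + C1 * \<bar>b' - b\<bar>"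
      proof -
        have "0 \<le> (b + 1) * (6 * c + 2)" "0 \<le> 2 * c\<^sup>2 + q0"
          using b cp q0 by (auto intro!: mult_nonneg_nonneg add_nonneg_nonneg)
        hence "(b + 1) * (6 * c + 2) \<le> C1" "2 * c\<^sup>2 + q0 \<le> C1" unfolding C1_def by linarith+
        thus ?thesis by (intro add_mono mult_right_mono) auto
      qed
      also have "\<dots> = e" by (simp add: e_def algebra_simps)
      finally show "\<bar>b' * F c' (Tc c' (sol b' c' t)) t - b * F c (Tc c (sol b c t)) t\<bar>
           \<le> L * \<bar>sol b' c' t - sol b c t\<bar> + e" using 4 by simp
    qed (use y e L sol_0 c b c' b' in auto)
    also have "\<dots> \<le> e * 1 * exp (L * 1)"
      using y e L by (intro mult_mono) auto
    finally show ?thesis by (simp add: e_def mult.commute mult.left_commute)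
  qed
  moreover have "C1 * exp L > 0" using C1 by simp
  ultimately show ?thesis by blast
qed

end

section \<open>Hitting a target temperature\<close>

context reactive_flow begin

lemma sol_tendsto_params:
  assumes c: "c \<ge> c_cj q0" and b: "b > 0" and e: "e > 0"
  shows "\<exists>d>0. \<forall>b' c' y. 0 < b' \<and> \<bar>b' - b\<bar> < d \<and> c_cj q0 \<le> c' \<and> \<bar>c' - c\<bar> < d \<and> y \<in> {0..1} \<longrightarrow>
           \<bar>sol b' c' y - sol b c y\<bar> < e"
proof -
  obtain C where C: "C > 0" "\<And>b' c' y. 0 < b' \<and> b' \<le> b + 1 \<and> c_cj q0 \<le> c' \<and> c' \<le> c + 1 \<and> y \<in> {0..1} \<Longrightarrow>
           \<bar>sol b' c' y - sol b c y\<bar> \<le> C * (\<bar>b' - b\<bar> + \<bar>c' - c\<bar>)"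
    using sol_lipschitz_params[OF c b] by blast
  define d where "d = min 1 (e / (2 * C))"
  have d: "d > 0" "d \<le> 1" "C * (2 * d) \<le> e" using C e by (auto simp: d_def min_def field_simps)
  have "\<bar>sol b' c' y - sol b c y\<bar> < e"
    if "0 < b'" "\<bar>b' - b\<bar> < d" "c_cj q0 \<le> c'" "\<bar>c' - c\<bar> < d" "y \<in> {0..1}" for b' c' y
  proof -
    have "\<bar>sol b' c' y - sol b c y\<bar> \<le> C * (\<bar>b' - b\<bar> + \<bar>c' - c\<bar>)"
      using that d by (intro C(2)) auto
    also have "\<dots> < C * (2 * d)" using that C by (intro mult_strict_left_mono) auto
    finally show ?thesis using d by simp
  qed
  thus ?thesis using d(1) by blast
qed

lemma sol_end_tendsto_c:
  assumes "c \<ge> c_cj q0" "b > 0" "I \<subseteq> {c_cj q0..}"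
  shows "((\<lambda>c'. sol b c' 1) \<longlongrightarrow> sol b c 1) (at c within I)"
proof (rule tendstoI)
  fix e :: real assume "e > 0"
  from sol_tendsto_params[OF assms(1,2) this] obtain d where "d > 0"
    "\<And>c'. c_cj q0 \<le> c' \<Longrightarrow> \<bar>c' - c\<bar> < d \<Longrightarrow> \<bar>sol b c' 1 - sol b c 1\<bar> < e"
    using assms(2) by force
  thus "\<forall>\<^sub>F c' in at c within I. dist (sol b c' 1) (sol b c 1) < e"
    using assms(3) by (auto simp: eventually_at dist_real_def intro!: exI[of _ d])
qed

lemma shoot_exists:
  assumes c: "c \<ge> c_cj q0" and t: "Ti < t" "t \<le> T_0 q0 c"
  shows "\<exists>b>0. sol b c 1 = G t"
proof -
  obtain B where B: "B > 0" "\<And>b. b \<ge> B \<Longrightarrow> sol b c 1 > G (T_0 q0 c)" using sol_large_b[OF c] by blast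
  have Gt: "G t > 0" using G_less_iff[of Ti t] G_Ti t by simp
  \<comment> \<open>at this lower end of the interval of \<open>b\<close>, \<open>sol_small_b\<close> keeps the end value below the target\<close>
  define b0 where "b0 = min B (G t / (2 * c\<^sup>2))"
  have c2: "2 * c\<^sup>2 > 0" using c_pos[OF c] by simp
  have b0: "b0 > 0" "b0 \<le> B" using B Gt c2 by (auto simp: b0_def)
  have "b0 * (2 * c\<^sup>2) \<le> G t / (2 * c\<^sup>2) * (2 * c\<^sup>2)"
    using c2 by (intro mult_right_mono) (auto simp: b0_def)
  also have "\<dots> = G t" using c2 by simp
  finally have lo: "sol b0 c 1 \<le> G t" using sol_small_b[OF c b0(1)] by simp
  have "G t \<le> G (T_0 q0 c)" using t by (subst G_le_iff) auto
  hence hi: "G t \<le> sol B c 1" using B(2)[of B] by simp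
  have "continuous_on {b0..B} (\<lambda>b. sol b c 1)"
  proof (rule continuous_onI)
    fix b e :: real assume b: "b \<in> {b0..B}" and e: "e > 0"
    from sol_tendsto_params[OF c _ e, of b] b b0 obtain d where
      "d > 0" "\<And>b'. 0 < b' \<Longrightarrow> \<bar>b' - b\<bar> < d \<Longrightarrow> \<bar>sol b' c 1 - sol b c 1\<bar> < e" using c by force
    thus "\<exists>d>0. \<forall>b'\<in>{b0..B}. dist b' b < d \<longrightarrow> dist (sol b' c 1) (sol b c 1) \<le> e"
      using b0 by (intro exI[of _ d]) (force simp: dist_real_def intro: less_imp_le)
  qed
  from IVT'[OF lo hi b0(2) this] b0 show ?thesis by (meson less_le_trans)
qed

definition shoot where "shoot t c = (SOME b. b > 0 \<and> sol b c 1 = G t)"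

text \<open>The targets that a profile can be asked to hit at \<open>y = 1\<close>.\<close>
definition admissible where
  "admissible t c \<longleftrightarrow> c \<ge> c_cj q0 \<and> Ti < t \<and> (t = T_0 q0 c \<or> t = T_1 q0 c)"

lemma admissibleD:
  assumes "admissible t c"
  shows "c \<ge> c_cj q0" "Ti < t" "T_1 q0 c \<le> t" "t \<le> T_0 q0 c" "G t > 0" "t \<le> 2 * c"
  using assms T01_le[of c] T01[of c] G_less_iff[of Ti t] G_Ti by (auto simp: admissible_def)

lemma shoot:
  assumes "admissible t c"
  shows shoot_pos: "shoot t c > 0" and sol_shoot: "sol (shoot t c) c 1 = G t"
  using someI_ex[OF shoot_exists[OF admissibleD(1,2,4)[OF assms]]] unfolding shoot_def by auto

lemma shoot_props:
  assumes a: "admissible t c" and y: "y \<in> {0..1}"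
  shows "sol (shoot t c) c y \<ge> 0" "Tc c (sol (shoot t c) c y) = S (sol (shoot t c) c y)"
    "Ti \<le> S (sol (shoot t c) c y)" "S (sol (shoot t c) c y) \<le> 2 * c"
    "y < 1 \<Longrightarrow> F c (S (sol (shoot t c) c y)) y > 0"
    "G (S (sol (shoot t c) c y)) = sol (shoot t c) c y"
proof -
  note d = admissibleD[OF a] and s = shoot[OF a]
  have pos: "sol (shoot t c) c 1 > 0" using s d by simp
  show nn: "sol (shoot t c) c y \<ge> 0" by (rule sol_nonneg[OF d(1) s(1) pos y])
  show Tc: "Tc c (sol (shoot t c) c y) = S (sol (shoot t c) c y)" by (rule Tc_sol[OF d(1) s(1) pos y])
  show "Ti \<le> S (sol (shoot t c) c y)" by (rule S_ge[OF nn])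
  show "S (sol (shoot t c) c y) \<le> 2 * c" using Tc_range(2)[OF d(1)] unfolding Tc[symmetric] .
  show "F c (S (sol (shoot t c) c y)) y > 0" if "y < 1"
    by (rule F_sol_pos[OF d(1) s(1) pos]) (use y that d s S_G[of t] in auto)
  show "G (S (sol (shoot t c) c y)) = sol (shoot t c) c y" by (rule G_S[OF nn])
qed

lemma sol_less_shoot:
  assumes a: "admissible t c" and b: "0 < b" "b < shoot t c" shows "sol b c 1 < G t"
  using sol_compare_b(2)[OF admissibleD(1)[OF a] shoot_pos[OF a] b(1) _ b(2)]
    shoot_props(2,5)[OF a] sol_shoot[OF a] by simp

lemma sol_greater_shoot:
  assumes a: "admissible t c" and b: "shoot t c < b" shows "sol b c 1 > G t"
proof -
  have "0 < b" using b shoot_pos[OF a] by simp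
  thus ?thesis
  using sol_compare_b(1)[OF admissibleD(1)[OF a] shoot_pos[OF a] _ _ b]
    shoot_props(2,5)[OF a] sol_shoot[OF a] by simp
qed

lemma shoot_less_iff: "admissible t c \<Longrightarrow> 0 < b \<Longrightarrow> shoot t c < b \<longleftrightarrow> G t < sol b c 1"
  using sol_less_shoot[of t c b] sol_greater_shoot[of t c b] sol_shoot[of t c]
  by (cases b "shoot t c" rule: linorder_cases) auto

lemma less_shoot_iff: "admissible t c \<Longrightarrow> 0 < b \<Longrightarrow> b < shoot t c \<longleftrightarrow> sol b c 1 < G t"
  using sol_less_shoot[of t c b] sol_greater_shoot[of t c b] sol_shoot[of t c]
  by (cases b "shoot t c" rule: linorder_cases) auto

text \<open>The sign of \<open>sol b c 1 - G (\<tau> c)\<close> tells on which side of \<open>shoot (\<tau> c) c\<close> the value \<open>b\<close> lies, and this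
  sign persists for nearby speeds.\<close>
lemma shoot_continuous:
  assumes adm: "\<And>c. c \<in> I \<Longrightarrow> admissible (\<tau> c) c" and cont: "continuous_on I \<tau>"
  shows "continuous_on I (\<lambda>c. shoot (\<tau> c) c)"
  unfolding continuous_on_def
proof
  fix c assume c: "c \<in> I"
  note a = adm[OF c] and d = admissibleD[OF adm[OF c]]
  have I: "I \<subseteq> {c_cj q0..}" using adm admissibleD(1) by auto
  have "continuous_on I (\<lambda>c. G (\<tau> c))"
    by (rule continuous_on_compose2[OF G_cont cont]) (use adm admissibleD(2) in force)
  hence G: "((\<lambda>c. G (\<tau> c)) \<longlongrightarrow> G (\<tau> c)) (at c within I)" using c by (simp add: continuous_on_def)
  have diff: "((\<lambda>c'. sol b c' 1 - G (\<tau> c')) \<longlongrightarrow> sol b c 1 - G (\<tau> c)) (at c within I)" if "b > 0" for b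
    by (intro tendsto_diff sol_end_tendsto_c d I that G)
  have inI: "\<forall>\<^sub>F c' in at c within I. c' \<in> I" by (simp add: eventually_at_filter)
  show "((\<lambda>c. shoot (\<tau> c) c) \<longlongrightarrow> shoot (\<tau> c) c) (at c within I)"
  proof (rule order_tendstoI)
    fix b assume b: "b < shoot (\<tau> c) c"
    show "\<forall>\<^sub>F c' in at c within I. b < shoot (\<tau> c') c'"
    proof (cases "b > 0")
      case False
      show ?thesis using inI by eventually_elim (use shoot_pos[OF adm] False in force)
    next
      case True
      have "sol b c 1 - G (\<tau> c) < 0" using sol_less_shoot[OF a True b] by simp
      from order_tendstoD(2)[OF diff[OF True] this] inI
      show ?thesis by eventually_elim (use less_shoot_iff[OF adm True] in auto)
    qed
  next
    fix b assume b: "shoot (\<tau> c) c < b"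
    have b0: "b > 0" using b shoot_pos[OF a] by simp
    have "sol b c 1 - G (\<tau> c) > 0" using sol_greater_shoot[OF a b] by simp
    from order_tendstoD(1)[OF diff[OF b0] this] inI
    show "\<forall>\<^sub>F c' in at c within I. shoot (\<tau> c') c' < b"
      by eventually_elim (use shoot_less_iff[OF adm b0] in auto)
  qed
qed

definition profile where "profile t c y = S (sol (shoot t c) c y)"

lemma sol_shoot_continuous:
  assumes adm: "\<And>c. c \<in> I \<Longrightarrow> admissible (\<tau> c) c" and cont: "continuous_on I \<tau>"
  shows "continuous_on (I \<times> {0..1}) (\<lambda>(c, y). sol (shoot (\<tau> c) c) c y)"
proof (rule continuous_onI, clarify)
  fix c y e :: real assume c: "c \<in> I" and y: "y \<in> {0..1}" and e: "e > 0"
  let ?b = "\<lambda>c. shoot (\<tau> c) c"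
  note a = adm[OF c] and d = admissibleD[OF adm[OF c]]
  obtain d1 where d1: "d1 > 0" "\<And>b' c' y. 0 < b' \<Longrightarrow> \<bar>b' - ?b c\<bar> < d1 \<Longrightarrow> c_cj q0 \<le> c' \<Longrightarrow> \<bar>c' - c\<bar> < d1
      \<Longrightarrow> y \<in> {0..1} \<Longrightarrow> \<bar>sol b' c' y - sol (?b c) c y\<bar> < e / 2"
    using sol_tendsto_params[OF d(1) shoot_pos[OF a], of "e / 2"] e by (auto simp del: divide_le_eq_numeral1)
  obtain d2 where d2: "d2 > 0" "\<And>c'. c' \<in> I \<Longrightarrow> \<bar>c' - c\<bar> < d2 \<Longrightarrow> \<bar>?b c' - ?b c\<bar> < d1"
    using shoot_continuous[OF adm cont, unfolded continuous_on_iff, rule_format, OF _ c d1(1)]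
    by (auto simp: dist_real_def)
  obtain d3 where d3: "d3 > 0" "\<And>y'. y' \<in> {0..1} \<Longrightarrow> \<bar>y' - y\<bar> < d3 \<Longrightarrow> \<bar>sol (?b c) c y' - sol (?b c) c y\<bar> < e / 2"
    using sol_cont[OF d(1) shoot_pos[OF a], unfolded continuous_on_iff, rule_format, OF y, of "e/2"] e
    by (auto simp: dist_real_def)
  show "\<exists>d>0. \<forall>z\<in>I \<times> {0..1}. dist z (c, y) < d \<longrightarrow>
     dist (case z of (c, y) \<Rightarrow> sol (?b c) c y) (sol (?b c) c y) \<le> e"
  proof (intro exI[of _ "min d1 (min d2 d3)"] conjI ballI impI)
    fix z assume z: "z \<in> I \<times> {0..1}" "dist z (c, y) < min d1 (min d2 d3)"
    obtain c' y' where z': "z = (c', y')" by (cases z)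
    have cy: "c' \<in> I" "y' \<in> {0..1}" using z z' by auto
    have "\<bar>c' - c\<bar> < min d1 (min d2 d3)" "\<bar>y' - y\<bar> < min d1 (min d2 d3)"
      using z dist_fst_le[of z "(c, y)"] dist_snd_le[of z "(c, y)"] z' by (auto simp: dist_real_def)
    hence "\<bar>sol (?b c') c' y' - sol (?b c) c y'\<bar> < e / 2" "\<bar>sol (?b c) c y' - sol (?b c) c y\<bar> < e / 2"
      using d1(2)[of "?b c'" c' y'] d2(2)[of c'] d3(2)[of y'] cy shoot_pos[OF adm[OF cy(1)]]
        admissibleD(1)[OF adm[OF cy(1)]] by auto
    thus "dist (case z of (c, y) \<Rightarrow> sol (?b c) c y) (sol (?b c) c y) \<le> e"
      unfolding z' dist_real_def prod.case by linarith
  qed (use d1 d2 d3 in auto)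
qed

lemma profile_continuous:
  assumes adm: "\<And>c. c \<in> I \<Longrightarrow> admissible (\<tau> c) c" and cont: "continuous_on I \<tau>"
  shows "continuous_on (I \<times> {0..1}) (\<lambda>(c, y). profile (\<tau> c) c y)"
proof -
  have "continuous_on (I \<times> {0..1}) (\<lambda>z. S (case z of (c, y) \<Rightarrow> sol (shoot (\<tau> c) c) c y))"
    by (rule continuous_on_compose2[OF S_cont sol_shoot_continuous[OF adm cont]])
      (use shoot_props(1)[OF adm] in auto)
  thus ?thesis by (simp add: profile_def case_prod_beta)
qed

lemma profile_props:
  assumes a: "admissible t c" and y: "y \<in> {0..1}"
  shows "Ti \<le> profile t c y" "profile t c y \<le> 2 * c" "y < 1 \<Longrightarrow> F c (profile t c y) y > 0"
    "G (profile t c y) = sol (shoot t c) c y"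
  using shoot_props[OF assms] by (auto simp: profile_def)

lemma sol_shoot_deriv:
  assumes a: "admissible t c" and y: "y \<in> {0..1}"
  shows "(sol (shoot t c) c has_real_derivative shoot t c * F c (profile t c y) y) (at y within {0..1})"
  using sol_deriv_within[OF admissibleD(1)[OF a] shoot_pos[OF a] y] shoot_props(2)[OF assms]
  by (simp add: profile_def)

text \<open>The slope of \<open>G\<close> between \<open>x\<close> and \<open>z\<close>, in a form that is jointly continuous also on the diagonal.\<close>
definition mean where "mean x z = integral {0..1} (\<lambda>t. \<phi> (x + t * (z - x)))"

lemma segment_ge: "Ti \<le> x \<Longrightarrow> Ti \<le> z \<Longrightarrow> t \<in> {0..1} \<Longrightarrow> Ti \<le> x + t * (z - x)" for x z t :: real
proof -
  assume a: "Ti \<le> x" "Ti \<le> z" "t \<in> {0..1}"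
  have "(1 - t) * Ti + t * Ti \<le> (1 - t) * x + t * z" using a by (intro add_mono mult_left_mono) auto
  thus ?thesis by (simp add: algebra_simps)
qed

lemma G_diff_mean:
  assumes "Ti \<le> x" "Ti \<le> z"
  shows "G z - G x = (z - x) * mean x z"
proof -
  have "((\<lambda>t. (z - x) * \<phi> (x + t * (z - x))) has_integral G (x + 1 * (z - x)) - G (x + 0 * (z - x))) {0..1}"
  proof (rule fundamental_theorem_of_calculus)
    fix t :: real assume t: "t \<in> {0..1}"
    have "(G has_real_derivative \<phi> (x + t * (z - x))) (at (x + t * (z - x)) within (\<lambda>t. x + t * (z - x)) ` {0..1})"
      by (rule DERIV_subset[OF G_deriv]) (use segment_ge assms t in auto)
    moreover have "((\<lambda>t. x + t * (z - x)) has_real_derivative z - x) (at t within {0..1})"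
      by (auto intro!: derivative_eq_intros)
    ultimately have "((G \<circ> (\<lambda>t. x + t * (z - x))) has_real_derivative \<phi> (x + t * (z - x)) * (z - x)) (at t within {0..1})"
      by (rule DERIV_image_chain)
    hence "((\<lambda>t. G (x + t * (z - x))) has_real_derivative \<phi> (x + t * (z - x)) * (z - x)) (at t within {0..1})"
      by (simp add: o_def)
    thus "((\<lambda>t. G (x + t * (z - x))) has_vector_derivative (z - x) * \<phi> (x + t * (z - x))) (at t within {0..1})"
      by (simp add: has_real_derivative_iff_has_vector_derivative mult.commute)
  qed simp
  from integral_unique[OF this] show ?thesis by (simp add: mean_def)
qed

lemma mean_continuous: "continuous_on ({Ti..} \<times> {Ti..}) (\<lambda>(x, z). mean x z)"
proof -
  have "continuous_on (({Ti..} \<times> {Ti..}) \<times> {0..1}) (\<lambda>w. \<phi> (fst (fst w) + snd w * (snd (fst w) - fst (fst w))))"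
    by (rule continuous_on_compose2[OF \<phi>_cont]) (auto intro!: continuous_intros segment_ge)
  hence "continuous_on ({Ti..} \<times> {Ti..}) (\<lambda>w. integral {0..1} (\<lambda>t. \<phi> (fst w + t * (snd w - fst w))))"
    by (intro continuous_on_integral_unit_param) (simp add: case_prod_beta)
  thus ?thesis by (simp add: mean_def case_prod_beta)
qed

lemma mean_ge:
  assumes "Ti \<le> x" "Ti \<le> z"
  shows "mean x z \<ge> m"
proof -
  have "continuous_on {0..1} (\<lambda>t. \<phi> (x + t * (z - x)))"
    by (rule continuous_on_compose2[OF \<phi>_cont]) (use segment_ge assms in \<open>auto intro!: continuous_intros\<close>)
  hence "integral {0..1} (\<lambda>t::real. m) \<le> mean x z" unfolding mean_def
    using segment_ge assms by (intro integral_le integrable_continuous_real \<phi>_ge) auto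
  thus ?thesis by simp
qed

lemma mean_same: "mean x x = \<phi> x" by (simp add: mean_def)

end

section \<open>Smoothness of the shooting parameter\<close>

context reactive_flow begin

text \<open>Variation of constants with the integrating factor \<open>exp (- integral {0..y} A)\<close>.\<close>
lemma linear_ode_solution:
  fixes w A r :: "real \<Rightarrow> real"
  assumes A: "continuous_on {0..1} A" and r: "continuous_on {0..1} r"
    and w: "\<And>y. y \<in> {0..1} \<Longrightarrow> (w has_real_derivative A y * w y + r y) (at y within {0..1})"
    and w0: "w 0 = 0" and y: "y \<in> {0..1}"
  shows "w y = exp (integral {0..y} A) * integral {0..y} (\<lambda>s. r s / exp (integral {0..s} A))"
proof -
  define H where "H y = exp (integral {0..y} A)" for y
  have Hd: "(H has_real_derivative H y * A y) (at y within {0..1})" if "y \<in> {0..1}" for y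
    unfolding H_def by (rule DERIV_chain2[OF DERIV_exp integral_has_real_derivative[OF A that]])
  have Hp: "H y > 0" for y by (simp add: H_def)
  have wd: "((\<lambda>y. w y / H y) has_real_derivative r y / H y) (at y within {0..1})" if "y \<in> {0..1}" for y
  proof -
    have "((\<lambda>y. w y / H y) has_real_derivative ((A y * w y + r y) * H y - w y * (H y * A y)) / (H y * H y)) (at y within {0..1})"
      by (rule DERIV_divide[OF w[OF that] Hd[OF that]]) (use Hp[of y] in simp)
    moreover have "((A y * w y + r y) * H y - w y * (H y * A y)) / (H y * H y) = r y / H y"
      using Hp[of y] by (simp add: field_simps)
    ultimately show ?thesis by simp
  qed
  have "((\<lambda>y. r y / H y) has_integral w y / H y - w 0 / H 0) {0..y}"
    by (rule fundamental_theorem_of_calculus)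
      (use y DERIV_subset[OF wd, of _ "{0..y}"] in \<open>auto simp flip: has_real_derivative_iff_has_vector_derivative\<close>)
  hence "integral {0..y} (\<lambda>y. r y / H y) = w y / H y" using w0 by (simp add: integral_unique)
  thus ?thesis using Hp[of y] by (simp add: H_def)
qed

lemma F_continuous:
  assumes "continuous_on A f" "continuous_on A g" "continuous_on A h" "\<And>x. x \<in> A \<Longrightarrow> h x \<le> 1"
  shows "continuous_on A (\<lambda>x. F (f x) (g x) (h x))"
proof -
  have "continuous_on A (\<lambda>x. Zf (h x))" by (rule continuous_on_compose2[OF Zf_cont assms(3)]) (use assms in auto)
  thus ?thesis unfolding F_def using assms by (intro continuous_intros) auto
qed

end

text \<open>A branch of admissible targets over an open interval of speeds. The inclusion of the end point
  \<open>c_cj\<close> is left to \<open>shoot_continuous\<close>, since the targets are not differentiable there.\<close>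
locale shooting = reactive_flow +
  fixes I :: "real set" and \<tau> \<tau>' :: "real \<Rightarrow> real"
  assumes I_open: "open I" and adm: "\<And>c. c \<in> I \<Longrightarrow> admissible (\<tau> c) c"
    and \<tau>_deriv: "\<And>c. c \<in> I \<Longrightarrow> (\<tau> has_real_derivative \<tau>' c) (at c)"
begin

definition b where "b c = shoot (\<tau> c) c"
definition u where "u c = profile (\<tau> c) c"

lemma c_ge: "c \<in> I \<Longrightarrow> c \<ge> c_cj q0" using adm admissibleD by blast

lemma \<tau>_cont: "continuous_on I \<tau>"
  using \<tau>_deriv by (intro DERIV_continuous_on) (auto intro: has_field_derivative_at_within)

lemma b_pos: "c \<in> I \<Longrightarrow> b c > 0" using adm shoot_pos by (simp add: b_def)

lemma b_cont: "continuous_on I b" unfolding b_def by (rule shoot_continuous[OF adm \<tau>_cont])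

lemma u_cont: "continuous_on (I \<times> {0..1}) (\<lambda>(c, y). u c y)"
  unfolding u_def by (rule profile_continuous[OF adm \<tau>_cont])

lemma u_ge: "c \<in> I \<Longrightarrow> y \<in> {0..1} \<Longrightarrow> u c y \<ge> Ti"
  using profile_props adm by (auto simp: u_def)

lemma u_F_pos: "c \<in> I \<Longrightarrow> 0 \<le> y \<Longrightarrow> y < 1 \<Longrightarrow> F c (u c y) y > 0"
  using profile_props(3)[OF adm] by (auto simp: u_def)

lemma u_cont_y: "c \<in> I \<Longrightarrow> continuous_on {0..1} (u c)"
  using continuous_on_compose2[OF u_cont, of "{0..1}" "\<lambda>y. (c, y)"]
    continuous_on_Pair[OF continuous_on_const continuous_on_id, of "{0..1}" c] by auto

definition g where "g c = sol (b c) c"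

lemma g_eq: "c \<in> I \<Longrightarrow> y \<in> {0..1} \<Longrightarrow> g c y = G (u c y)"
  using profile_props(4)[OF adm] by (simp add: u_def g_def b_def)

lemma u_eq: "u c y = S (g c y)" by (simp add: u_def g_def b_def profile_def)

lemma g_nonneg: "c \<in> I \<Longrightarrow> y \<in> {0..1} \<Longrightarrow> g c y \<ge> 0"
  using shoot_props(1)[OF adm] by (simp add: g_def b_def)

lemma g_end: "c \<in> I \<Longrightarrow> g c 1 = G (\<tau> c)" using sol_shoot[OF adm] by (simp add: g_def b_def)

lemma g_0: "c \<in> I \<Longrightarrow> g c 0 = 0" using sol_0[OF c_ge b_pos] by (simp add: g_def)

lemma u_end: "c \<in> I \<Longrightarrow> u c 1 = \<tau> c"
  using g_end S_G[OF less_imp_le[OF admissibleD(2)[OF adm]]] by (simp add: u_eq)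

text \<open>Data of the linear equation for the difference of the solutions with speeds \<open>c\<close> and \<open>c2\<close>: \<open>A\<close> is
  its coefficient, \<open>H\<close> solves the homogeneous equation, and \<open>H W\<close> and \<open>H V\<close> are the responses to a
  unit change of \<open>b\<close> and of \<open>c\<close>. The base speed \<open>c\<close> comes first; \<open>c2\<close> is the speed that tends to it.\<close>
definition A where "A c c2 y = b c2 * (c2 - (u c y + u c2 y) / 2) / mean (u c y) (u c2 y)"
definition H where "H c c2 y = exp (integral {0..y} (A c c2))"
definition W where "W c c2 y = integral {0..y} (\<lambda>s. F c (u c s) s / H c c2 s)"
definition V where "V c c2 y = integral {0..y} (\<lambda>s. b c2 * u c s / H c c2 s)"

lemma A_cont:
  assumes c: "c \<in> I" shows "continuous_on (I \<times> {0..1}) (\<lambda>(c2, y). A c c2 y)"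
proof -
  have 1: "continuous_on (I \<times> {0..1}) (\<lambda>z. u c (snd z))"
    by (rule continuous_on_compose2[OF u_cont_y[OF c]]) (auto intro!: continuous_intros)
  have 2: "continuous_on (I \<times> {0..1}) (\<lambda>z. u (fst z) (snd z))"
    using u_cont by (simp add: case_prod_beta)
  have "continuous_on (I \<times> {0..1}) (\<lambda>z. case (u c (snd z), u (fst z) (snd z)) of (x, z) \<Rightarrow> mean x z)"
    by (rule continuous_on_compose2[OF mean_continuous]) (use 1 2 u_ge c in \<open>auto intro!: continuous_intros\<close>)
  hence 3: "continuous_on (I \<times> {0..1}) (\<lambda>z. mean (u c (snd z)) (u (fst z) (snd z)))" by simp
  have 4: "continuous_on (I \<times> {0..1}) (\<lambda>z. b (fst z))"
    by (rule continuous_on_compose2[OF b_cont]) (auto intro!: continuous_intros)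
  have "mean (u c y) (u c2 y) \<noteq> 0" if "c2 \<in> I" "y \<in> {0..1}" for c2 y
    using mean_ge[OF u_ge[OF c that(2)] u_ge[OF that]] m by simp
  thus ?thesis unfolding A_def case_prod_beta using 1 2 3 4
    by (intro continuous_intros) auto
qed

lemma H_cont:
  assumes c: "c \<in> I" shows "continuous_on (I \<times> {0..1}) (\<lambda>(c2, y). H c c2 y)"
  using continuous_on_exp[OF continuous_on_indefinite_integral_param[OF A_cont[OF c]]]
  by (simp add: H_def case_prod_beta)

lemma H_pos: "H c c2 y > 0" by (simp add: H_def)

lemma W_cont:
  assumes c: "c \<in> I" shows "continuous_on (I \<times> {0..1}) (\<lambda>(c2, y). W c c2 y)"
proof -
  have 1: "continuous_on (I \<times> {0..1}) (\<lambda>z. u c (snd z))"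
    by (rule continuous_on_compose2[OF u_cont_y[OF c]]) (auto intro!: continuous_intros)
  have "continuous_on (I \<times> {0..1}) (\<lambda>(c2, s). F c (u c s) s / H c c2 s)"
    using 1 H_cont[OF c] H_pos[of c] unfolding case_prod_beta
    by (intro continuous_on_divide F_continuous continuous_intros) (auto simp: less_imp_neq[THEN not_sym])
  from continuous_on_indefinite_integral_param[OF this] show ?thesis unfolding W_def .
qed

lemma V_cont:
  assumes c: "c \<in> I" shows "continuous_on (I \<times> {0..1}) (\<lambda>(c2, y). V c c2 y)"
proof -
  have 1: "continuous_on (I \<times> {0..1}) (\<lambda>z. u c (snd z))"
    by (rule continuous_on_compose2[OF u_cont_y[OF c]]) (auto intro!: continuous_intros)
  have 4: "continuous_on (I \<times> {0..1}) (\<lambda>z. b (fst z))"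
    by (rule continuous_on_compose2[OF b_cont]) (auto intro!: continuous_intros)
  have "continuous_on (I \<times> {0..1}) (\<lambda>(c2, s). b c2 * u c s / H c c2 s)"
    using 1 4 H_cont[OF c] H_pos[of c] unfolding case_prod_beta
    by (intro continuous_on_divide continuous_on_mult) (auto simp: less_imp_neq[THEN not_sym])
  from continuous_on_indefinite_integral_param[OF this] show ?thesis unfolding V_def .
qed

lemma section_cont:
  assumes "continuous_on (I \<times> {0..1}) (\<lambda>(c, y). f c y)" "c \<in> I" shows "continuous_on {0..1} (f c)"
  using continuous_on_compose2[OF assms(1), of "{0..1}" "\<lambda>y. (c, y)"] assms(2)
    continuous_on_Pair[OF continuous_on_const continuous_on_id, of "{0..1}" c] by auto

lemma section_tendsto:
  assumes "continuous_on (I \<times> {0..1}) (\<lambda>(c, y). f c y)" "c \<in> I" "y \<in> {0..1}"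
  shows "((\<lambda>c. f c y) \<longlongrightarrow> f c y) (at c)"
proof -
  have "continuous_on I (\<lambda>c. case (c, y) of (c, y) \<Rightarrow> f c y)"
    by (rule continuous_on_compose2[OF assms(1)]) (use assms(3) in \<open>auto intro!: continuous_intros\<close>)
  hence "continuous_on I (\<lambda>c. f c y)" by simp
  thus ?thesis using assms(2) I_open by (metis at_within_open continuous_on_def)
qed

text \<open>\<open>F\<close> is positive along the profile except at its end; this is what makes the shooting condition
  solvable for the change of \<open>b\<close>.\<close>
lemma W_pos:
  assumes c: "c \<in> I" "c2 \<in> I" shows "W c c2 1 > 0"
proof -
  have cont: "continuous_on {0..1} (\<lambda>s. F c (u c s) s / H c c2 s)"
    using u_cont_y[OF c(1)] section_cont[OF H_cont[OF c(1)] c(2)] H_pos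
    by (intro continuous_on_divide F_continuous continuous_intros) (auto simp: less_imp_neq[THEN not_sym])
  have nn: "F c (u c s) s / H c c2 s \<ge> 0" if "s \<in> {0..1}" for s
  proof -
    have "F c (u c s) s \<ge> 0"
    proof (cases "s < 1")
      case True thus ?thesis using u_F_pos[OF c(1), of s] that by simp
    next
      case False
      hence "s = 1" using that by simp
      moreover have "F c (\<tau> c) 1 = 0"
        using adm[OF c(1)] by (auto simp: admissible_def F_factor Zf_1)
      ultimately show ?thesis using u_end[OF c(1)] by simp
    qed
    thus ?thesis using H_pos[of c c2 s] by simp
  qed
  have "W c c2 1 \<noteq> 0"
  proof
    assume "W c c2 1 = 0"
    hence "F c (u c s) s / H c c2 s = 0" if "s \<in> {0..1}" for s
      using integral_eq_0_iff[OF cont] nn that unfolding W_def by auto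
    hence "F c (u c 0) 0 / H c c2 0 = 0" by simp
    thus False using u_F_pos[OF c(1), of 0] H_pos[of c c2 0] by simp
  qed
  moreover have "W c c2 1 \<ge> 0" unfolding W_def
    by (rule integral_nonneg) (use nn cont in \<open>auto intro: integrable_continuous_real\<close>)
  ultimately show ?thesis by simp
qed

text \<open>An exact identity, not a linearisation: the mean \<open>mean (u c y) (u c2 y)\<close> converts differences of \<open>u\<close>
  into differences of \<open>g\<close>.\<close>
lemma g_difference:
  assumes c: "c \<in> I" "c2 \<in> I" and y: "y \<in> {0..1}"
  shows "g c2 y - g c y = H c c2 y * ((b c2 - b c) * W c c2 y + (c2 - c) * V c c2 y)"
proof -
  define r where "r s = (b c2 - b c) * F c (u c s) s + (c2 - c) * (b c2 * u c s)" for s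
  have rc: "continuous_on {0..1} r"
    unfolding r_def using u_cont_y[OF c(1)] by (intro continuous_intros F_continuous) auto
  have "g c2 y - g c y = exp (integral {0..y} (A c c2)) * integral {0..y} (\<lambda>s. r s / exp (integral {0..s} (A c c2)))"
  proof (rule linear_ode_solution[where w = "\<lambda>y. g c2 y - g c y"])
    show "continuous_on {0..1} (A c c2)" by (rule section_cont[OF A_cont[OF c(1)] c(2)])
    fix s :: real assume s: "s \<in> {0..1}"
    have "((\<lambda>y. g c2 y - g c y) has_real_derivative b c2 * F c2 (u c2 s) s - b c * F c (u c s) s) (at s within {0..1})"
      unfolding g_def b_def u_def by (intro DERIV_diff sol_shoot_deriv adm c s)
    moreover have "b c2 * F c2 (u c2 s) s - b c * F c (u c s) s = A c c2 s * (g c2 s - g c s) + r s"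
    proof -
      have "g c2 s - g c s = (u c2 s - u c s) * mean (u c s) (u c2 s)"
        using G_diff_mean[OF u_ge[OF c(1) s] u_ge[OF c(2) s]] g_eq[OF c(1) s] g_eq[OF c(2) s] by simp
      moreover have "mean (u c s) (u c2 s) \<noteq> 0"
        using mean_ge[OF u_ge[OF c(1) s] u_ge[OF c(2) s]] m by simp
      ultimately have "A c c2 s * (g c2 s - g c s) = b c2 * ((c2 - (u c s + u c2 s) / 2) * (u c2 s - u c s))"
        by (simp add: A_def)
      moreover have "(c2 - (u c s + u c2 s) / 2) * (u c2 s - u c s) = F c2 (u c2 s) s - F c (u c s) s - (c2 - c) * u c s"
        using F_diff[of c2 "u c2 s" s c "u c s"] by simp
      ultimately have e: "A c c2 s * (g c2 s - g c s) = b c2 * (F c2 (u c2 s) s - F c (u c s) s - (c2 - c) * u c s)"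
        by simp
      show ?thesis unfolding e r_def by (simp add: algebra_simps)
    qed
    ultimately show "((\<lambda>y. g c2 y - g c y) has_real_derivative A c c2 s * (g c2 s - g c s) + r s) (at s within {0..1})"
      by simp
  qed (use rc y g_0 c in auto)
  also have "\<dots> = H c c2 y * integral {0..y} (\<lambda>s. (b c2 - b c) * (F c (u c s) s / H c c2 s) + (c2 - c) * (b c2 * u c s / H c c2 s))"
    by (simp add: H_def r_def add_divide_distrib)
  also have "integral {0..y} (\<lambda>s. (b c2 - b c) * (F c (u c s) s / H c c2 s) + (c2 - c) * (b c2 * u c s / H c c2 s))
     = (b c2 - b c) * W c c2 y + (c2 - c) * V c c2 y"
  proof -
    have sub: "{0..y} \<subseteq> {0..1}" using y by auto
    have Hc: "continuous_on {0..y} (H c c2)"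
      using section_cont[OF H_cont[OF c(1)] c(2)] sub continuous_on_subset by blast
    have uc: "continuous_on {0..y} (u c)" using u_cont_y[OF c(1)] sub continuous_on_subset by blast
    have 1: "(\<lambda>s. F c (u c s) s / H c c2 s) integrable_on {0..y}"
      using uc Hc H_pos y
      by (intro integrable_continuous_real continuous_on_divide F_continuous continuous_intros)
        (auto simp: less_imp_neq[THEN not_sym])
    have 2: "(\<lambda>s. b c2 * u c s / H c c2 s) integrable_on {0..y}"
      using uc Hc H_pos
      by (intro integrable_continuous_real continuous_on_divide continuous_intros)
        (auto simp: less_imp_neq[THEN not_sym])
    show ?thesis unfolding W_def V_def
      using integral_add[OF integrable_on_mult_right[OF 1, of "b c2 - b c"] integrable_on_mult_right[OF 2, of "c2 - c"]]
      by (simp only: integral_mult_right)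
  qed
  finally show ?thesis .
qed

text \<open>Obtained from \<open>g_difference\<close> at \<open>y = 1\<close>, divided by \<open>c2 - c\<close>, in the limit \<open>c2 = c\<close>.\<close>
definition b' where "b' c = (\<phi> (\<tau> c) * \<tau>' c / H c c 1 - V c c 1) / W c c 1"
definition g' where "g' c y = H c c y * (b' c * W c c y + V c c y)"

lemma G_\<tau>_deriv: assumes c: "c \<in> I" shows "((\<lambda>c. G (\<tau> c)) has_real_derivative \<phi> (\<tau> c) * \<tau>' c) (at c)"
proof -
  have "(G has_real_derivative \<phi> (\<tau> c)) (at (\<tau> c) within \<tau> ` I)"
    by (rule DERIV_subset[OF G_deriv]) (use adm admissibleD(2) c in force)+
  moreover have "(\<tau> has_real_derivative \<tau>' c) (at c within I)"
    using \<tau>_deriv[OF c] by (rule has_field_derivative_at_within)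
  ultimately have "(G \<circ> \<tau> has_real_derivative \<phi> (\<tau> c) * \<tau>' c) (at c within I)"
    by (rule DERIV_image_chain)
  thus ?thesis using at_within_open[OF c I_open] by (simp add: o_def)
qed

lemma b_deriv: assumes c: "c \<in> I" shows "(b has_real_derivative b' c) (at c)"
  unfolding has_field_derivative_iff
proof (rule Lim_transform_within_open[OF _ I_open c])
  note e = section_tendsto[OF H_cont[OF c] c] section_tendsto[OF W_cont[OF c] c] section_tendsto[OF V_cont[OF c] c]
  have 1: "((\<lambda>c2. (G (\<tau> c2) - G (\<tau> c)) / (c2 - c)) \<longlongrightarrow> \<phi> (\<tau> c) * \<tau>' c) (at c)"
    using G_\<tau>_deriv[OF c] by (simp add: has_field_derivative_iff)
  show "((\<lambda>c2. ((G (\<tau> c2) - G (\<tau> c)) / (c2 - c) / H c c2 1 - V c c2 1) / W c c2 1) \<longlongrightarrow> b' c) (at c)"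
    unfolding b'_def using H_pos[of c c 1] W_pos[OF c c]
    by (intro tendsto_divide tendsto_diff 1 e) auto
  fix c2 assume c2: "c2 \<in> I" "c2 \<noteq> c"
  have "G (\<tau> c2) - G (\<tau> c) = H c c2 1 * ((b c2 - b c) * W c c2 1 + (c2 - c) * V c c2 1)"
    using g_difference[OF c c2(1), of 1] g_end c c2 by simp
  hence "(G (\<tau> c2) - G (\<tau> c)) / (c2 - c) / H c c2 1 = ((b c2 - b c) * W c c2 1 + (c2 - c) * V c c2 1) / (c2 - c)"
    using H_pos[of c c2 1] by simp
  also have "\<dots> = (b c2 - b c) / (c2 - c) * W c c2 1 + V c c2 1" using c2 by (simp add: field_simps)
  finally show "((G (\<tau> c2) - G (\<tau> c)) / (c2 - c) / H c c2 1 - V c c2 1) / W c c2 1 = (b c2 - b c) / (c2 - c)"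
    using W_pos[OF c c2(1)] by simp
qed

lemma g_deriv: assumes c: "c \<in> I" and y: "y \<in> {0..1}"
  shows "((\<lambda>c. g c y) has_real_derivative g' c y) (at c)"
  unfolding has_field_derivative_iff
proof (rule Lim_transform_within_open[OF _ I_open c])
  note e = section_tendsto[OF H_cont[OF c] c y] section_tendsto[OF W_cont[OF c] c y] section_tendsto[OF V_cont[OF c] c y]
  have 1: "((\<lambda>c2. (b c2 - b c) / (c2 - c)) \<longlongrightarrow> b' c) (at c)"
    using b_deriv[OF c] by (simp add: has_field_derivative_iff)
  show "((\<lambda>c2. H c c2 y * ((b c2 - b c) / (c2 - c) * W c c2 y + V c c2 y)) \<longlongrightarrow> g' c y) (at c)"
    unfolding g'_def by (intro tendsto_intros 1 e)
  fix c2 assume c2: "c2 \<in> I" "c2 \<noteq> c"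
  show "H c c2 y * ((b c2 - b c) / (c2 - c) * W c c2 y + V c c2 y) = (g c2 y - g c y) / (c2 - c)"
    using g_difference[OF c c2(1) y] c2 by (simp add: field_simps)
qed

lemma u_deriv: assumes c: "c \<in> I" and y: "y \<in> {0..1}"
  shows "((\<lambda>c. u c y) has_real_derivative g' c y / \<phi> (u c y)) (at c)"
proof -
  have "(S has_real_derivative 1 / \<phi> (S (g c y))) (at (g c y) within (\<lambda>c. g c y) ` I)"
    by (rule DERIV_subset[OF S_deriv]) (use g_nonneg y c in auto)
  moreover have "((\<lambda>c. g c y) has_real_derivative g' c y) (at c within I)"
    using g_deriv[OF c y] by (rule has_field_derivative_at_within)
  ultimately have "(S \<circ> (\<lambda>c. g c y) has_real_derivative 1 / \<phi> (S (g c y)) * g' c y) (at c within I)"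
    by (rule DERIV_image_chain)
  thus ?thesis using at_within_open[OF c I_open] by (simp add: o_def u_eq)
qed

text \<open>The formulas for \<open>b'\<close> and \<open>g'\<close> consist of \<open>b\<close>, \<open>u\<close>, \<open>\<phi>(u)\<close> and integrals of these, so \<open>k\<close>
  derivatives of \<open>b\<close> and \<open>u\<close> produce one more.\<close>
lemma Ck_param_bootstrap:
  assumes \<phi>: "Ck_on n \<phi> {Ti..}" and \<tau>_Ck: "Ck_param n I (\<lambda>c y. \<tau> c)" "Ck_param n I (\<lambda>c y. \<tau>' c)"
  shows "k \<le> n \<Longrightarrow> Ck_param k I (\<lambda>c y. b c) \<and> Ck_param k I u"
proof (induction k)
  case 0
  have "continuous_on (I \<times> {0..1}) (\<lambda>z. b (fst z))"
    by (rule continuous_on_compose2[OF b_cont]) (auto intro!: continuous_intros)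
  thus ?case using u_cont by (simp add: case_prod_beta)
next
  case (Suc k)
  hence b: "Ck_param k I (\<lambda>c y. b c)" and u: "Ck_param k I u" by auto
  have down: "Ck_param k I f" if "Ck_param n I f" for f
    using that \<open>Suc k \<le> n\<close>
  proof (induction n)
    case (Suc n) thus ?case using Ck_param_Suc_imp[of n I f] by (cases "k = Suc n") (auto simp: le_Suc_eq)
  qed simp
  have down': "Ck_on k f A" if "Ck_on n f A" for f A
    using that \<open>Suc k \<le> n\<close>
  proof (induction n)
    case (Suc n) thus ?case using Ck_on_Suc_imp[of n f A] by (cases "k = Suc n") (auto simp: le_Suc_eq)
  qed simp
  have \<phi>u: "Ck_param k I (\<lambda>c y. \<phi> (u c y))"
    by (rule Ck_param_compose[OF I_open down'[OF \<phi>] u]) (use u_ge in auto)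
  have \<phi>\<tau>: "Ck_param k I (\<lambda>c y. \<phi> (\<tau> c))"
    by (rule Ck_param_compose[OF I_open down'[OF \<phi>] down[OF \<tau>_Ck(1)]]) (use adm admissibleD(2) in force)
  have \<phi>_pos: "\<phi> (u c y) > 0" if "c \<in> I" "y \<in> {0..1}" for c y
    using \<phi>_ge[OF u_ge[OF that]] m by simp
  have Zf: "Ck_param k I (\<lambda>c. Zf)"
    by (rule Ck_param_indep[OF continuous_on_subset[OF Zf_cont]]) auto
  have A: "Ck_param k I (\<lambda>c. A c c)"
  proof (rule Ck_param_cong[OF I_open])
    show "Ck_param k I (\<lambda>c y. b c * (c - u c y) / \<phi> (u c y))"
      by (intro Ck_param_divide Ck_param_mult Ck_param_diff b u Ck_param_param \<phi>u I_open \<phi>_pos)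
  qed (simp add: A_def mean_same)
  have H: "Ck_param k I (\<lambda>c. H c c)"
    unfolding H_def by (rule Ck_param_compose[OF I_open Ck_on_exp[of k UNIV] Ck_param_integral[OF I_open A]]) simp
  have Fu: "Ck_param k I (\<lambda>c y. F c (u c y) y)"
    unfolding F_def power2_eq_square
    by (intro Ck_param_diff Ck_param_mult Ck_param_divide Ck_param_param u Zf Ck_param_const I_open) simp
  have W: "Ck_param k I (\<lambda>c. W c c)" unfolding W_def
    by (intro Ck_param_integral Ck_param_divide Fu H I_open H_pos)
  have V: "Ck_param k I (\<lambda>c. V c c)" unfolding V_def
    by (intro Ck_param_integral Ck_param_divide Ck_param_mult b u H I_open H_pos)
  have b': "Ck_param k I (\<lambda>c y. b' c)" unfolding b'_def
    by (intro Ck_param_diff Ck_param_mult Ck_param_divide I_open \<phi>\<tau> down[OF \<tau>_Ck(2)]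
      Ck_param_eval_1[OF H] Ck_param_eval_1[OF W] Ck_param_eval_1[OF V] H_pos W_pos)
  have g': "Ck_param k I g'" unfolding g'_def[abs_def]
    by (intro Ck_param_mult Ck_param_add b' H W V)
  have "Ck_param k I (\<lambda>c y. g' c y / \<phi> (u c y))"
    by (intro Ck_param_divide I_open g' \<phi>u \<phi>_pos)
  hence "Ck_param (Suc k) I u" using Ck_param_continuous[OF u] u_deriv
    by (auto intro!: exI[of _ "\<lambda>c y. g' c y / \<phi> (u c y)"])
  moreover have "Ck_param (Suc k) I (\<lambda>c y. b c)" using Ck_param_continuous[OF b] b' b_deriv
    by (auto intro!: exI[of _ "\<lambda>c y. b' c"])
  ultimately show ?case by simp
qed

text \<open>Lowering the target and raising the speed both ask for less heating: the target term has the sign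
  of \<open>\<tau>'\<close>, and the response \<open>V\<close> to a change of speed is nonnegative.\<close>
lemma b'_neg:
  assumes c: "c \<in> I" and neg: "\<tau>' c < 0" shows "b' c < 0"
proof -
  have "\<phi> (\<tau> c) > 0" using \<phi>_ge[of "\<tau> c"] m admissibleD(2)[OF adm[OF c]] by simp
  hence "\<phi> (\<tau> c) * \<tau>' c / H c c 1 < 0" using neg H_pos[of c c 1] by (simp add: mult_pos_neg divide_neg_pos)
  moreover have "V c c 1 \<ge> 0" unfolding V_def
  proof (rule integral_nonneg)
    have "continuous_on {0..1} (\<lambda>s. b c * u c s / H c c s)"
      using u_cont_y[OF c] section_cont[OF H_cont[OF c] c] H_pos
      by (intro continuous_on_divide continuous_intros) (auto simp: less_imp_neq[THEN not_sym])
    thus "(\<lambda>s. b c * u c s / H c c s) integrable_on {0..1}" by (rule integrable_continuous_real)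
    fix s :: real assume s: "s \<in> {0..1}"
    have "u c s \<ge> 0" using u_ge[OF c s] Ti by simp
    thus "0 \<le> b c * u c s / H c c s" using b_pos[OF c] H_pos[of c c s] by simp
  qed
  ultimately show ?thesis unfolding b'_def using W_pos[OF c c] by (simp add: divide_neg_pos)
qed

end

section \<open>The curves of special waves\<close>

text \<open>\<open>c_star\<close> is the speed at which the smaller root of \<open>T^2 - 2 c T + 2 q0\<close> equals \<open>Ti\<close>.\<close>
lemma c_star_props:
  assumes "0 < q0" "0 < Ti" "Ti < sqrt (2 * q0)"
  shows "c_cj q0 < c_star q0 Ti" "T_1 q0 (c_star q0 Ti) = Ti"
    "c_cj q0 \<le> c \<Longrightarrow> c < c_star q0 Ti \<Longrightarrow> T_1 q0 c > Ti"
proof -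
  have Ti2: "Ti\<^sup>2 < 2 * q0"
  proof -
    have "Ti\<^sup>2 < (sqrt (2 * q0))\<^sup>2" using assms by (intro power_strict_mono) auto
    thus ?thesis using assms by simp
  qed
  have "0 < (sqrt (2 * q0) - Ti)\<^sup>2" using assms by simp
  hence "2 * Ti * sqrt (2 * q0) < Ti\<^sup>2 + 2 * q0" using assms by (simp add: power2_diff algebra_simps)
  thus 1: "c_cj q0 < c_star q0 Ti" using assms by (simp add: c_cj_def c_star_def field_simps)
  have "(c_star q0 Ti)\<^sup>2 - 2 * q0 = ((2 * q0 - Ti\<^sup>2) / (2 * Ti))\<^sup>2"
    using assms by (simp add: c_star_def field_simps power2_eq_square)
  hence "sqrt ((c_star q0 Ti)\<^sup>2 - 2 * q0) = (2 * q0 - Ti\<^sup>2) / (2 * Ti)"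
    using assms Ti2 by simp
  thus "T_1 q0 (c_star q0 Ti) = Ti" using assms
    by (simp add: T_1_def c_star_def field_simps power2_eq_square)
  show "T_1 q0 c > Ti" if c: "c_cj q0 \<le> c" "c < c_star q0 Ti"
  proof -
    have "c > Ti" using c assms by (simp add: c_cj_def)
    have "2 * Ti * c < Ti\<^sup>2 + 2 * q0" using c(2) assms by (simp add: c_star_def field_simps)
    hence "c\<^sup>2 - 2 * q0 < (c - Ti)\<^sup>2" by (simp add: power2_diff algebra_simps)
    hence "sqrt (c\<^sup>2 - 2 * q0) < sqrt ((c - Ti)\<^sup>2)" by (rule real_sqrt_less_mono)
    thus ?thesis using \<open>c > Ti\<close> by (simp add: T_1_def)
  qed
qed

definition T_0' :: "real \<Rightarrow> real \<Rightarrow> real" where "T_0' q0 c = 1 + c / sqrt (c\<^sup>2 - 2 * q0)"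
definition T_1' :: "real \<Rightarrow> real \<Rightarrow> real" where "T_1' q0 c = 1 - c / sqrt (c\<^sup>2 - 2 * q0)"

lemma disc_pos: assumes "0 < q0" "c_cj q0 < c" shows "c\<^sup>2 - 2 * q0 > 0"
proof -
  have "(c_cj q0)\<^sup>2 < c\<^sup>2" using assms by (intro power_strict_mono) (auto simp: c_cj_def)
  thus ?thesis using assms by (simp add: c_cj_def)
qed

lemma T01_deriv:
  assumes "0 < q0" "c_cj q0 < c"
  shows "(T_0 q0 has_real_derivative T_0' q0 c) (at c)" "(T_1 q0 has_real_derivative T_1' q0 c) (at c)"
proof -
  have "((\<lambda>c. sqrt (c\<^sup>2 - 2 * q0)) has_real_derivative c / sqrt (c\<^sup>2 - 2 * q0)) (at c)"
    using disc_pos[OF assms] by (auto intro!: derivative_eq_intros simp: field_simps)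
  thus "(T_0 q0 has_real_derivative T_0' q0 c) (at c)" "(T_1 q0 has_real_derivative T_1' q0 c) (at c)"
    unfolding T_0_def[abs_def] T_1_def[abs_def] T_0'_def T_1'_def by (auto intro!: derivative_intros)
qed

lemma T_1'_neg:
  assumes "0 < q0" "c_cj q0 < c" shows "T_1' q0 c < 0"
proof -
  have "c > 0" using assms by (auto simp: c_cj_def intro: less_trans[of _ "sqrt (2 * q0)"])
  have "sqrt (c\<^sup>2 - 2 * q0) < sqrt (c\<^sup>2)" using assms by (intro real_sqrt_less_mono) simp
  hence "sqrt (c\<^sup>2 - 2 * q0) < c" using \<open>c > 0\<close> by simp
  thus ?thesis using disc_pos[OF assms] by (simp add: T_1'_def)
qed

lemma T01_Ck:
  assumes q0: "0 < q0" and I: "open I" "I \<subseteq> {c_cj q0<..}"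
  shows "Ck_param k I (\<lambda>c y. T_0 q0 c)" "Ck_param k I (\<lambda>c y. T_1 q0 c)"
    "Ck_param k I (\<lambda>c y. T_0' q0 c)" "Ck_param k I (\<lambda>c y. T_1' q0 c)"
proof -
  have d: "c\<^sup>2 - 2 * q0 > 0" if "c \<in> I" for c using disc_pos[OF q0, of c] that I by auto
  have s: "Ck_param k I (\<lambda>c y. sqrt (c\<^sup>2 - 2 * q0))"
    unfolding power2_eq_square
    by (intro Ck_param_sqrt I Ck_param_diff Ck_param_mult Ck_param_param Ck_param_const)
      (use d in \<open>simp add: power2_eq_square\<close>)
  show "Ck_param k I (\<lambda>c y. T_0 q0 c)" "Ck_param k I (\<lambda>c y. T_1 q0 c)"
    unfolding T_0_def T_1_def by (intro Ck_param_add Ck_param_diff Ck_param_param s)+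
  show "Ck_param k I (\<lambda>c y. T_0' q0 c)" "Ck_param k I (\<lambda>c y. T_1' q0 c)"
    unfolding T_0'_def T_1'_def using d
    by (intro Ck_param_add Ck_param_diff Ck_param_divide Ck_param_param Ck_param_const s I; simp)+
qed

lemma T01_cont: "continuous_on A (T_0 q0)" "continuous_on A (T_1 q0)"
  unfolding T_0_def[abs_def] T_1_def[abs_def] by (intro continuous_intros)+

context reactive_flow begin

lemma admissible_T0: "c \<ge> c_cj q0 \<Longrightarrow> admissible (T_0 q0 c) c"
  using T01(4) by (simp add: admissible_def)

lemma admissible_T1: "c \<in> {c_cj q0..<c_star q0 Ti} \<Longrightarrow> admissible (T_1 q0 c) c"
  using c_star_props(3)[OF q0 Ti Ti_less] by (simp add: admissible_def)

sublocale strong: shooting q0 K \<alpha> Ti m M \<phi> "{c_cj q0<..}" "T_0 q0" "T_0' q0"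
  by unfold_locales (use admissible_T0 T01_deriv[OF q0] in auto)

sublocale weak: shooting q0 K \<alpha> Ti m M \<phi> "{c_cj q0<..<c_star q0 Ti}" "T_1 q0" "T_1' q0"
  by unfold_locales (use admissible_T1 T01_deriv[OF q0] in auto)

text \<open>The correspondence between \<open>b\<close> and \<open>\<beta>\<close>; the same formula converts in both directions
  (\<open>viscosity_involution\<close>).\<close>
definition viscosity where "viscosity b = 1 / (b * (K * (1 - \<alpha>)))"

lemma rate_pos: "K * (1 - \<alpha>) > 0" using K \<alpha>1 by simp

lemma viscosity_pos: "b > 0 \<Longrightarrow> viscosity b > 0" using rate_pos by (simp add: viscosity_def)

lemma viscosity_involution: "b > 0 \<Longrightarrow> viscosity (viscosity b) = b"
  using K \<alpha>1 by (simp add: viscosity_def)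

lemma viscosity_less: "0 < b \<Longrightarrow> b < b' \<Longrightarrow> viscosity b' < viscosity b"
  unfolding viscosity_def
  by (intro divide_strict_left_mono mult_strict_right_mono mult_pos_pos rate_pos) auto

lemma viscosity_less_iff: "0 < b \<Longrightarrow> 0 < b' \<Longrightarrow> viscosity b' < viscosity b \<longleftrightarrow> b < b'"
  using viscosity_less[of b b'] viscosity_less[of b' b] by (cases b b' rule: linorder_cases) auto

lemma filterlim_viscosity:
  assumes "\<And>b0. b0 > 0 \<Longrightarrow> \<forall>\<^sub>F c in Fl. 0 < b c \<and> b c < b0"
  shows "filterlim (\<lambda>c. viscosity (b c)) at_top Fl"
  unfolding filterlim_at_top_dense
proof
  fix Z :: real
  have Z: "max Z 1 > 0" by simp
  have "\<forall>\<^sub>F c in Fl. 0 < b c \<and> b c < viscosity (max Z 1)"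
    by (rule assms[OF viscosity_pos[OF Z]])
  thus "\<forall>\<^sub>F c in Fl. Z < viscosity (b c)"
  proof eventually_elim
    case (elim c)
    hence "viscosity (viscosity (max Z 1)) < viscosity (b c)" by (intro viscosity_less) auto
    thus ?case using viscosity_involution[OF Z] by simp
  qed
qed

definition \<beta>0 where "\<beta>0 c = viscosity (shoot (T_0 q0 c) c)"
definition \<beta>1 where "\<beta>1 c = viscosity (shoot (T_1 q0 c) c)"

lemma \<beta>0_pos: "c \<ge> c_cj q0 \<Longrightarrow> \<beta>0 c > 0"
  unfolding \<beta>0_def by (intro viscosity_pos shoot_pos admissible_T0)

lemma \<beta>1_pos: "c \<in> {c_cj q0..<c_star q0 Ti} \<Longrightarrow> \<beta>1 c > 0"
  unfolding \<beta>1_def by (intro viscosity_pos shoot_pos admissible_T1)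

lemma \<beta>0_less_\<beta>1:
  assumes c: "c \<in> {c_cj q0<..<c_star q0 Ti}" shows "\<beta>0 c < \<beta>1 c"
proof -
  have a: "admissible (T_0 q0 c) c" "admissible (T_1 q0 c) c"
    using c admissible_T0 admissible_T1 by auto
  have "T_1 q0 c < T_0 q0 c" using disc_pos[OF q0, of c] c by (simp add: T_0_def T_1_def)
  hence "G (T_1 q0 c) < G (T_0 q0 c)" using G_less_iff admissibleD(2)[OF a(1)] admissibleD(2)[OF a(2)] by simp
  hence "shoot (T_1 q0 c) c < shoot (T_0 q0 c) c"
    using shoot_less_iff[OF a(2) shoot_pos[OF a(1)]] sol_shoot[OF a(1)] by simp
  thus ?thesis unfolding \<beta>0_def \<beta>1_def by (rule viscosity_less[OF shoot_pos[OF a(2)]])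
qed

lemma Ck_viscosity:
  assumes "open I" "Ck_param k I (\<lambda>c y. b c)" "\<And>c. c \<in> I \<Longrightarrow> b c > 0"
  shows "Ck_on k (\<lambda>c. viscosity (b c)) I"
proof -
  have "Ck_param k I (\<lambda>c y. viscosity (b c))" unfolding viscosity_def
    using rate_pos assms by (intro Ck_param_divide Ck_param_mult Ck_param_const) auto
  from Ck_param_imp_Ck_on[OF assms(1) this] show ?thesis .
qed

lemma \<beta>0_class:
  assumes "Ck_on n \<phi> {Ti..}" shows "class_Ck_speed n \<beta>0 {c_cj q0..}"
  unfolding class_Ck_speed_def
proof
  have "continuous_on {c_cj q0..} (\<lambda>c. shoot (T_0 q0 c) c)"
    by (rule shoot_continuous[OF _ T01_cont(1)]) (use admissible_T0 in auto)
  moreover have "shoot (T_0 q0 c) c * (K * (1 - \<alpha>)) \<noteq> 0" if "c \<ge> c_cj q0" for c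
    using K \<alpha>1 shoot_pos[OF admissible_T0[OF that]] by simp
  ultimately show "continuous_on {c_cj q0..} \<beta>0"
    unfolding \<beta>0_def[abs_def] viscosity_def by (intro continuous_intros) auto
  have "Ck_param n {c_cj q0<..} (\<lambda>c y. strong.b c)"
    using strong.Ck_param_bootstrap[OF assms T01_Ck(1,3)[OF q0], of n] by simp
  hence "Ck_on n (\<lambda>c. viscosity (strong.b c)) {c_cj q0<..}"
    by (intro Ck_viscosity strong.b_pos) auto
  thus "Ck_on n \<beta>0 (interior {c_cj q0..})" by (simp add: \<beta>0_def[abs_def] strong.b_def)
qed

lemma \<beta>1_class:
  assumes "Ck_on n \<phi> {Ti..}" shows "class_Ck_speed n \<beta>1 {c_cj q0..<c_star q0 Ti}"
  unfolding class_Ck_speed_def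
proof
  have "continuous_on {c_cj q0..<c_star q0 Ti} (\<lambda>c. shoot (T_1 q0 c) c)"
    by (rule shoot_continuous[OF _ T01_cont(2)]) (use admissible_T1 in auto)
  moreover have "shoot (T_1 q0 c) c * (K * (1 - \<alpha>)) \<noteq> 0" if "c \<in> {c_cj q0..<c_star q0 Ti}" for c
    using K \<alpha>1 shoot_pos[OF admissible_T1[OF that]] by simp
  ultimately show "continuous_on {c_cj q0..<c_star q0 Ti} \<beta>1"
    unfolding \<beta>1_def[abs_def] viscosity_def by (intro continuous_intros) auto
  have "Ck_param n {c_cj q0<..<c_star q0 Ti} (\<lambda>c y. weak.b c)"
    using weak.Ck_param_bootstrap[OF assms T01_Ck(2)[OF q0 weak.I_open] T01_Ck(4)[OF q0 weak.I_open], of n]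
    by (simp add: subset_iff)
  hence "Ck_on n (\<lambda>c. viscosity (weak.b c)) {c_cj q0<..<c_star q0 Ti}"
    by (intro Ck_viscosity weak.b_pos) auto
  thus "Ck_on n \<beta>1 (interior {c_cj q0..<c_star q0 Ti})"
    by (simp add: \<beta>1_def[abs_def] weak.b_def)
qed

lemma \<beta>1_deriv_pos:
  assumes c: "c \<in> {c_cj q0<..<c_star q0 Ti}" shows "deriv \<beta>1 c > 0"
proof -
  have b: "weak.b c > 0" by (rule weak.b_pos[OF c])
  have nz: "K \<noteq> 0" "\<alpha> \<noteq> 1" using K \<alpha>1 by auto
  have "weak.b' c < 0" using weak.b'_neg[OF c] T_1'_neg[OF q0] c by auto
  have "((\<lambda>c. viscosity (weak.b c)) has_real_derivative
      - (weak.b' c * (K * (1 - \<alpha>))) / (weak.b c * (K * (1 - \<alpha>)))\<^sup>2) (at c)"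
    unfolding viscosity_def using weak.b_deriv[OF c] b nz
    by (auto intro!: derivative_eq_intros simp: power2_eq_square)
  hence "deriv \<beta>1 c = - (weak.b' c * (K * (1 - \<alpha>))) / (weak.b c * (K * (1 - \<alpha>)))\<^sup>2"
    by (intro DERIV_imp_deriv) (simp add: \<beta>1_def[abs_def] weak.b_def)
  moreover have "weak.b' c * (K * (1 - \<alpha>)) < 0"
    using \<open>weak.b' c < 0\<close> rate_pos by (rule mult_neg_pos)
  hence "- (weak.b' c * (K * (1 - \<alpha>))) > 0" by linarith
  moreover have "(weak.b c * (K * (1 - \<alpha>)))\<^sup>2 > 0" using b nz by simp
  ultimately show ?thesis by (metis divide_pos_pos)
qed

text \<open>At \<open>c_star\<close> the target \<open>T1\<close> has come down to \<open>Ti\<close>, where \<open>F = q0 Zf\<close> is positive before the end;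
  so every \<open>b > 0\<close> overshoots it, and by continuity also at speeds slightly below.\<close>
lemma \<beta>1_at_c_star: "filterlim \<beta>1 at_top (at_left (c_star q0 Ti))"
  unfolding \<beta>1_def
proof (rule filterlim_viscosity)
  fix b :: real assume b: "b > 0"
  let ?c = "c_star q0 Ti"
  note cs = c_star_props[OF q0 Ti Ti_less]
  have c: "?c \<ge> c_cj q0" using cs by simp
  have "sol b ?c 1 > G Ti"
  proof (rule sol_gt_const[OF c b, of 0])
    show "Ti \<le> 2 * ?c" using Ti_less_c[OF c] c_pos[OF c] by simp
    fix y :: real assume "0 < y" "y < 1"
    thus "F ?c Ti y > 0" using F_factor[OF c, of Ti y] cs(2) q0 Zf_pos[of y] by simp
  qed (use sol_0[OF c b] G_Ti in auto)
  moreover have "((\<lambda>c. sol b c 1 - G (T_1 q0 c)) \<longlongrightarrow> sol b ?c 1 - G Ti) (at ?c within {c_cj q0..?c})"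
  proof (intro tendsto_diff)
    show "((\<lambda>c. sol b c 1) \<longlongrightarrow> sol b ?c 1) (at ?c within {c_cj q0..?c})"
      by (rule sol_end_tendsto_c[OF c b]) auto
    have "T_1 q0 c \<ge> Ti" if "c \<in> {c_cj q0..?c}" for c
      using cs(2) cs(3)[of c] that by (cases "c = ?c") auto
    hence "continuous_on {c_cj q0..?c} (\<lambda>c. G (T_1 q0 c))"
      by (intro continuous_on_compose2[OF G_cont T01_cont(2)]) auto
    thus "((\<lambda>c. G (T_1 q0 c)) \<longlongrightarrow> G Ti) (at ?c within {c_cj q0..?c})"
      using c cs(2) unfolding continuous_on_def by (metis atLeastAtMost_iff order_refl)
  qed
  ultimately have "\<forall>\<^sub>F c in at ?c within {c_cj q0..?c}. 0 < sol b c 1 - G (T_1 q0 c)"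
    by (intro order_tendstoD(1)) auto
  moreover have "at ?c within {c_cj q0..?c} = at_left ?c"
    by (rule at_within_Icc_at_left[OF cs(1)])
  ultimately have "\<forall>\<^sub>F c in at_left ?c. 0 < sol b c 1 - G (T_1 q0 c)" by simp
  moreover have "\<forall>\<^sub>F c in at_left ?c. c \<in> {c_cj q0<..<?c}"
    by (rule eventually_at_left_real[OF cs(1)])
  ultimately show "\<forall>\<^sub>F c in at_left ?c. 0 < shoot (T_1 q0 c) c \<and> shoot (T_1 q0 c) c < b"
  proof eventually_elim
    case (elim c)
    have a: "admissible (T_1 q0 c) c" using admissible_T1 elim by simp
    show ?case using shoot_pos[OF a] shoot_less_iff[OF a b] elim by simp
  qed
qed

lemma profile_deriv:
  assumes a: "admissible t c" and y: "0 < y" "y < 1"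
  shows "(profile t c has_real_derivative shoot t c * F c (profile t c y) y / \<phi> (profile t c y)) (at y)"
proof -
  have y': "y \<in> {0..1}" using y by simp
  have "(S has_real_derivative 1 / \<phi> (S (sol (shoot t c) c y))) (at (sol (shoot t c) c y) within sol (shoot t c) c ` {0..1})"
    by (rule DERIV_subset[OF S_deriv]) (use shoot_props(1)[OF a] y in auto)
  from DERIV_image_chain[OF this sol_shoot_deriv[OF a y']]
  have "(profile t c has_real_derivative 1 / \<phi> (profile t c y) * (shoot t c * F c (profile t c y) y)) (at y within {0..1})"
    by (simp add: o_def profile_def[abs_def])
  thus ?thesis using at_within_interior[of y "{0..1}"] y by simp
qed

lemma profile_cont_y: "admissible t c \<Longrightarrow> continuous_on {0..1} (profile t c)"
  unfolding profile_def[abs_def]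
  by (rule continuous_on_compose2[OF S_cont sol_cont[OF admissibleD(1) shoot_pos]])
    (use shoot_props(1) in auto)

text \<open>The profile that ends at \<open>T0\<close> is estimated in two stages. On \<open>[0, 1/4]\<close> the logistic part of \<open>F\<close>
  makes \<open>ln ((u - T1) / (T0 - u))\<close> grow at least at the rate \<open>b c / (2 M)\<close>, which leaves an
  exponentially small distance to \<open>T0\<close>. On \<open>[1/4, 1/2]\<close> the heat release alone raises the temperature
  by the left-hand side of the claim, and \<open>T0\<close> must not be reached yet. For large \<open>c\<close> these two
  demands on \<open>b\<close> contradict each other.\<close>
lemma shoot_T0_bound:
  assumes b: "b > 0" and c: "c \<ge> c_cj q0" "c \<ge> 4 * q0 / Ti" "c\<^sup>2 \<ge> 4 * q0"
    and le: "b \<le> shoot (T_0 q0 c) c"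
  shows "b / M * (q0 * Zf (1/2)) / 4 \<le> 8 * c\<^sup>2 / Ti * exp (- (b * c / (8 * M)))"
proof -
  have a: "admissible (T_0 q0 c) c" by (rule admissible_T0[OF c(1)])
  define u where "u = profile (T_0 q0 c) c"
  define T0 where "T0 = T_0 q0 c"
  define T1 where "T1 = T_1 q0 c"
  have cp: "c > 0" by (rule c_pos[OF c(1)])
  have M: "M > 0" using \<phi>_ge[of Ti] \<phi>_le[of Ti] m by simp
  have T: "T0 \<le> 2 * c" "T1 \<le> Ti / 2" "T1 \<ge> 0" "T0 - T1 \<ge> c"
  proof -
    have "c * T1 \<le> T0 * T1" using T01[OF c(1)] by (intro mult_right_mono) (auto simp: T0_def T1_def)
    also have "\<dots> = 2 * q0" unfolding T0_def T1_def by (rule T01_prod[OF c(1)])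
    also have "\<dots> \<le> c * (Ti / 2)" using c(2) Ti by (simp add: field_simps)
    finally show "T1 \<le> Ti / 2" using cp by simp
    have "sqrt ((c / 2)\<^sup>2) \<le> sqrt (c\<^sup>2 - 2 * q0)"
      using c(3) q0 by (intro real_sqrt_le_mono) (simp add: power_divide)
    thus "T0 - T1 \<ge> c" using cp by (simp add: T0_def T1_def T_0_def T_1_def)
  qed (use T01[OF c(1)] in \<open>auto simp: T0_def T1_def\<close>)
  have u_ge: "u y \<ge> Ti" if "y \<in> {0..1}" for y using profile_props(1)[OF a that] by (simp add: u_def)
  have u_lt: "u y < T0" if "0 \<le> y" "y < 1" for y
  proof -
    have "sol (shoot (T_0 q0 c) c) c y < G (T_0 q0 c)"
      using sol_above_T0[OF c(1) shoot_pos[OF a] that] sol_shoot[OF a] by force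
    hence "G (u y) < G T0" using profile_props(4)[OF a, of y] that by (simp add: u_def T0_def)
    thus ?thesis using G_less_iff[OF u_ge, of y T0] T01(4)[OF c(1)] that by (simp add: T0_def)
  qed
  define d where "d y = shoot (T_0 q0 c) c * F c (u y) y / \<phi> (u y)" for y
  have u_d: "(u has_real_derivative d y) (at y)" if "0 < y" "y < 1" for y
    unfolding d_def u_def by (rule profile_deriv[OF a that])
  have u_cont: "continuous_on {0..1} u" unfolding u_def by (rule profile_cont_y[OF a])
  have d_ge: "d y \<ge> b / M * x" if y: "0 < y" "y < 1" and x: "0 \<le> x" "x \<le> F c (u y) y" for y x
  proof -
    have "b * x * \<phi> (u y) \<le> shoot (T_0 q0 c) c * F c (u y) y * M"
      using b le x \<phi>_le[OF u_ge[of y]] \<phi>_ge[OF u_ge[of y]] m y by (intro mult_mono) auto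
    thus ?thesis unfolding d_def using M \<phi>_ge[OF u_ge[of y]] m y by (simp add: field_simps)
  qed
  define rate where "rate = b / M * (c / 2)"
  have F_ge: "F c (u y) y \<ge> (u y - T1) * (T0 - u y) / 2" "F c (u y) y \<ge> q0 * Zf y"
    if "0 < y" "y < 1" for y
  proof -
    have "(u y - T1) * (T0 - u y) / 2 \<ge> 0" using u_ge[of y] u_lt[of y] T Ti that by simp
    thus "F c (u y) y \<ge> (u y - T1) * (T0 - u y) / 2" "F c (u y) y \<ge> q0 * Zf y"
      using F_factor[OF c(1), of "u y" y] q0 Zf_nonneg[of y] by (auto simp: T0_def T1_def)
  qed
  define \<Lambda> where "\<Lambda> y = ln (u y - T1) - ln (T0 - u y) - rate * y" for y
  have "\<Lambda> 0 \<le> \<Lambda> (1/4)"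
  proof (rule DERIV_nonneg_imp_increasing_open[where f = \<Lambda> and a = 0 and b = "1/4"])
    have "continuous_on {0..1/4} u" using u_cont by (rule continuous_on_subset) auto
    moreover have "u y - T1 \<noteq> 0" "T0 - u y \<noteq> 0" if "y \<in> {0..1/4}" for y
      using u_ge[of y] u_lt[of y] T Ti that by auto
    ultimately show "continuous_on {0..1/4} \<Lambda>" unfolding \<Lambda>_def[abs_def]
      by (intro continuous_intros) auto
    fix y :: real assume y: "0 < y" "y < 1/4"
    have p: "u y - T1 > 0" "T0 - u y > 0" using u_ge[of y] u_lt[of y] T Ti y by auto
    have "(\<Lambda> has_real_derivative d y / (u y - T1) + d y / (T0 - u y) - rate) (at y)"
      unfolding \<Lambda>_def[abs_def] using u_d[of y] p y by (auto intro!: derivative_eq_intros)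
    moreover have "d y / (u y - T1) + d y / (T0 - u y) - rate \<ge> 0"
    proof -
      have "b / M * ((u y - T1) * (T0 - u y) / 2) \<le> d y"
        using y p F_ge(1)[of y] by (intro d_ge) auto
      hence "b / M * ((u y - T1) * (T0 - u y) / 2) * ((T0 - T1) / ((u y - T1) * (T0 - u y))) \<le> d y * ((T0 - T1) / ((u y - T1) * (T0 - u y)))"
        using p by (intro mult_right_mono) auto
      moreover have "b / M * ((u y - T1) * (T0 - u y) / 2) * ((T0 - T1) / ((u y - T1) * (T0 - u y))) = b / M * ((T0 - T1) / 2)"
      proof -
        have "b / M * (X / 2) * (D / X) = b / M * (D / 2)" if "X \<noteq> 0" for X D :: real using that by simp
        note aux = this
        show ?thesis by (rule aux) (use p in auto)
      qed
      moreover have "d y * ((T0 - T1) / ((u y - T1) * (T0 - u y))) = d y / (u y - T1) + d y / (T0 - u y)"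
        using p by (simp add: field_simps)
      moreover have "b / M * ((T0 - T1) / 2) \<ge> rate" unfolding rate_def
        using T b M by (intro mult_left_mono) auto
      ultimately show ?thesis by linarith
    qed
    ultimately show "\<exists>z. (\<Lambda> has_real_derivative z) (at y) \<and> 0 \<le> z" by blast
  qed simp
  moreover have "\<Lambda> 0 \<ge> ln (Ti / 2) - ln (2 * c)"
  proof -
    have "ln (Ti / 2) \<le> ln (u 0 - T1)" "ln (T0 - u 0) \<le> ln (2 * c)"
      using u_ge[of 0] u_lt[of 0] T Ti by auto
    thus ?thesis by (simp add: \<Lambda>_def)
  qed
  moreover have "\<Lambda> (1/4) \<le> ln (2 * c) - ln (T0 - u (1/4)) - rate / 4"
  proof -
    have "ln (u (1/4) - T1) \<le> ln (2 * c)"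
      using u_ge[of "1/4"] u_lt[of "1/4"] T Ti by auto
    thus ?thesis by (simp add: \<Lambda>_def)
  qed
  ultimately have "ln (T0 - u (1/4)) \<le> ln (2 * c) + ln (2 * c) - ln (Ti / 2) - rate / 4" by linarith
  also have "\<dots> = ln (8 * c\<^sup>2 / Ti * exp (- (rate / 4)))"
    using cp Ti ln_realpow[of 2 3] by (simp add: ln_mult ln_div power2_eq_square)
  finally have v: "T0 - u (1/4) \<le> 8 * c\<^sup>2 / Ti * exp (- (rate / 4))"
    using u_lt[of "1/4"] cp Ti by (subst (asm) ln_le_cancel_iff) auto
  define \<kappa> where "\<kappa> = b / M * (q0 * Zf (1/2))"
  have "u (1/4) - \<kappa> * (1/4) \<le> u (1/2) - \<kappa> * (1/2)"
  proof (rule DERIV_nonneg_imp_increasing_open[where f = "\<lambda>y. u y - \<kappa> * y" and a = "1/4" and b = "1/2"])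
    show "continuous_on {1/4..1/2} (\<lambda>y. u y - \<kappa> * y)"
      by (intro continuous_intros continuous_on_subset[OF u_cont]) auto
    fix y :: real assume y: "1/4 < y" "y < 1/2"
    have "q0 * Zf (1/2) \<le> q0 * Zf y" using q0 Zf_antimono[of y "1/2"] y by simp
    also have "\<dots> \<le> F c (u y) y" using F_ge(2)[of y] y by simp
    finally have "\<kappa> \<le> d y" unfolding \<kappa>_def using q0 Zf_nonneg[of "1/2"] y by (intro d_ge) auto
    thus "\<exists>z. ((\<lambda>y. u y - \<kappa> * y) has_real_derivative z) (at y) \<and> 0 \<le> z"
      using u_d[of y] y by (intro exI[of _ "d y - \<kappa>"]) (auto intro!: derivative_eq_intros)
  qed simp
  hence "\<kappa> / 4 \<le> T0 - u (1/4)" using u_lt[of "1/2"] by simp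
  also note v
  also have "rate / 4 = b * c / (8 * M)" by (simp add: rate_def)
  finally show ?thesis by (simp add: \<kappa>_def)
qed

lemma \<beta>0_at_top: "filterlim \<beta>0 at_top at_top"
  unfolding \<beta>0_def
proof (rule filterlim_viscosity)
  fix b :: real assume b: "b > 0"
  have M: "M > 0" using \<phi>_ge[of Ti] \<phi>_le[of Ti] m by simp
  define \<kappa> where "\<kappa> = b / M * (q0 * Zf (1/2)) / 4"
  have \<kappa>: "\<kappa> > 0" unfolding \<kappa>_def using b M q0 Zf_pos[of "1/2"] by simp
  define r where "r = b / (8 * M)"
  have r: "r > 0" using b M by (simp add: r_def)
  \<comment> \<open>beyond \<open>c0\<close> the bound \<open>exp (r c) \<ge> (r c / 3)^3\<close> makes the estimate of \<open>shoot_T0_bound\<close> fail\<close>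
  define c0 where "c0 = 8 / Ti * 27 / r ^ 3 / \<kappa>"
  have "\<forall>\<^sub>F c in at_top. c > max (max (c_cj q0) (4 * q0 / Ti)) (max (max 1 (4 * q0)) c0)"
    by (rule eventually_gt_at_top)
  thus "\<forall>\<^sub>F c in at_top. 0 < shoot (T_0 q0 c) c \<and> shoot (T_0 q0 c) c < b"
  proof eventually_elim
    case (elim c)
    hence c: "c \<ge> c_cj q0" "c \<ge> 4 * q0 / Ti" "c > 1" "c \<ge> 4 * q0" "c > c0" by auto
    have "c * 1 \<le> c * c" using c by (intro mult_left_mono) auto
    hence c2: "c\<^sup>2 \<ge> 4 * q0" using c unfolding power2_eq_square by linarith
    have "\<not> b \<le> shoot (T_0 q0 c) c"
    proof
      assume "b \<le> shoot (T_0 q0 c) c"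
      from shoot_T0_bound[OF b c(1,2) c2 this]
      have 1: "\<kappa> \<le> 8 * c\<^sup>2 / Ti * exp (- (r * c))" by (simp add: \<kappa>_def r_def)
      have "r * c / 3 \<le> exp (r * c / 3)" using exp_ge_add_one_self[of "r * c / 3"] by linarith
      hence "(r * c / 3) ^ 3 \<le> exp (r * c / 3) ^ 3" using r c by (intro power_mono) auto
      also have "\<dots> = exp (r * c)" by (simp flip: exp_of_nat_mult)
      finally have "exp (- (r * c)) \<le> 27 / (r * c) ^ 3"
        using r c by (simp add: exp_minus field_simps power_divide)
      hence "\<kappa> \<le> 8 * c\<^sup>2 / Ti * (27 / (r * c) ^ 3)"
        using 1 Ti by (elim order_trans) (intro mult_left_mono, auto)
      also have "\<dots> = 8 / Ti * 27 / r ^ 3 / c"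
        using c by (simp add: power_mult_distrib power2_eq_square power3_eq_cube)
      finally have "\<kappa> * c \<le> 8 / Ti * 27 / r ^ 3 / c * c" using c by (intro mult_right_mono) auto
      hence "\<kappa> * c \<le> 8 / Ti * 27 / r ^ 3" using c by simp
      hence "c \<le> c0" unfolding c0_def pos_le_divide_eq[OF \<kappa>] by (simp only: mult.commute)
      thus False using c by simp
    qed
    thus ?case using shoot_pos[OF admissible_T0[OF c(1)]] by simp
  qed
qed

end

section \<open>Wave profiles\<close>

text \<open>By the fundamental theorem of calculus \<open>T\<close> is a primitive of \<open>R\<close> across the exceptional points. It
  saves the matching of one-sided derivatives where the pieces of a wave are joined.\<close>
lemma has_derivative_removable_points:
  fixes T R :: "real \<Rightarrow> real"
  assumes T: "continuous_on UNIV T" and R: "continuous_on UNIV R" and fin: "finite P"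
    and der: "\<And>x. x \<notin> P \<Longrightarrow> (T has_real_derivative R x) (at x)"
  shows "(T has_real_derivative R x) (at x)"
proof -
  have ftc: "(R has_integral T y - T (x - 1)) {x - 1..y}" if "x - 1 \<le> y" for y
    by (rule fundamental_theorem_of_calculus_interior_strong[OF fin that])
      (use der continuous_on_subset[OF T subset_UNIV] in \<open>auto simp flip: has_real_derivative_iff_has_vector_derivative\<close>)
  have "((\<lambda>y. integral {x - 1..y} R) has_real_derivative R x) (at x within {x - 1..x + 1})"
    by (rule integral_has_real_derivative[OF continuous_on_subset[OF R subset_UNIV]]) auto
  hence "((\<lambda>y. integral {x - 1..y} R) has_real_derivative R x) (at x)"
    using at_within_interior[of x "{x - 1..x + 1}"] by simp
  hence "((\<lambda>y. integral {x - 1..y} R + T (x - 1)) has_real_derivative R x) (at x)"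
    by (auto intro!: derivative_eq_intros)
  thus ?thesis
  proof (rule has_field_derivative_transform_within_open[of _ _ _ "{x - 1<..}"])
    fix y assume "y \<in> {x - 1<..}"
    thus "integral {x - 1..y} R + T (x - 1) = T y" using integral_unique[OF ftc[of y]] by simp
  qed auto
qed

text \<open>The solution of \<open>2 \<beta> x' = (x - r1) (x - r2)\<close> with \<open>x(0) = p\<close>. It describes the preheating zone
  (\<open>r1 = 0\<close>, \<open>r2 = 2 c\<close>) as well as the burnt zone (\<open>r1 = T1\<close>, \<open>r2 = T0\<close>).\<close>
definition logistic :: "real \<Rightarrow> real \<Rightarrow> real \<Rightarrow> real \<Rightarrow> real \<Rightarrow> real" where
  "logistic r1 r2 p \<beta> \<xi> = r1 + (r2 - r1) / (1 - (p - r2) / (p - r1) * exp ((r2 - r1) / (2 * \<beta>) * \<xi>))"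

lemma logistic_deriv:
  assumes "1 - (p - r2) / (p - r1) * exp ((r2 - r1) / (2 * \<beta>) * \<xi>) \<noteq> 0" "\<beta> \<noteq> 0"
  shows "(logistic r1 r2 p \<beta> has_real_derivative
    (logistic r1 r2 p \<beta> \<xi> - r1) * (logistic r1 r2 p \<beta> \<xi> - r2) / (2 * \<beta>)) (at \<xi>)"
proof -
  define C where "C = (p - r2) / (p - r1)"
  define k where "k = (r2 - r1) / (2 * \<beta>)"
  define e where "e = exp (k * \<xi>)"
  have nz: "1 - C * e \<noteq> 0" using assms by (simp add: C_def k_def e_def)
  have "(logistic r1 r2 p \<beta> has_real_derivative (r2 - r1) * (C * (k * e)) / (1 - C * e)\<^sup>2) (at \<xi>)"
    unfolding logistic_def[abs_def] C_def[symmetric] k_def[symmetric]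
    using nz by (auto intro!: derivative_eq_intros simp: e_def power2_eq_square)
  moreover have "logistic r1 r2 p \<beta> \<xi> - r1 = (r2 - r1) / (1 - C * e)"
    by (simp add: logistic_def C_def k_def e_def)
  moreover have "logistic r1 r2 p \<beta> \<xi> - r2 = (r2 - r1) * C * e / (1 - C * e)"
  proof -
    have "logistic r1 r2 p \<beta> \<xi> - r2 = (r2 - r1) / (1 - C * e) - (r2 - r1)"
      by (simp add: logistic_def C_def k_def e_def)
    thus ?thesis using nz by (simp add: field_simps)
  qed
  moreover have "(r2 - r1) * (C * (k * e)) / (1 - C * e)\<^sup>2 =
     ((r2 - r1) / (1 - C * e)) * ((r2 - r1) * C * e / (1 - C * e)) / (2 * \<beta>)"
    by (simp add: k_def power2_eq_square mult_ac)
  ultimately show ?thesis by metis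
qed

lemma logistic_0: "p \<noteq> r1 \<Longrightarrow> r1 \<noteq> r2 \<Longrightarrow> logistic r1 r2 p \<beta> 0 = p"
  by (simp add: logistic_def field_simps)

lemma logistic_backward:
  assumes r: "r1 < r2" "r1 < p" "\<beta> > 0" and x: "\<xi> \<le> 0"
  shows "1 - (p - r2) / (p - r1) * exp ((r2 - r1) / (2 * \<beta>) * \<xi>) > 0" (is ?pos)
    and "r2 < p \<Longrightarrow> r2 < logistic r1 r2 p \<beta> \<xi> \<and> logistic r1 r2 p \<beta> \<xi> \<le> p"
    and "p < r2 \<Longrightarrow> p \<le> logistic r1 r2 p \<beta> \<xi> \<and> logistic r1 r2 p \<beta> \<xi> < r2"
    and "\<bar>logistic r1 r2 p \<beta> \<xi> - r2\<bar> \<le>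
      (r2 - r1) * \<bar>(p - r2) / (p - r1)\<bar> / min 1 (1 - (p - r2) / (p - r1)) * exp ((r2 - r1) / (2 * \<beta>) * \<xi>)"
proof -
  define C where "C = (p - r2) / (p - r1)"
  define k where "k = (r2 - r1) / (2 * \<beta>)"
  define e where "e = exp (k * \<xi>)"
  define D where "D = 1 - C * e"
  have "k > 0" using r by (simp add: k_def)
  hence e: "0 < e" "e \<le> 1" using x by (auto simp: e_def mult_nonneg_nonpos)
  have C1: "C < 1" using r by (simp add: C_def field_simps)
  have C2: "1 - C = (r2 - r1) / (p - r1)" using r by (simp add: C_def field_simps)
  have D: "D \<ge> min 1 (1 - C)"
  proof (cases "C \<le> 0")
    case True
    hence "C * e \<le> 0" using e by (simp add: mult_nonpos_nonneg)
    thus ?thesis by (simp add: D_def)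
  next
    case False
    hence "C * e \<le> C * 1" using e by (intro mult_left_mono) auto
    thus ?thesis by (simp add: D_def)
  qed
  have mn: "min 1 (1 - C) > 0" using C1 by simp
  have D0: "D > 0" using D mn by linarith
  thus ?pos by (simp add: D_def C_def e_def k_def)
  have L: "logistic r1 r2 p \<beta> \<xi> = r1 + (r2 - r1) / D"
    by (simp add: logistic_def D_def C_def e_def k_def)
  have P: "p = r1 + (r2 - r1) / (1 - C)" using r by (simp add: C2)
  show "r2 < logistic r1 r2 p \<beta> \<xi> \<and> logistic r1 r2 p \<beta> \<xi> \<le> p" if "r2 < p"
  proof
    have "C > 0" using that r by (simp add: C_def)
    hence "C * e \<le> C * 1" "C * e > 0" using e by (auto intro!: mult_left_mono)
    hence "D < 1" "1 - C \<le> D" by (auto simp: D_def)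
    hence "(r2 - r1) / 1 < (r2 - r1) / D" using r D0 by (intro divide_strict_left_mono) auto
    thus "r2 < logistic r1 r2 p \<beta> \<xi>" by (simp add: L)
    have "(r2 - r1) / D \<le> (r2 - r1) / (1 - C)" using r D0 C1 \<open>1 - C \<le> D\<close> by (intro divide_left_mono) auto
    thus "logistic r1 r2 p \<beta> \<xi> \<le> p" using P L by linarith
  qed
  show "p \<le> logistic r1 r2 p \<beta> \<xi> \<and> logistic r1 r2 p \<beta> \<xi> < r2" if "p < r2"
  proof
    have "C < 0" using that r by (simp add: C_def divide_neg_pos)
    hence "C * 1 \<le> C * e" "C * e < 0" using e by (auto intro!: mult_left_mono_neg simp: mult_neg_pos)
    hence "D > 1" "D \<le> 1 - C" by (auto simp: D_def)
    hence "(r2 - r1) / D < (r2 - r1) / 1" using r D0 by (intro divide_strict_left_mono) auto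
    thus "logistic r1 r2 p \<beta> \<xi> < r2" by (simp add: L)
    have "(r2 - r1) / (1 - C) \<le> (r2 - r1) / D" using r D0 C1 \<open>D \<le> 1 - C\<close> by (intro divide_left_mono) auto
    thus "p \<le> logistic r1 r2 p \<beta> \<xi>" using P L by linarith
  qed
  have "logistic r1 r2 p \<beta> \<xi> - r2 = (r2 - r1) * (C * e) / D"
    using D0 by (simp add: L D_def field_simps)
  hence "\<bar>logistic r1 r2 p \<beta> \<xi> - r2\<bar> = (r2 - r1) * (\<bar>C\<bar> * e) / D"
    using D0 e r by (simp add: abs_mult)
  also have "\<dots> \<le> (r2 - r1) * (\<bar>C\<bar> * e) / min 1 (1 - C)"
    using D mn D0 e r by (intro divide_left_mono) auto
  finally show "\<bar>logistic r1 r2 p \<beta> \<xi> - r2\<bar> \<le>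
      (r2 - r1) * \<bar>(p - r2) / (p - r1)\<bar> / min 1 (1 - (p - r2) / (p - r1)) * exp ((r2 - r1) / (2 * \<beta>) * \<xi>)"
    by (simp add: C_def e_def k_def mult.assoc)
qed

lemma logistic_exp_convergent:
  assumes r: "r1 < r2" "r1 < p" "\<beta> > 0"
  shows "exp_convergent_at_bot (\<lambda>\<xi>. logistic r1 r2 p \<beta> (\<xi> + l)) r2"
proof -
  define B where "B = (r2 - r1) * \<bar>(p - r2) / (p - r1)\<bar> / min 1 (1 - (p - r2) / (p - r1))"
  define k where "k = (r2 - r1) / (2 * \<beta>)"
  have B: "B \<ge> 0" unfolding B_def using r by (intro divide_nonneg_pos mult_nonneg_nonneg) (auto simp: field_simps)
  have "\<forall>\<^sub>F \<xi> in at_bot. \<bar>logistic r1 r2 p \<beta> (\<xi> + l) - r2\<bar> \<le> (B * exp (k * l) + 1) * exp (k * \<xi>)"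
    using eventually_le_at_bot[of "- l"]
  proof eventually_elim
    case (elim \<xi>)
    have "\<bar>logistic r1 r2 p \<beta> (\<xi> + l) - r2\<bar> \<le> B * exp (k * (\<xi> + l))"
      unfolding B_def k_def using elim by (intro logistic_backward(4) r) auto
    also have "\<dots> = B * exp (k * l) * exp (k * \<xi>)" by (simp add: exp_add algebra_simps)
    also have "\<dots> \<le> (B * exp (k * l) + 1) * exp (k * \<xi>)" by (intro mult_right_mono) auto
    finally show ?case .
  qed
  moreover have "B * exp (k * l) + 1 > 0" "k > 0" using B r by (auto simp: k_def intro!: add_nonneg_pos)
  ultimately show ?thesis unfolding exp_convergent_at_bot_def by blast
qed

lemma exp_convergent_imp_tendsto:
  assumes "exp_convergent_at_bot T L" shows "(T \<longlongrightarrow> L) at_bot"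
proof -
  obtain C k where C: "C > 0" "k > 0" "\<forall>\<^sub>F \<xi> in at_bot. \<bar>T \<xi> - L\<bar> \<le> C * exp (k * \<xi>)"
    using assms unfolding exp_convergent_at_bot_def by blast
  have "((\<lambda>\<xi>. exp (k * \<xi>)) \<longlongrightarrow> 0) at_bot"
  proof (rule filterlim_compose[OF exp_at_bot])
    show "LIM x at_bot. k * x :> at_bot"
      by (rule filterlim_tendsto_pos_mult_at_bot[OF tendsto_const C(2) filterlim_ident])
  qed
  hence "((\<lambda>\<xi>. C * exp (k * \<xi>)) \<longlongrightarrow> 0) at_bot" using tendsto_mult_right_zero by blast
  hence "((\<lambda>\<xi>. T \<xi> - L) \<longlongrightarrow> 0) at_bot"
    by (rule Lim_null_comparison[rotated]) (use C in simp)
  thus ?thesis using LIM_zero_cancel by blast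
qed

lemma exp_convergent_cong:
  assumes "exp_convergent_at_bot f L" "\<And>\<xi>. \<xi> \<le> a \<Longrightarrow> T \<xi> = f \<xi>"
  shows "exp_convergent_at_bot T L"
proof -
  obtain C k where C: "C > 0" "k > 0" "\<forall>\<^sub>F \<xi> in at_bot. \<bar>f \<xi> - L\<bar> \<le> C * exp (k * \<xi>)"
    using assms unfolding exp_convergent_at_bot_def by blast
  have "\<forall>\<^sub>F \<xi> in at_bot. \<bar>T \<xi> - L\<bar> \<le> C * exp (k * \<xi>)"
    using C(3) eventually_le_at_bot[of a] by eventually_elim (simp add: assms(2))
  thus ?thesis using C unfolding exp_convergent_at_bot_def by blast
qed

lemma preheat_profile:
  assumes "0 < Ti" "Ti < c" "\<beta> > (0::real)"
  defines "P \<equiv> logistic 0 (2 * c) Ti \<beta>"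
  shows "P 0 = Ti" "\<xi> > 0 \<Longrightarrow> P \<xi> < Ti" "\<xi> \<ge> 0 \<Longrightarrow> P \<xi> > 0" "(P \<longlongrightarrow> 0) at_top"
    "\<xi> \<ge> 0 \<Longrightarrow> (P has_real_derivative (- c * P \<xi> + (P \<xi>)\<^sup>2 / 2) / \<beta>) (at \<xi>)"
proof -
  define a where "a = (2 * c - Ti) / Ti"
  have a: "a > 0" using assms(1-3) by (simp add: a_def)
  have P: "P \<xi> = 2 * c / (1 + a * exp (c / \<beta> * \<xi>))" for \<xi>
    using assms(1-3) by (simp add: P_def logistic_def a_def field_simps)
  have a1: "1 + a = 2 * c / Ti" using assms(1-3) by (simp add: a_def field_simps)
  show "P 0 = Ti" unfolding P_def by (rule logistic_0) (use assms(1-3) in auto)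
  have pos: "1 + a * exp (c / \<beta> * \<xi>) > 0" for \<xi> using a by (intro add_pos_pos) auto
  show "P \<xi> > 0" if "\<xi> \<ge> 0" using pos[of \<xi>] assms(1-3) by (simp add: P)
  show "P \<xi> < Ti" if "\<xi> > 0"
  proof -
    have "c / \<beta> * \<xi> > 0" using that assms(1-3) by simp
    hence "a * 1 < a * exp (c / \<beta> * \<xi>)" using a by (intro mult_strict_left_mono) auto
    hence "2 * c / (1 + a * exp (c / \<beta> * \<xi>)) < 2 * c / (1 + a)"
      using a assms(1-3) pos[of \<xi>] by (intro divide_strict_left_mono) (auto intro!: mult_pos_pos)
    thus ?thesis using a1 assms(1-3) by (simp add: P)
  qed
  show "(P has_real_derivative (- c * P \<xi> + (P \<xi>)\<^sup>2 / 2) / \<beta>) (at \<xi>)" if "\<xi> \<ge> 0"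
  proof -
    have "1 - (Ti - 2 * c) / (Ti - 0) * exp ((2 * c - 0) / (2 * \<beta>) * \<xi>) = 1 + a * exp (c / \<beta> * \<xi>)"
      using assms(1-3) by (simp add: a_def field_simps)
    hence "(P has_real_derivative (P \<xi> - 0) * (P \<xi> - 2 * c) / (2 * \<beta>)) (at \<xi>)"
      unfolding P_def using pos[of \<xi>] assms(1-3) by (intro logistic_deriv) auto
    moreover have "(P \<xi> - 0) * (P \<xi> - 2 * c) / (2 * \<beta>) = (- c * P \<xi> + (P \<xi>)\<^sup>2 / 2) / \<beta>"
      using assms(1-3) by (simp add: field_simps power2_eq_square)
    ultimately show ?thesis by simp
  qed
  show "(P \<longlongrightarrow> 0) at_top" unfolding P
  proof (rule tendsto_divide_0[OF tendsto_const filterlim_at_top_imp_at_infinity])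
    have "c / \<beta> > 0" using assms(1-3) by simp
    hence "filterlim (\<lambda>x. c / \<beta> * x) at_top at_top"
      by (rule filterlim_tendsto_pos_mult_at_top[OF tendsto_const _ filterlim_ident])
    hence "filterlim (\<lambda>x. exp (c / \<beta> * x)) at_top at_top" by (rule filterlim_compose[OF exp_at_top])
    hence "filterlim (\<lambda>x. a * exp (c / \<beta> * x)) at_top at_top"
      by (rule filterlim_tendsto_pos_mult_at_top[OF tendsto_const a])
    thus "filterlim (\<lambda>x. 1 + a * exp (c / \<beta> * x)) at_top at_top"
      by (rule filterlim_tendsto_add_at_top[OF tendsto_const])
  qed
qed

context reactive_flow begin

text \<open>What is known of the wave with parameter \<open>b\<close> that continues the profile \<open>sol b c\<close> by \<open>B\<close> into the
  burnt zone.\<close>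
definition assembled where
  "assembled b c B l T Z \<longleftrightarrow> wave q0 K \<alpha> Ti \<phi> (viscosity b) c l T Z \<and>
     (\<forall>\<xi>\<le>-l. T \<xi> = B (\<xi> + l)) \<and>
     (\<forall>\<xi>. (T has_real_derivative (- c * T \<xi> + (T \<xi>)\<^sup>2 / 2 + q0 * (1 - Z \<xi>)) / viscosity b) (at \<xi>)) \<and>
     (\<forall>\<xi>. - l \<le> \<xi> \<longrightarrow> \<xi> \<le> 0 \<longrightarrow> (\<exists>y\<in>{0..1}. T \<xi> = S (sol b c y) \<and> Z \<xi> = Zf y)) \<and>
     (\<forall>\<xi>\<ge>0. 0 < T \<xi> \<and> T \<xi> \<le> Ti \<and> Z \<xi> = 1) \<and> (\<forall>\<xi>\<le>-l. Z \<xi> = 0)"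

lemma assembledD:
  assumes "assembled b c B l T Z"
  shows "wave q0 K \<alpha> Ti \<phi> (viscosity b) c l T Z"
    "\<xi> \<le> - l \<Longrightarrow> T \<xi> = B (\<xi> + l)"
    "(T has_real_derivative (- c * T \<xi> + (T \<xi>)\<^sup>2 / 2 + q0 * (1 - Z \<xi>)) / viscosity b) (at \<xi>)"
    "- l \<le> \<xi> \<Longrightarrow> \<xi> \<le> 0 \<Longrightarrow> \<exists>y\<in>{0..1}. T \<xi> = S (sol b c y) \<and> Z \<xi> = Zf y"
    "\<xi> \<ge> 0 \<Longrightarrow> 0 < T \<xi> \<and> T \<xi> \<le> Ti \<and> Z \<xi> = 1" "\<xi> \<le> - l \<Longrightarrow> Z \<xi> = 0"
  using assms unfolding assembled_def by blast+

text \<open>The progress variable turns back into space by inverting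
  \<open>y \<mapsto> integral {0..y} (1 / (K (1 - \<alpha>) \<phi>(T)))\<close>, whose value at 1 is the length of the reaction zone.
  The three pieces join continuously, and the right-hand side of the temperature equation is
  continuous across the joints, so \<open>T\<close> is continuously differentiable there.\<close>
lemma wave_assembly:
  assumes c: "c \<ge> c_cj q0" and b: "b > 0" and pos: "sol b c 1 > 0"
    and B_0: "B 0 = S (sol b c 1)"
    and B_deriv: "\<And>\<xi>. \<xi> \<le> 0 \<Longrightarrow> (B has_real_derivative (- c * B \<xi> + (B \<xi>)\<^sup>2 / 2 + q0) / viscosity b) (at \<xi>)"
    and B_gt: "\<And>\<xi>. \<xi> \<le> 0 \<Longrightarrow> B \<xi> > Ti"
    and B_lim: "(B \<longlongrightarrow> T_minus) at_bot" "T_minus \<in> {T_0 q0 c, T_1 q0 c}"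
  shows "\<exists>l T Z. assembled b c B l T Z \<and> (T \<longlongrightarrow> T_minus) at_bot"
proof -
  define \<beta> where "\<beta> = viscosity b"
  have \<beta>: "\<beta> > 0" "1 / \<beta> = b * (K * (1 - \<alpha>))" using viscosity_pos[OF b] by (auto simp: \<beta>_def viscosity_def)
  define u where "u y = S (sol b c y)" for y
  have u_ge: "u y \<ge> Ti" if "y \<in> {0..1}" for y
    unfolding u_def by (rule S_ge[OF sol_nonneg[OF c b pos that]])
  have u_cont: "continuous_on {0..1} u" unfolding u_def
    by (rule continuous_on_compose2[OF S_cont sol_cont[OF c b]]) (use sol_nonneg[OF c b pos] in auto)
  \<comment> \<open>the density of space with respect to progress; \<open>min 1\<close> extends it constantly beyond the unit interval\<close>
  define h where "h y = 1 / (K * (1 - \<alpha>) * \<phi> (u (min 1 y)))" for y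
  have \<phi>u: "m \<le> \<phi> (u (min 1 y))" "\<phi> (u (min 1 y)) \<le> M" if "y \<ge> 0" for y
    using \<phi>_ge[OF u_ge[of "min 1 y"]] \<phi>_le[OF u_ge[of "min 1 y"]] that by auto
  have h_cont: "continuous_on {0..} h"
  proof -
    have "continuous_on {0..} (\<lambda>y. u (min 1 y))"
      by (rule continuous_on_compose2[OF u_cont]) (auto intro!: continuous_intros)
    hence "continuous_on {0..} (\<lambda>y. \<phi> (u (min 1 y)))"
      by (rule continuous_on_compose2[OF \<phi>_cont]) (use u_ge in auto)
    moreover have "K * (1 - \<alpha>) * \<phi> (u (min 1 y)) \<noteq> 0" if "y \<in> {0..}" for y
      using \<phi>u[of y] m rate_pos that by auto
    ultimately show ?thesis unfolding h_def by (intro continuous_intros) auto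
  qed
  have M: "M > 0" using \<phi>_ge[of Ti] \<phi>_le[of Ti] m by simp
  have h_ge: "h y \<ge> 1 / (K * (1 - \<alpha>) * M)" if "y \<ge> 0" for y
  proof -
    have "K * (1 - \<alpha>) * \<phi> (u (min 1 y)) \<le> K * (1 - \<alpha>) * M"
      using \<phi>u[OF that] rate_pos by (intro mult_left_mono) auto
    moreover have "K * (1 - \<alpha>) * \<phi> (u (min 1 y)) > 0" using \<phi>u[OF that] m rate_pos by simp
    ultimately show ?thesis unfolding h_def by (intro frac_le) (assumption | simp)+
  qed
  define Gs where "Gs t = integral {0..t} h" for t
  have "1 / (K * (1 - \<alpha>) * M) > 0" using rate_pos M by simp
  from inverse_of_primitive_exists[OF h_cont this h_ge]
  obtain Y where Y: "inverse_of_primitive 0 h (1 / (K * (1 - \<alpha>) * M)) Gs Y"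
    unfolding Gs_def[abs_def] by blast
  have Y0: "Y 0 = 0" and Y_nn: "\<And>s. s \<ge> 0 \<Longrightarrow> Y s \<ge> 0" and GY: "\<And>s. s \<ge> 0 \<Longrightarrow> Gs (Y s) = s"
    and G_nn: "\<And>t. t \<ge> 0 \<Longrightarrow> Gs t \<ge> 0" and YG: "\<And>t. t \<ge> 0 \<Longrightarrow> Y (Gs t) = t"
    and Y_less: "\<And>s s'. s \<ge> 0 \<Longrightarrow> s < s' \<Longrightarrow> Y s < Y s'"
    and Yd: "\<And>s. s \<ge> 0 \<Longrightarrow> (Y has_real_derivative 1 / h (Y s)) (at s within {0..})"
    using Y unfolding inverse_of_primitive_def by simp_all
  define l where "l = Gs 1"
  have Yl: "Y l = 1" unfolding l_def by (rule YG) simp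
  have l: "l > 0" using G_nn[of 1] Yl Y0 unfolding l_def by (metis less_eq_real_def zero_le_one zero_neq_one)
  have Y_in: "Y s \<in> {0..1}" if "0 \<le> s" "s \<le> l" for s
    using Y_nn[OF that(1)] Y_less[OF that(1), of l] that Yl by (cases "s = l") auto
  have Y_in': "0 < Y s" "Y s < 1" if "0 < s" "s < l" for s
    using Y_less[of 0 s] Y_less[of s l] that Yl Y0 by auto
  have Y_cont: "continuous_on {0..} Y" using Yd by (intro DERIV_continuous_on) auto
  define \<eta> where "\<eta> \<xi> = Y (- \<xi>)" for \<xi>
  have \<eta>_in: "\<eta> \<xi> \<in> {0..1}" if "- l \<le> \<xi>" "\<xi> \<le> 0" for \<xi> using Y_in[of "-\<xi>"] that by (simp add: \<eta>_def)
  have \<eta>_cont: "continuous_on {-l..0} \<eta>" unfolding \<eta>_def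
    by (rule continuous_on_compose2[OF Y_cont]) (auto intro!: continuous_intros)
  have \<eta>_deriv: "(\<eta> has_real_derivative - (K * (1 - \<alpha>) * \<phi> (u (\<eta> \<xi>)))) (at \<xi>)" if x: "- l < \<xi>" "\<xi> < 0" for \<xi>
  proof -
    have "(Y has_real_derivative 1 / h (Y (-\<xi>))) (at (-\<xi>))"
      using Yd[of "-\<xi>"] at_within_interior[of "-\<xi>" "{0..}"] x by simp
    moreover have "min 1 (Y (-\<xi>)) = Y (-\<xi>)" using Y_in[of "-\<xi>"] x by simp
    ultimately have "(Y has_real_derivative K * (1 - \<alpha>) * \<phi> (u (\<eta> \<xi>))) (at (-\<xi>))"
      by (simp add: h_def \<eta>_def)
    thus ?thesis unfolding \<eta>_def[abs_def] by (simp only: DERIV_mirror)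
  qed
  define P where "P = logistic 0 (2 * c) Ti \<beta>"
  note P = preheat_profile[OF Ti Ti_less_c[OF c] \<beta>(1), folded P_def]
  define T where "T \<xi> = (if \<xi> \<ge> 0 then P \<xi> else if \<xi> \<ge> -l then u (\<eta> \<xi>) else B (\<xi> + l))" for \<xi>
  define Z where "Z \<xi> = (if \<xi> \<ge> 0 then 1 else if \<xi> \<ge> -l then Zf (\<eta> \<xi>) else 0)" for \<xi>
  have T1: "T \<xi> = P \<xi>" "Z \<xi> = 1" if "\<xi> \<ge> 0" for \<xi> using that by (auto simp: T_def Z_def)
  have \<eta>0: "\<eta> 0 = 0" "\<eta> (-l) = 1" using Y0 Yl by (auto simp: \<eta>_def)
  have T2: "T \<xi> = u (\<eta> \<xi>)" "Z \<xi> = Zf (\<eta> \<xi>)" if "- l \<le> \<xi>" "\<xi> \<le> 0" for \<xi>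
    using that P(1) \<eta>0 sol_0[OF c b] S_0 Zf_0 by (auto simp: T_def Z_def u_def)
  have T3: "T \<xi> = B (\<xi> + l)" "Z \<xi> = 0" if "\<xi> \<le> -l" for \<xi>
    using that l \<eta>0 B_0 Zf_1 by (auto simp: T_def Z_def u_def)
  have un: "(UNIV :: real set) = ({..-l} \<union> {-l..0}) \<union> {0..}" using l by auto
  have u\<eta>: "continuous_on {-l..0} (\<lambda>\<xi>. u (\<eta> \<xi>))"
    by (rule continuous_on_compose2[OF u_cont \<eta>_cont]) (use \<eta>_in in auto)
  have T_cont: "continuous_on UNIV T"
    unfolding un
  proof (intro continuous_on_closed_Un closed_Un)
    have "continuous_on {..0} B"
      using B_deriv by (intro DERIV_continuous_on) (auto intro: has_field_derivative_at_within)
    hence "continuous_on {..-l} (\<lambda>\<xi>. B (\<xi> + l))"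
      by (rule continuous_on_compose2) (auto intro!: continuous_intros)
    thus "continuous_on {..-l} T" by (rule continuous_on_eq) (use T3 in auto)
    show "continuous_on {-l..0} T" using u\<eta> by (rule continuous_on_eq) (use T2 in auto)
    have "continuous_on {0..} P"
      using P(5) by (intro DERIV_continuous_on) (auto intro: has_field_derivative_at_within)
    thus "continuous_on {0..} T" by (rule continuous_on_eq) (use T1 in auto)
  qed auto
  have Z_cont: "continuous_on UNIV Z"
    unfolding un
  proof (intro continuous_on_closed_Un closed_Un)
    show "continuous_on {..-l} Z" using continuous_on_const[of _ 0] by (rule continuous_on_eq) (use T3 in auto)
    have "continuous_on {-l..0} (\<lambda>\<xi>. Zf (\<eta> \<xi>))"
      by (rule continuous_on_compose2[OF Zf_cont \<eta>_cont]) (use \<eta>_in in auto)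
    thus "continuous_on {-l..0} Z" by (rule continuous_on_eq) (use T2 in auto)
    show "continuous_on {0..} Z" using continuous_on_const[of _ 1] by (rule continuous_on_eq) (use T1 in auto)
  qed auto
  define R where "R \<xi> = (- c * T \<xi> + (T \<xi>)\<^sup>2 / 2 + q0 * (1 - Z \<xi>)) / \<beta>" for \<xi>
  have R_cont: "continuous_on UNIV R" unfolding R_def[abs_def]
    using \<beta> by (intro continuous_intros T_cont Z_cont) auto
  have T_deriv: "(T has_real_derivative R \<xi>) (at \<xi>)" for \<xi>
  proof (rule has_derivative_removable_points[OF T_cont R_cont, of "{0, -l}"])
    fix \<xi> assume x: "\<xi> \<notin> {0, -l}"
    consider "\<xi> > 0" | "-l < \<xi>" "\<xi> < 0" | "\<xi> < -l" using x by force
    thus "(T has_real_derivative R \<xi>) (at \<xi>)"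
    proof cases
      case 1
      have "(P has_real_derivative R \<xi>) (at \<xi>)" using P(5)[of \<xi>] 1 T1 by (simp add: R_def)
      thus ?thesis
        by (rule has_field_derivative_transform_within_open[of _ _ _ "{0<..}"]) (use 1 T1 in auto)
    next
      case 2
      let ?y = "\<eta> \<xi>"
      have y: "0 < ?y" "?y < 1" using Y_in'[of "-\<xi>"] 2 by (auto simp: \<eta>_def)
      have y01: "?y \<in> {0..1}" using y by simp
      have "(S has_real_derivative 1 / \<phi> (S (sol b c ?y))) (at (sol b c ?y))"
        using S_deriv[of "sol b c ?y"] sol_positive[OF c b pos y(1)] y
          at_within_interior[of "sol b c ?y" "{0..}"] by simp
      from DERIV_chain2[OF this sol_deriv[OF c b y]]
      have "(u has_real_derivative b * F c (u ?y) ?y / \<phi> (u ?y)) (at ?y)"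
        using Tc_sol[OF c b pos y01] by (simp add: u_def[abs_def])
      from DERIV_chain2[OF this \<eta>_deriv[OF 2]]
      have "((\<lambda>\<xi>. u (\<eta> \<xi>)) has_real_derivative
         b * F c (u ?y) ?y / \<phi> (u ?y) * - (K * (1 - \<alpha>) * \<phi> (u ?y))) (at \<xi>)" .
      moreover have "b * F c (u ?y) ?y / \<phi> (u ?y) * - (K * (1 - \<alpha>) * \<phi> (u ?y)) = R \<xi>"
      proof -
        have "\<phi> (u ?y) > 0" using \<phi>_ge[OF u_ge[OF y01]] m by simp
        hence "b * F c (u ?y) ?y / \<phi> (u ?y) * - (K * (1 - \<alpha>) * \<phi> (u ?y)) = - F c (u ?y) ?y * (1 / \<beta>)"
          by (simp add: \<beta>(2))
        also have "\<dots> = R \<xi>" using T2[of \<xi>] 2 by (simp add: R_def F_def algebra_simps diff_divide_distrib add_divide_distrib)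
        finally show ?thesis .
      qed
      ultimately have "((\<lambda>\<xi>. u (\<eta> \<xi>)) has_real_derivative R \<xi>) (at \<xi>)" by simp
      thus ?thesis
        by (rule has_field_derivative_transform_within_open[of _ _ _ "{-l<..<0}"]) (use 2 T2 in auto)
    next
      case 3
      have "((\<lambda>\<xi>. B (\<xi> + l)) has_real_derivative R \<xi>) (at \<xi>)"
        using B_deriv[of "\<xi> + l"] 3 T3[of \<xi>] by (simp add: R_def \<beta>_def flip: DERIV_shift)
      thus ?thesis
        by (rule has_field_derivative_transform_within_open[of _ _ _ "{..<-l}"]) (use 3 T3 in auto)
    qed
  qed simp
  have dT: "deriv T \<xi> = R \<xi>" for \<xi> using T_deriv by (rule DERIV_imp_deriv)
  have T_lim: "(T \<longlongrightarrow> T_minus) at_bot"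
  proof -
    have "filterlim (\<lambda>\<xi>. \<xi> + l) at_bot at_bot"
      unfolding filterlim_at_bot
    proof
      fix x show "\<forall>\<^sub>F \<xi> in at_bot. \<xi> + l \<le> x"
        using eventually_le_at_bot[of "x - l"] by eventually_elim simp
    qed
    hence "((\<lambda>\<xi>. B (\<xi> + l)) \<longlongrightarrow> T_minus) at_bot" by (rule filterlim_compose[OF B_lim(1)])
    moreover have "\<forall>\<^sub>F \<xi> in at_bot. B (\<xi> + l) = T \<xi>"
      using eventually_le_at_bot[of "-l"] by eventually_elim (simp add: T3)
    ultimately show ?thesis by (rule Lim_transform_eventually)
  qed
  have Z_deriv: "(Z has_real_derivative K * \<phi> (T \<xi>) * Z \<xi> powr \<alpha>) (at \<xi>)" "Z \<xi> > 0" if x: "- l < \<xi>" "\<xi> < 0" for \<xi>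
  proof -
    let ?y = "\<eta> \<xi>"
    have y: "0 < ?y" "?y < 1" using Y_in'[of "-\<xi>"] x by (auto simp: \<eta>_def)
    show "Z \<xi> > 0" using T2[of \<xi>] x Zf_pos[OF y(2)] by simp
    have "((\<lambda>\<xi>. (1 - \<eta> \<xi>) powr p) has_real_derivative
        p * (1 - ?y) powr (p - 1) * (K * (1 - \<alpha>) * \<phi> (u ?y))) (at \<xi>)"
      using \<eta>_deriv[OF x] y DERIV_fun_powr[of "\<lambda>\<xi>. 1 - \<eta> \<xi>" "K * (1 - \<alpha>) * \<phi> (u ?y)" \<xi> p]
      by (auto intro!: derivative_eq_intros)
    moreover have "p * (1 - ?y) powr (p - 1) * (K * (1 - \<alpha>) * \<phi> (u ?y)) = K * \<phi> (T \<xi>) * Z \<xi> powr \<alpha>"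
    proof -
      have "p - 1 = p * \<alpha>" "p * (1 - \<alpha>) = 1" using \<alpha>1 by (auto simp: p_def field_simps)
      moreover have "p * (1 - ?y) powr (p - 1) * (K * (1 - \<alpha>) * \<phi> (u ?y)) =
        (p * (1 - \<alpha>)) * (K * \<phi> (u ?y) * (1 - ?y) powr (p - 1))" by simp
      ultimately show ?thesis using T2[of \<xi>] x by (simp add: Zf_def powr_powr)
    qed
    ultimately have "((\<lambda>\<xi>. Zf (\<eta> \<xi>)) has_real_derivative K * \<phi> (T \<xi>) * Z \<xi> powr \<alpha>) (at \<xi>)"
      by (simp add: Zf_def)
    thus "(Z has_real_derivative K * \<phi> (T \<xi>) * Z \<xi> powr \<alpha>) (at \<xi>)"
      by (rule has_field_derivative_transform_within_open[of _ _ _ "{-l<..<0}"]) (use x T2 in auto)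
  qed
  have T_gt: "T \<xi> > Ti" if "\<xi> < 0" for \<xi>
  proof (cases "\<xi> \<le> -l")
    case True thus ?thesis using T3 B_gt by simp
  next
    case False
    hence y: "0 < \<eta> \<xi>" "\<eta> \<xi> < 1" using Y_in'[of "-\<xi>"] that by (auto simp: \<eta>_def)
    hence "sol b c (\<eta> \<xi>) > 0" by (intro sol_positive[OF c b pos]) auto
    thus ?thesis using S_gt T2[of \<xi>] False that by (simp add: u_def)
  qed
  have "wave q0 K \<alpha> Ti \<phi> \<beta> c l T Z"
    unfolding wave_def
  proof (intro conjI allI impI)
    show "T C1_differentiable_on UNIV" unfolding C1_differentiable_on_def
      using T_deriv R_cont by (auto simp: has_real_derivative_iff_has_vector_derivative intro!: exI[of _ R])
    show "T 0 = Ti" using P(1) T1 by simp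
    show "T \<xi> < Ti" if "\<xi> > 0" for \<xi> using P(2) T1 that by simp
    show "\<beta> * deriv T \<xi> = - c * T \<xi> + (T \<xi>)\<^sup>2 / 2" if "\<xi> > 0" for \<xi> using T1[of \<xi>] that \<beta> by (simp add: dT R_def)
    show "(T \<longlongrightarrow> 0) at_top"
    proof (rule Lim_transform_eventually[OF P(4)])
      show "\<forall>\<^sub>F \<xi> in at_top. P \<xi> = T \<xi>" using eventually_ge_at_top[of 0] by eventually_elim (simp add: T1)
    qed
    show "\<beta> * deriv T \<xi> = - c * T \<xi> + (T \<xi>)\<^sup>2 / 2 + q0 * (1 - Z \<xi>)" if "- l < \<xi> \<and> \<xi> < 0" for \<xi>
      using \<beta> by (simp add: dT R_def)
    show "Z 0 = 1" "Z (- l) = 0" using T1[of 0] T3[of "-l"] by auto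
    show "\<beta> * deriv T \<xi> = - c * T \<xi> + (T \<xi>)\<^sup>2 / 2 + q0" if "\<xi> < - l" for \<xi>
      using \<beta> T3(2)[of \<xi>] that by (simp add: dT R_def)
    show "\<exists>T_minus\<in>{T_0 q0 c, T_1 q0 c}. (T \<longlongrightarrow> T_minus) at_bot" using T_lim B_lim by blast
  qed (use l T_cont Z_cont T_gt T1 T3 Z_deriv in auto)
  moreover have "0 < T \<xi> \<and> T \<xi> \<le> Ti" if "\<xi> \<ge> 0" for \<xi>
    using P(1) P(2)[of \<xi>] P(3)[of \<xi>] T1[of \<xi>] that by (cases "\<xi> = 0") auto
  moreover have "\<exists>y\<in>{0..1}. T \<xi> = S (sol b c y) \<and> Z \<xi> = Zf y" if "- l \<le> \<xi>" "\<xi> \<le> 0" for \<xi>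
    using T2[OF that] \<eta>_in[OF that] unfolding u_def by blast
  ultimately have "assembled b c B l T Z"
    using T_deriv T1 T3 unfolding assembled_def R_def \<beta>_def by blast
  thus ?thesis using T_lim by blast
qed

end

section \<open>Existence and nonexistence of waves\<close>

context reactive_flow begin

lemma burnt_rhs:
  assumes "c \<ge> c_cj q0"
  shows "- c * x + x\<^sup>2 / 2 + q0 = (x - T_1 q0 c) * (x - T_0 q0 c) / 2"
proof -
  have "- c * x + x\<^sup>2 / 2 + q0 = - ((x - T_1 q0 c) * (T_0 q0 c - x) / 2)"
    unfolding quadratic_factor[OF assms, symmetric] by simp
  also have "(x - T_1 q0 c) * (T_0 q0 c - x) = - ((x - T_1 q0 c) * (x - T_0 q0 c))"
    by (simp add: algebra_simps)
  finally show ?thesis by simp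
qed

lemma special_wave_exists:
  assumes a: "admissible t c"
  shows "\<exists>T Z l. wave q0 K \<alpha> Ti \<phi> (viscosity (shoot t c)) c l T Z \<and> (\<forall>\<xi>\<le>-l. T \<xi> = t) \<and> (T \<longlongrightarrow> t) at_bot"
proof -
  note d = admissibleD[OF a]
  have end_t: "S (sol (shoot t c) c 1) = t" using sol_shoot[OF a] S_G d by simp
  have t: "t \<in> {T_0 q0 c, T_1 q0 c}" using a by (auto simp: admissible_def)
  have "- c * t + t\<^sup>2 / 2 + q0 = 0" using burnt_rhs[OF d(1), of t] t by auto
  hence "\<exists>l T Z. assembled (shoot t c) c (\<lambda>_. t) l T Z \<and> (T \<longlongrightarrow> t) at_bot"
    by (intro wave_assembly[OF d(1) shoot_pos[OF a]]) (use sol_shoot[OF a] d end_t t in auto)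
  thus ?thesis using assembledD(1,2) by blast
qed

lemma strong_special_exists:
  assumes "c \<ge> c_cj q0" shows "\<exists>T Z. strong_special q0 K \<alpha> Ti \<phi> (\<beta>0 c) c T Z"
  using special_wave_exists[OF admissible_T0[OF assms]]
  unfolding \<beta>0_def strong_special_def strong_solution_def solution_def by blast

lemma weak_special_exists:
  assumes "c \<in> {c_cj q0..<c_star q0 Ti}" shows "\<exists>T Z. weak_special q0 K \<alpha> Ti \<phi> (\<beta>1 c) c T Z"
  using special_wave_exists[OF admissible_T1[OF assms]]
  unfolding \<beta>1_def weak_special_def weak_solution_def solution_def by blast

text \<open>The end value \<open>pe\<close> lies in the basin of attraction of \<open>T0\<close>, namely above \<open>T1\<close>.\<close>
lemma strong_wave_exists:
  assumes c: "c > c_cj q0" and b: "b > 0" and pos: "sol b c 1 > 0"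
    and pe: "pe = S (sol b c 1)" "pe > T_1 q0 c" "pe \<noteq> T_0 q0 c"
  defines "B \<equiv> logistic (T_1 q0 c) (T_0 q0 c) pe (viscosity b)"
  shows "\<exists>l T Z. assembled b c B l T Z \<and> exp_convergent_at_bot T (T_0 q0 c)"
proof -
  have c': "c \<ge> c_cj q0" using c by simp
  define \<beta> where "\<beta> = viscosity b"
  have \<beta>: "\<beta> > 0" unfolding \<beta>_def by (rule viscosity_pos[OF b])
  have r: "T_1 q0 c < T_0 q0 c" using disc_pos[OF q0 c] by (simp add: T_0_def T_1_def)
  note lb = logistic_backward[OF r pe(2) \<beta>, folded \<beta>_def]
  have B: "B = logistic (T_1 q0 c) (T_0 q0 c) pe \<beta>" by (simp add: B_def \<beta>_def)
  have B0: "B 0 = pe" unfolding B using r pe by (intro logistic_0) auto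
  have p_gt: "pe > Ti" unfolding pe(1) by (rule S_gt[OF pos])
  have ec: "exp_convergent_at_bot (\<lambda>\<xi>. B (\<xi> + l)) (T_0 q0 c)" for l
    unfolding B by (rule logistic_exp_convergent[OF r pe(2) \<beta>])
  have "\<exists>l T Z. assembled b c B l T Z \<and> (T \<longlongrightarrow> T_0 q0 c) at_bot"
  proof (rule wave_assembly[OF c' b pos])
    show "B 0 = S (sol b c 1)" using B0 pe by simp
    show "(B has_real_derivative (- c * B \<xi> + (B \<xi>)\<^sup>2 / 2 + q0) / viscosity b) (at \<xi>)" if "\<xi> \<le> 0" for \<xi>
      unfolding burnt_rhs[OF c'] B \<beta>_def[symmetric]
      using logistic_deriv[OF less_imp_neq[OF lb(1)[OF that], THEN not_sym]] \<beta> by simp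
    show "Ti < B \<xi>" if "\<xi> \<le> 0" for \<xi>
      using lb(2,3)[OF that] pe p_gt T01(4)[OF c'] unfolding B by (cases "pe < T_0 q0 c") auto
    show "(B \<longlongrightarrow> T_0 q0 c) at_bot" using exp_convergent_imp_tendsto[OF ec[of 0]] by simp
  qed simp
  then obtain l T Z where w: "assembled b c B l T Z" by blast
  have "exp_convergent_at_bot T (T_0 q0 c)"
    by (rule exp_convergent_cong[OF ec[of l], of "-l"]) (rule assembledD(2)[OF w])
  thus ?thesis using w by blast
qed

text \<open>Here the profile ends above \<open>T0\<close>, so at the end of the reaction zone the temperature increases with
  \<open>\<xi>\<close>, whereas it exceeds \<open>Ti\<close> inside; the maximum therefore lies strictly inside the zone.\<close>
lemma bump_exists:
  assumes c: "c > c_cj q0" and \<beta>: "0 < \<beta>" "\<beta> < \<beta>0 c"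
  shows "\<exists>T Z. strong_bump q0 K \<alpha> Ti \<phi> \<beta> c T Z"
proof -
  have c': "c \<ge> c_cj q0" using c by simp
  have a: "admissible (T_0 q0 c) c" by (rule admissible_T0[OF c'])
  define b where "b = viscosity \<beta>"
  have b: "b > 0" "viscosity b = \<beta>" unfolding b_def using viscosity_pos viscosity_involution \<beta> by auto
  have "shoot (T_0 q0 c) c < b"
    using \<beta> viscosity_less_iff[OF shoot_pos[OF a] b(1)] b by (simp add: \<beta>0_def)
  hence gt: "sol b c 1 > G (T_0 q0 c)" by (rule sol_greater_shoot[OF a])
  hence pos: "sol b c 1 > 0" using admissibleD(5)[OF a] by simp
  define pe where "pe = S (sol b c 1)"
  have "S (G (T_0 q0 c)) < pe" unfolding pe_def by (rule S_strict[OF G_nonneg gt]) (use admissibleD[OF a] in simp)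
  hence pe: "T_0 q0 c < pe" using S_G[of "T_0 q0 c"] admissibleD[OF a] by simp
  have r: "T_1 q0 c < T_0 q0 c" using disc_pos[OF q0 c] by (simp add: T_0_def T_1_def)
  obtain l T Z where as: "assembled b c (logistic (T_1 q0 c) (T_0 q0 c) pe \<beta>) l T Z"
    and ec: "exp_convergent_at_bot T (T_0 q0 c)"
    using strong_wave_exists[OF c b(1) pos pe_def] pe r unfolding b(2) by force
  note w = assembledD(1,2)[OF as, unfolded b(2)] exp_convergent_imp_tendsto[OF ec] ec
    assembledD(3,5,6)[OF as, unfolded b(2)]
  have l: "l > 0" and T0: "T 0 = Ti" and T1: "T 1 < Ti" and T_gt: "\<And>\<xi>. \<xi> < 0 \<Longrightarrow> T \<xi> > Ti"
    using w(1) by (auto simp: wave_def)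
  have Tl: "T (-l) = pe" using w(2)[of "-l"] logistic_0[of pe "T_1 q0 c" "T_0 q0 c" \<beta>] pe r by simp
  have T_burnt: "T \<xi> \<le> pe" if "\<xi> \<le> -l" for \<xi>
    using logistic_backward(2)[OF r _ \<beta>(1), of pe "\<xi> + l"] w(2)[OF that] that pe r by simp
  have T_cont: "continuous_on {-l..0} T"
    using w(5) by (intro DERIV_continuous_on) (auto intro: has_field_derivative_at_within)
  obtain m' where m': "m' \<in> {-l..0}" "\<And>\<xi>. \<xi> \<in> {-l..0} \<Longrightarrow> T \<xi> \<le> T m'"
    using continuous_attains_sup[OF compact_Icc _ T_cont] l by force
  have inc: "\<exists>x. -l < x \<and> x < 0 \<and> T (-l) < T x"
  proof -
    have "(T has_real_derivative ((pe - T_1 q0 c) * (pe - T_0 q0 c) / 2) / \<beta>) (at (-l))"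
    proof -
      have eq: "- c * pe + pe\<^sup>2 / 2 + q0 * (1 - Z (-l)) = (pe - T_1 q0 c) * (pe - T_0 q0 c) / 2"
        using w(7)[of "-l"] burnt_rhs[OF c', of pe] by simp
      show ?thesis using w(5)[of "-l"] unfolding Tl eq .
    qed
    moreover have "((pe - T_1 q0 c) * (pe - T_0 q0 c) / 2) / \<beta> > 0"
      using pe r \<beta> by (intro divide_pos_pos mult_pos_pos) auto
    ultimately obtain d where d: "d > 0" "\<And>h. h > 0 \<Longrightarrow> h < d \<Longrightarrow> T (-l) < T (-l + h)"
      using DERIV_pos_inc_right by blast
    \<comment> \<open>a step that stays inside the zone of increase and inside the reaction zone\<close>
    define h where "h = min (d / 2) (l / 2)"
    have "0 < h" "h < d" "h < l" using d l by (auto simp: h_def)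
    thus ?thesis using d(2)[of h] by (intro exI[of _ "-l + h"]) auto
  qed
  then obtain x where x: "-l < x" "x < 0" "T (-l) < T x" by blast
  have m_max: "T x \<le> T m'" using m'(2)[of x] x by simp
  have "m' \<noteq> -l" using m_max x by auto
  moreover have "m' \<noteq> 0" using m_max x T0 T_gt[of x] by auto
  ultimately have m_in: "-l < m'" "m' < 0" using m'(1) by auto
  have glob: "T \<xi> \<le> T m'" for \<xi>
  proof -
    consider "\<xi> \<ge> 0" | "\<xi> \<in> {-l..0}" | "\<xi> \<le> -l" by force
    thus ?thesis
    proof cases
      case 1 thus ?thesis using w(6)[of \<xi>] T_gt[OF m_in(2)] by simp
    next
      case 2 thus ?thesis by (rule m'(2))
    next
      case 3 thus ?thesis using T_burnt[of \<xi>] x m_max Tl by simp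
    qed
  qed
  have "\<not> mono T"
  proof
    assume "mono T" hence "T 0 \<le> T 1" by (rule monoD) simp
    thus False using T0 T1 by simp
  qed
  moreover have "\<not> antimono T"
  proof
    assume "antimono T" hence "T x \<le> T (-l)" using x by (intro antimonoD[of T]) auto
    thus False using x by simp
  qed
  ultimately have "strong_bump q0 K \<alpha> Ti \<phi> \<beta> c T Z"
    unfolding strong_bump_def strong_solution_def solution_def using w(1,3,4) m_in glob by blast
  thus ?thesis by blast
qed

text \<open>The profile ends strictly between \<open>T1\<close> and \<open>T0\<close>; then \<open>F\<close> is positive along it, and the right-hand side
  of the temperature equation is nonpositive in all three zones.\<close>
lemma monotonic_exists:
  assumes c: "c \<in> {c_cj q0<..<c_star q0 Ti}" and \<beta>: "\<beta>0 c < \<beta>" "\<beta> < \<beta>1 c"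
  shows "\<exists>T Z. strong_monotonic q0 K \<alpha> Ti \<phi> \<beta> c T Z"
proof -
  have c': "c \<ge> c_cj q0" and cc: "c > c_cj q0" using c by auto
  have a: "admissible (T_0 q0 c) c" "admissible (T_1 q0 c) c" using admissible_T0 admissible_T1 c by auto
  define b where "b = viscosity \<beta>"
  have \<beta>p: "\<beta> > 0" using \<beta> \<beta>0_pos[OF c'] by simp
  have b: "b > 0" "viscosity b = \<beta>" unfolding b_def using viscosity_pos viscosity_involution \<beta>p by auto
  have "b < shoot (T_0 q0 c) c" "shoot (T_1 q0 c) c < b"
    using \<beta> viscosity_less_iff[OF b(1) shoot_pos[OF a(1)]] viscosity_less_iff[OF shoot_pos[OF a(2)] b(1)] b
    by (auto simp: \<beta>0_def \<beta>1_def)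
  hence lt: "sol b c 1 < G (T_0 q0 c)" and gt: "G (T_1 q0 c) < sol b c 1"
    using sol_less_shoot[OF a(1) b(1)] sol_greater_shoot[OF a(2)] by auto
  have pos: "sol b c 1 > 0" using gt admissibleD(5)[OF a(2)] by simp
  define pe where "pe = S (sol b c 1)"
  have "S (G (T_1 q0 c)) < pe" "pe < S (G (T_0 q0 c))" unfolding pe_def
    using S_strict[OF G_nonneg gt] S_strict[OF less_imp_le[OF pos] lt] admissibleD[OF a(2)] by auto
  hence pe: "T_1 q0 c < pe" "pe < T_0 q0 c" using S_G admissibleD(2)[OF a(1)] admissibleD(2)[OF a(2)] by auto
  have r: "T_1 q0 c < T_0 q0 c" using pe by simp
  obtain l T Z where as: "assembled b c (logistic (T_1 q0 c) (T_0 q0 c) pe \<beta>) l T Z"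
    and ec: "exp_convergent_at_bot T (T_0 q0 c)"
    using strong_wave_exists[OF cc b(1) pos pe_def] pe unfolding b(2) by force
  note w = assembledD(1,2)[OF as, unfolded b(2)] exp_convergent_imp_tendsto[OF ec] ec
    assembledD(3,4,5,6)[OF as, unfolded b(2)]
  have burnt: "T_1 q0 c < T \<xi> \<and> T \<xi> < T_0 q0 c" if "\<xi> \<le> -l" for \<xi>
    using logistic_backward(3)[OF r pe(1) \<beta>p, of "\<xi> + l"] w(2)[OF that] that pe by auto
  have F_end: "F c pe 1 > 0" using pe by (simp add: F_factor[OF c'] Zf_1)
  have rhs: "- c * T \<xi> + (T \<xi>)\<^sup>2 / 2 + q0 * (1 - Z \<xi>) \<le> 0" for \<xi>
  proof -
    consider "\<xi> \<ge> 0" | "-l \<le> \<xi>" "\<xi> \<le> 0" | "\<xi> \<le> -l" by force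
    thus ?thesis
    proof cases
      case 1
      have "T \<xi> * (T \<xi> / 2 - c) \<le> 0"
        using w(7)[OF 1] Ti_less_c[OF c'] by (intro mult_nonneg_nonpos) auto
      thus ?thesis using w(7)[OF 1] by (simp add: algebra_simps power2_eq_square)
    next
      case 2
      obtain y where y: "y \<in> {0..1}" "T \<xi> = S (sol b c y)" "Z \<xi> = Zf y" using w(6)[OF 2] by blast
      have "F c (S (sol b c y)) y \<ge> 0"
      proof (cases "y < 1")
        case True
        thus ?thesis using F_sol_pos[OF c' b(1) pos, of y] pe y(1) unfolding pe_def by simp
      next
        case False
        hence "y = 1" using y(1) by simp
        thus ?thesis using F_end by (simp add: pe_def)
      qed
      thus ?thesis unfolding y(2,3) F_def by simp
    next
      case 3
      have "(T \<xi> - T_1 q0 c) * (T \<xi> - T_0 q0 c) \<le> 0" using burnt[OF 3] by (intro mult_nonneg_nonpos) auto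
      thus ?thesis using w(8)[OF 3] burnt_rhs[OF c', of "T \<xi>"] by simp
    qed
  qed
  have "antimono T"
  proof (rule antimonoI)
    fix x y :: real assume "x \<le> y"
    thus "T y \<le> T x"
    proof (rule DERIV_nonpos_imp_nonincreasing)
      fix z
      have "(- c * T z + (T z)\<^sup>2 / 2 + q0 * (1 - Z z)) / \<beta> \<le> 0"
        by (rule divide_nonpos_pos[OF rhs \<beta>p])
      thus "\<exists>d. (T has_real_derivative d) (at z) \<and> d \<le> 0" using w(5)[of z] by blast
    qed
  qed
  moreover have "\<not> strong_special q0 K \<alpha> Ti \<phi> \<beta> c T Z"
  proof
    assume "strong_special q0 K \<alpha> Ti \<phi> \<beta> c T Z"
    then obtain l' where "\<forall>\<xi>\<le>-l'. T \<xi> = T_0 q0 c" unfolding strong_special_def by blast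
    hence "T (min (-l) (-l')) = T_0 q0 c" by simp
    thus False using burnt[of "min (-l) (-l')"] by simp
  qed
  ultimately have "strong_monotonic q0 K \<alpha> Ti \<phi> \<beta> c T Z"
    unfolding strong_monotonic_def strong_solution_def solution_def using w(1,3,4) by blast
  thus ?thesis by blast
qed

text \<open>A given wave is pulled back to the profile that hits \<open>t\<close>: with \<open>y(s) = 1 - Z(- s) powr (1 - \<alpha>)\<close>, the
  function \<open>sol b1 c (y s) - G (T (- s))\<close> satisfies a differential inequality whose forcing term is
  a positive multiple of \<open>(b1 - b) F\<close> along that profile, where \<open>F\<close> is positive.\<close>
lemma wave_end_bound:
  assumes wv: "wave q0 K \<alpha> Ti \<phi> \<beta> c l T Z" and \<beta>: "\<beta> > 0" and c: "c \<ge> c_cj q0"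
    and a: "admissible t c" and b: "b = viscosity \<beta>"
  shows "b < shoot t c \<Longrightarrow> T (-l) < t" and "b = shoot t c \<Longrightarrow> T (-l) = t"
proof -
  define b1 where "b1 = shoot t c"
  have b1: "b1 > 0" unfolding b1_def by (rule shoot_pos[OF a])
  have bp: "b > 0" "1 / \<beta> = b * (K * (1 - \<alpha>))"
    using viscosity_pos[OF \<beta>] b rate_pos K \<alpha>1 by (auto simp: viscosity_def)
  have l: "l > 0" and T0: "T 0 = Ti" and T_gt: "\<And>\<xi>. \<xi> < 0 \<Longrightarrow> T \<xi> > Ti" and C1: "T C1_differentiable_on UNIV"
    and Z_cont: "continuous_on UNIV Z" and Z0: "Z 0 = 1" "Z (-l) = 0"
    and react: "\<And>\<xi>. - l < \<xi> \<Longrightarrow> \<xi> < 0 \<Longrightarrow> Z \<xi> > 0 \<and>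
        \<beta> * deriv T \<xi> = - c * T \<xi> + (T \<xi>)\<^sup>2 / 2 + q0 * (1 - Z \<xi>) \<and>
        (Z has_real_derivative K * \<phi> (T \<xi>) * Z \<xi> powr \<alpha>) (at \<xi>)"
    using wv unfolding wave_def by auto
  have T_diff: "(T has_real_derivative deriv T \<xi>) (at \<xi>)" for \<xi>
    using C1 unfolding C1_differentiable_on_def
    by (metis DERIV_imp_deriv UNIV_I has_real_derivative_iff_has_vector_derivative)
  have T_cont: "continuous_on A T" for A
    using T_diff by (intro DERIV_continuous_on) (auto intro: has_field_derivative_at_within)
  have T_ge: "T \<xi> \<ge> Ti" if "\<xi> \<le> 0" for \<xi> using T_gt[of \<xi>] T0 that by (cases "\<xi> = 0") auto
  have Z_in: "0 < Z \<xi>" "Z \<xi> < 1" if "- l < \<xi>" "\<xi> < 0" for \<xi>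
  proof -
    show "0 < Z \<xi>" using react that by blast
    have "Z \<xi> < Z 0"
    proof (rule DERIV_pos_imp_increasing_open[OF that(2), where f = Z])
      fix x assume x: "\<xi> < x" "x < 0"
      have "\<phi> (T x) > 0" using \<phi>_ge[OF T_ge[of x]] m x by simp
      hence "K * \<phi> (T x) * Z x powr \<alpha> > 0" using react[of x] that x K by simp
      thus "\<exists>y. (Z has_real_derivative y) (at x) \<and> 0 < y" using react[of x] that x by auto
    qed (use Z_cont continuous_on_subset in blast)
    thus "Z \<xi> < 1" using Z0 by simp
  qed
  \<comment> \<open>the progress variable along the given wave, with \<open>s = - \<xi>\<close>\<close>
  define y where "y s = 1 - Z (-s) powr (1 - \<alpha>)" for s
  have y_in: "0 < y s" "y s < 1" if "0 < s" "s < l" for s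
  proof -
    have z: "0 < Z (-s)" "Z (-s) < 1" using Z_in[of "-s"] that by auto
    show "y s < 1" using z by (simp add: y_def)
    have "Z (-s) powr (1 - \<alpha>) < 1 powr (1 - \<alpha>)" using z \<alpha>1 by (intro powr_less_mono2) auto
    thus "0 < y s" by (simp add: y_def)
  qed
  have y0: "y 0 = 0" "y l = 1" using Z0 \<alpha>1 by (auto simp: y_def)
  have y_in': "y s \<in> {0..1}" if "s \<in> {0..l}" for s
    using y_in[of s] y0 that by (cases "s = 0"; cases "s = l") auto
  have Zm: "continuous_on {0..l} (\<lambda>s. Z (-s))"
    by (rule continuous_on_compose2[OF Z_cont]) (auto intro!: continuous_intros)
  have y_cont: "continuous_on {0..l} y" unfolding y_def
  proof (intro continuous_on_diff continuous_on_const continuous_on_powr' Zm ballI)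
    fix s assume s: "s \<in> {0..l}"
    hence "Z (-s) \<ge> 0" using Z_in[of "-s"] Z0 by (cases "s = 0"; cases "s = l") (auto simp: less_imp_le)
    thus "0 \<le> Z (-s) \<and> (Z (-s) = 0 \<longrightarrow> 0 < 1 - \<alpha>)" using \<alpha>1 by simp
  qed
  have y_deriv: "(y has_real_derivative K * (1 - \<alpha>) * \<phi> (T (-s))) (at s)" if s: "0 < s" "s < l" for s
  proof -
    have z: "0 < Z (-s)" using Z_in[of "-s"] s by auto
    have "(Z has_real_derivative K * \<phi> (T (-s)) * Z (-s) powr \<alpha>) (at (-s))" using react[of "-s"] s by simp
    hence "((\<lambda>s. Z (-s)) has_real_derivative - (K * \<phi> (T (-s)) * Z (-s) powr \<alpha>)) (at s)"
      by (simp only: DERIV_mirror)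
    from DERIV_fun_powr[OF this z, of "1 - \<alpha>"]
    have D: "((\<lambda>s. Z (-s) powr (1 - \<alpha>)) has_real_derivative
       (1 - \<alpha>) * Z (-s) powr (1 - \<alpha> - of_nat 1) * - (K * \<phi> (T (-s)) * Z (-s) powr \<alpha>)) (at s)" .
    have eq: "(1 - \<alpha>) * Z (-s) powr (1 - \<alpha> - of_nat 1) * - (K * \<phi> (T (-s)) * Z (-s) powr \<alpha>)
        = - (K * (1 - \<alpha>) * \<phi> (T (-s))) * (Z (-s) powr (- \<alpha>) * Z (-s) powr \<alpha>)" by simp
    have one: "Z (-s) powr (- \<alpha>) * Z (-s) powr \<alpha> = 1" using z by (simp flip: powr_add)
    have "((\<lambda>s. Z (-s) powr (1 - \<alpha>)) has_real_derivative - (K * (1 - \<alpha>) * \<phi> (T (-s)))) (at s)"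
      using D unfolding eq one by simp
    from DERIV_diff[OF DERIV_const[of 1] this] show ?thesis unfolding y_def[abs_def] by simp
  qed
  have ZfZ: "Zf (y s) = Z (-s)" if s: "0 < s" "s < l" for s
  proof -
    have "Zf (y s) = Z (-s) powr ((1 - \<alpha>) * p)" by (simp add: Zf_def y_def powr_powr)
    also have "(1 - \<alpha>) * p = 1" using \<alpha>1 by (simp add: p_def)
    finally show ?thesis using Z_in[of "-s"] s by simp
  qed
  have Tm_cont: "continuous_on {0..l} (\<lambda>s. T (-s))"
    by (rule continuous_on_compose2[OF T_cont[of UNIV]]) (auto intro!: continuous_intros)
  obtain X where X: "\<And>s. s \<in> {0..l} \<Longrightarrow> T (-s) \<le> X"
    using continuous_attains_sup[OF compact_Icc _ Tm_cont] l by force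
  have Xp: "X \<ge> 0" using X[of 0] T0 Ti l by simp
  define u1 where "u1 s = S (sol b1 c (y s))" for s
  define w where "w s = sol b1 c (y s) - G (T (-s))" for s
  define k where "k s = K * (1 - \<alpha>) * \<phi> (T (-s))" for s
  define d where "d s = k s * ((b1 - b) * F c (u1 s) (y s) + b * (F c (u1 s) (y s) - F c (T (-s)) (y s)))" for s
  define L where "L = K * (1 - \<alpha>) * M * (b * ((c + X) / m))"
  have w_cont: "continuous_on {0..l} w" unfolding w_def
  proof (intro continuous_intros)
    show "continuous_on {0..l} (\<lambda>s. sol b1 c (y s))"
      by (rule continuous_on_compose2[OF sol_cont[OF c b1] y_cont]) (use y_in' in auto)
    show "continuous_on {0..l} (\<lambda>s. G (T (-s)))"
      by (rule continuous_on_compose2[OF G_cont Tm_cont]) (use T_ge in auto)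
  qed
  have w0: "w 0 = 0" using y0 sol_0[OF c b1] T0 G_Ti by (simp add: w_def)
  have wl: "w l = G t - G (T (-l))" using y0 sol_shoot[OF a] by (simp add: w_def b1_def)
  have kp: "k s > 0" "k s \<le> K * (1 - \<alpha>) * M" if "0 \<le> s" for s
  proof -
    show "k s > 0" unfolding k_def using \<phi>_ge[OF T_ge[of "-s"]] m rate_pos that by simp
    show "k s \<le> K * (1 - \<alpha>) * M" unfolding k_def
      using \<phi>_le[OF T_ge[of "-s"]] rate_pos that by (intro mult_left_mono) auto
  qed
  have w_deriv: "(w has_real_derivative d s) (at s)" if s: "0 < s" "s < l" for s
  proof -
    note ys = y_in[OF s]
    have ys': "y s \<in> {0..1}" using ys by simp
    have "(sol b1 c has_real_derivative b1 * F c (u1 s) (y s)) (at (y s))"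
      using sol_deriv[OF c b1 ys] shoot_props(2)[OF a ys'] by (simp add: u1_def b1_def)
    from DERIV_chain2[OF this y_deriv[OF s]]
    have 1: "((\<lambda>s. sol b1 c (y s)) has_real_derivative b1 * F c (u1 s) (y s) * k s) (at s)" by (simp add: k_def)
    have "(G has_real_derivative \<phi> (T (-s))) (at (T (-s)))"
      using G_deriv[OF T_ge[of "-s"]] at_within_interior[of "T (-s)" "{Ti..}"] T_gt[of "-s"] s by simp
    moreover have "((\<lambda>s. T (-s)) has_real_derivative - deriv T (-s)) (at s)"
      using T_diff[of "-s"] by (simp only: DERIV_mirror)
    ultimately have 2: "((\<lambda>s. G (T (-s))) has_real_derivative \<phi> (T (-s)) * - deriv T (-s)) (at s)"
      by (rule DERIV_chain2)
    have "\<beta> * deriv T (-s) = - F c (T (-s)) (y s)"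
      using react[of "-s"] s ZfZ[OF s] by (simp add: F_def)
    hence "- deriv T (-s) = F c (T (-s)) (y s) * (1 / \<beta>)" using \<beta> by (simp add: field_simps)
    hence 3: "\<phi> (T (-s)) * - deriv T (-s) = k s * (b * F c (T (-s)) (y s))" by (simp add: bp(2) k_def)
    have "(w has_real_derivative b1 * F c (u1 s) (y s) * k s - k s * (b * F c (T (-s)) (y s))) (at s)"
      unfolding w_def using DERIV_diff[OF 1 2] unfolding 3 .
    moreover have "b1 * F c (u1 s) (y s) * k s - k s * (b * F c (T (-s)) (y s)) = d s"
      unfolding d_def by (simp add: algebra_simps)
    ultimately show ?thesis by simp
  qed
  have lip: "\<bar>b * (F c (u1 s) (y s) - F c (T (-s)) (y s))\<bar> \<le> b * ((c + X) / m) * \<bar>w s\<bar>" if s: "0 < s" "s < l" for s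
  proof -
    have ys': "y s \<in> {0..1}" using y_in[OF s] by simp
    have u1: "Ti \<le> u1 s" "u1 s \<le> 2 * c" using shoot_props(3,4)[OF a ys'] by (auto simp: u1_def b1_def)
    have Ts: "Ti \<le> T (-s)" "T (-s) \<le> X" using T_ge[of "-s"] X[of s] s by auto
    have "\<bar>F c (u1 s) (y s) - F c (T (-s)) (y s)\<bar> = \<bar>c - (T (-s) + u1 s) / 2\<bar> * \<bar>u1 s - T (-s)\<bar>"
      by (simp add: F_diff abs_mult)
    also have "\<dots> \<le> (c + X) * (\<bar>w s\<bar> / m)"
    proof (intro mult_mono)
      have "0 \<le> (T (-s) + u1 s) / 2" "(T (-s) + u1 s) / 2 \<le> X + c" using u1 Ts Ti Xp by simp_all
      thus "\<bar>c - (T (-s) + u1 s) / 2\<bar> \<le> c + X" using Xp c_pos[OF c] by (intro abs_leI) linarith+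
      have "\<bar>S (sol b1 c (y s)) - S (G (T (-s)))\<bar> \<le> \<bar>sol b1 c (y s) - G (T (-s))\<bar> / m"
        using shoot_props(1)[OF a ys'] G_nonneg[OF Ts(1)] by (intro S_lipschitz) (auto simp: b1_def)
      thus "\<bar>u1 s - T (-s)\<bar> \<le> \<bar>w s\<bar> / m" using S_G[OF Ts(1)] by (simp add: u1_def w_def)
    qed (use Xp c_pos[OF c] in auto)
    finally have "b * \<bar>F c (u1 s) (y s) - F c (T (-s)) (y s)\<bar> \<le> b * ((c + X) * (\<bar>w s\<bar> / m))"
      using bp by (intro mult_left_mono) auto
    thus ?thesis using bp by (simp add: abs_mult)
  qed
  have lipk: "\<bar>k s * (b * (F c (u1 s) (y s) - F c (T (-s)) (y s)))\<bar> \<le> L * \<bar>w s\<bar>" if s: "0 < s" "s < l" for s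
  proof -
    have "\<bar>k s * (b * (F c (u1 s) (y s) - F c (T (-s)) (y s)))\<bar> = k s * \<bar>b * (F c (u1 s) (y s) - F c (T (-s)) (y s))\<bar>"
      using kp(1)[of s] s by (simp add: abs_mult)
    also have "\<dots> \<le> (K * (1 - \<alpha>) * M) * (b * ((c + X) / m) * \<bar>w s\<bar>)"
      using kp[of s] s lip[OF s] by (intro mult_mono) auto
    finally show ?thesis by (simp add: L_def)
  qed
  show "T (-l) < t" if "b < shoot t c"
  proof -
    have "w l > 0"
    proof (rule comparison_strict[OF l w_cont w_deriv])
      fix s assume s: "0 < s" "s < l"
      have "y s \<in> {0..1}" "y s < 1" using y_in[OF s] by auto
      hence "F c (u1 s) (y s) > 0" using shoot_props(5)[OF a] by (simp add: u1_def b1_def)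
      hence "k s * ((b1 - b) * F c (u1 s) (y s)) > 0" using kp(1)[of s] s that by (simp add: b1_def)
      moreover have "d s = k s * ((b1 - b) * F c (u1 s) (y s)) + k s * (b * (F c (u1 s) (y s) - F c (T (-s)) (y s)))"
        unfolding d_def by (rule distrib_left)
      ultimately show "- L * \<bar>w s\<bar> < d s" using lipk[OF s] by (simp add: abs_le_iff)
    qed (use w0 in auto)
    thus ?thesis using G_less_iff[of "T (-l)" t] T_ge[of "-l"] l admissibleD(2)[OF a] by (simp add: wl)
  qed
  show "T (-l) = t" if "b = shoot t c"
  proof -
    have d: "d s = k s * (b * (F c (u1 s) (y s) - F c (T (-s)) (y s)))" for s
      using that by (simp add: d_def b1_def)
    have "w l \<ge> 0"
    proof (rule comparison_nonneg_abs[OF less_imp_le[OF l] w_cont w_deriv])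
      show "- L * \<bar>w s\<bar> \<le> d s" if "0 < s" "s < l" for s using lipk[OF that] by (simp add: d abs_le_iff)
    qed (use w0 in auto)
    moreover have "- w l \<ge> 0"
    proof (rule comparison_nonneg_abs[where w = "\<lambda>s. - w s" and a = 0 and b = l and d = "\<lambda>s. - d s" and L = L])
      show "- L * \<bar>- w s\<bar> \<le> - d s" if "0 < s" "s < l" for s using lipk[OF that] by (simp add: d abs_le_iff)
    qed (use w0 w_cont w_deriv l in \<open>auto intro!: continuous_intros DERIV_minus\<close>)
    ultimately have "G (T (-l)) = G t" by (simp add: wl)
    hence "S (G (T (-l))) = S (G t)" by simp
    thus ?thesis using S_G[OF T_ge[of "-l"]] l S_G[of t] admissibleD(2)[OF a] by simp
  qed
qed

text \<open>Behind the reaction zone the equation is autonomous with the equilibria \<open>T1\<close> and \<open>T0\<close>, and \<open>T1\<close> is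
  repelling towards the burnt side: a temperature below \<open>T1\<close> decreases further, a temperature equal
  to \<open>T1\<close> stays.\<close>
lemma burnt_zone:
  assumes wv: "wave q0 K \<alpha> Ti \<phi> \<beta> c l T Z" and \<beta>: "\<beta> > 0" and c: "c \<ge> c_cj q0"
  shows "T (-l) < T_1 q0 c \<Longrightarrow> \<xi> \<le> -l \<Longrightarrow> T \<xi> \<le> T (-l)"
    and "T (-l) = T_1 q0 c \<Longrightarrow> \<xi> \<le> -l \<Longrightarrow> T \<xi> = T_1 q0 c"
proof -
  have C1: "T C1_differentiable_on UNIV"
    and burnt: "\<And>\<xi>. \<xi> < -l \<Longrightarrow> \<beta> * deriv T \<xi> = - c * T \<xi> + (T \<xi>)\<^sup>2 / 2 + q0"
    using wv unfolding wave_def by auto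
  have T_diff: "(T has_real_derivative deriv T \<xi>) (at \<xi>)" for \<xi>
    using C1 unfolding C1_differentiable_on_def
    by (metis DERIV_imp_deriv UNIV_I has_real_derivative_iff_has_vector_derivative)
  have T_cont: "continuous_on UNIV T"
    using T_diff by (intro DERIV_continuous_on) (auto intro: has_field_derivative_at_within)
  define v where "v s = T (- l - s)" for s
  have v_cont: "continuous_on A v" for A unfolding v_def
    by (rule continuous_on_compose2[OF T_cont]) (auto intro!: continuous_intros)
  define f where "f x = - ((x - T_1 q0 c) * (x - T_0 q0 c)) / (2 * \<beta>)" for x
  have v_deriv: "(v has_real_derivative f (v s)) (at s)" if "s > 0" for s
  proof -
    have "(v has_real_derivative deriv T (- l - s) * -1) (at s)"
      unfolding v_def by (rule DERIV_chain2[OF T_diff]) (auto intro!: derivative_eq_intros)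
    moreover have "deriv T (- l - s) = (v s - T_1 q0 c) * (v s - T_0 q0 c) / 2 / \<beta>"
      using burnt[of "- l - s"] that \<beta> unfolding burnt_rhs[OF c] by (simp add: v_def field_simps)
    ultimately show ?thesis by (simp add: f_def)
  qed
  have f_diff: "f x - f z = (2 * c - (x + z)) / (2 * \<beta>) * (x - z)" for x z
  proof -
    have "- ((x - T_1 q0 c) * (x - T_0 q0 c)) = - x\<^sup>2 + (T_0 q0 c + T_1 q0 c) * x - T_0 q0 c * T_1 q0 c" for x
      by (simp add: algebra_simps power2_eq_square)
    hence f: "f x = (- x\<^sup>2 + 2 * c * x - 2 * q0) / (2 * \<beta>)" for x
      unfolding f_def by (simp only: T01_sum[OF c] T01_prod[OF c])
    show ?thesis unfolding f by (simp add: algebra_simps power2_eq_square flip: diff_divide_distrib)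
  qed
  have lip: "\<exists>L. \<forall>r\<in>{0..s}. \<bar>f (v r) - f p\<bar> \<le> L * \<bar>v r - p\<bar>" for s p
  proof -
    have "bounded (v ` {0..s})" using v_cont by (intro compact_imp_bounded compact_continuous_image) auto
    then obtain X where "\<forall>r\<in>{0..s}. \<bar>v r\<bar> \<le> X" unfolding bounded_iff by auto
    hence X: "\<bar>v r\<bar> \<le> X" if "r \<in> {0..s}" for r using that by blast
    have "\<bar>f (v r) - f p\<bar> \<le> (2 * c + X + \<bar>p\<bar>) / (2 * \<beta>) * \<bar>v r - p\<bar>" if "r \<in> {0..s}" for r
    proof -
      have "\<bar>f (v r) - f p\<bar> = \<bar>2 * c - (v r + p)\<bar> / (2 * \<beta>) * \<bar>v r - p\<bar>"
        using \<beta> by (simp add: f_diff abs_mult)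
      also have "\<dots> \<le> (2 * c + X + \<bar>p\<bar>) / (2 * \<beta>) * \<bar>v r - p\<bar>"
        using X[OF that] \<beta> c_pos[OF c] by (intro mult_right_mono divide_right_mono) auto
      finally show ?thesis .
    qed
    thus ?thesis by blast
  qed
  show "T \<xi> \<le> T (-l)" if p: "T (-l) < T_1 q0 c" and x: "\<xi> \<le> -l"
  proof -
    define s where "s = - l - \<xi>"
    have s: "s \<ge> 0" using x by (simp add: s_def)
    obtain L where L: "\<And>r. r \<in> {0..s} \<Longrightarrow> \<bar>f (v r) - f (T (-l))\<bar> \<le> L * \<bar>v r - T (-l)\<bar>" using lip by blast
    have "(T (-l) - T_1 q0 c) * (T (-l) - T_0 q0 c) \<ge> 0"
      using p T01_le[OF c] by (intro mult_nonpos_nonpos) auto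
    hence fp: "f (T (-l)) \<le> 0" unfolding f_def using \<beta> by (simp add: divide_nonpos_pos)
    have "0 \<le> T (-l) - v s"
    proof (rule comparison_nonneg_abs[where w = "\<lambda>s. T (-l) - v s" and a = 0 and b = s and d = "\<lambda>s. - f (v s)" and L = L])
      fix r assume r: "0 < r" "r < s"
      show "((\<lambda>s. T (-l) - v s) has_real_derivative - f (v r)) (at r)"
        using v_deriv[OF r(1)] by (auto intro!: derivative_eq_intros)
      show "- L * \<bar>T (-l) - v r\<bar> \<le> - f (v r)"
        using L[of r] r fp by (simp add: abs_le_iff abs_minus_commute)
    qed (use s v_cont in \<open>auto intro!: continuous_intros simp: v_def\<close>)
    thus ?thesis by (simp add: v_def s_def)
  qed
  show "T \<xi> = T_1 q0 c" if p: "T (-l) = T_1 q0 c" and x: "\<xi> \<le> -l"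
  proof -
    define s where "s = - l - \<xi>"
    have s: "s \<ge> 0" using x by (simp add: s_def)
    have f1: "f (T_1 q0 c) = 0" by (simp add: f_def)
    obtain L where L: "\<And>r. r \<in> {0..s} \<Longrightarrow> \<bar>f (v r) - f (T_1 q0 c)\<bar> \<le> L * \<bar>v r - T_1 q0 c\<bar>"
      using lip by blast
    have v0: "v 0 = T_1 q0 c" using p by (simp add: v_def)
    have "0 \<le> v s - T_1 q0 c"
    proof (rule comparison_nonneg_abs[where w = "\<lambda>s. v s - T_1 q0 c" and a = 0 and b = s and d = "\<lambda>s. f (v s)" and L = L])
      fix r assume r: "0 < r" "r < s"
      show "((\<lambda>s. v s - T_1 q0 c) has_real_derivative f (v r)) (at r)"
        using v_deriv[OF r(1)] by (auto intro!: derivative_eq_intros)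
      show "- L * \<bar>v r - T_1 q0 c\<bar> \<le> f (v r)" using L[of r] r f1 by (simp add: abs_le_iff)
    qed (use s v_cont v0 in \<open>auto intro!: continuous_intros\<close>)
    moreover have "0 \<le> T_1 q0 c - v s"
    proof (rule comparison_nonneg_abs[where w = "\<lambda>s. T_1 q0 c - v s" and a = 0 and b = s and d = "\<lambda>s. - f (v s)" and L = L])
      fix r assume r: "0 < r" "r < s"
      show "((\<lambda>s. T_1 q0 c - v s) has_real_derivative - f (v r)) (at r)"
        using v_deriv[OF r(1)] by (auto intro!: derivative_eq_intros)
      show "- L * \<bar>T_1 q0 c - v r\<bar> \<le> - f (v r)" using L[of r] r f1 by (simp add: abs_le_iff abs_minus_commute)
    qed (use s v_cont v0 in \<open>auto intro!: continuous_intros\<close>)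
    ultimately show ?thesis by (simp add: v_def s_def)
  qed
qed

text \<open>If \<open>\<beta> > \<beta>1 c\<close>, the reaction zone ends below \<open>T1\<close> and the temperature can converge to neither
  equilibrium.\<close>
lemma wave_large_viscosity:
  assumes wv: "wave q0 K \<alpha> Ti \<phi> \<beta> c l T Z" and c: "c \<in> {c_cj q0<..<c_star q0 Ti}" and \<beta>: "\<beta> \<ge> \<beta>1 c"
  shows "\<beta> = \<beta>1 c \<and> (\<forall>\<xi>\<le>-l. T \<xi> = T_1 q0 c)"
proof -
  have c': "c \<ge> c_cj q0" using c by simp
  have a: "admissible (T_1 q0 c) c" using admissible_T1 c by simp
  have "\<beta>1 c > 0" using \<beta>1_pos c by simp
  hence \<beta>p: "\<beta> > 0" using \<beta> by simp
  define b where "b = viscosity \<beta>"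
  have b: "b > 0" "viscosity b = \<beta>" unfolding b_def using viscosity_pos viscosity_involution \<beta>p by auto
  have r: "T_1 q0 c < T_0 q0 c" using disc_pos[OF q0, of c] c by (simp add: T_0_def T_1_def)
  show ?thesis
  proof (cases "\<beta> = \<beta>1 c")
    case True
    have "b = shoot (T_1 q0 c) c"
      unfolding b_def True \<beta>1_def by (rule viscosity_involution[OF shoot_pos[OF a]])
    hence "T (-l) = T_1 q0 c" using wave_end_bound(2)[OF wv \<beta>p c' a b_def] by simp
    thus ?thesis using True burnt_zone(2)[OF wv \<beta>p c'] by simp
  next
    case False
    hence "\<beta>1 c < \<beta>" using \<beta> by simp
    hence "b < shoot (T_1 q0 c) c"
      using viscosity_less_iff[OF b(1) shoot_pos[OF a]] b by (simp add: \<beta>1_def)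
    hence lt: "T (-l) < T_1 q0 c" by (rule wave_end_bound(1)[OF wv \<beta>p c' a b_def])
    obtain L where L: "L \<in> {T_0 q0 c, T_1 q0 c}" "(T \<longlongrightarrow> L) at_bot" using wv unfolding wave_def by blast
    have "\<forall>\<^sub>F \<xi> in at_bot. T \<xi> \<le> T (-l)"
      using eventually_le_at_bot[of "-l"] by eventually_elim (rule burnt_zone(1)[OF wv \<beta>p c' lt])
    hence "L \<le> T (-l)" by (rule tendsto_upperbound[OF L(2)]) simp
    thus ?thesis using lt L(1) r by auto
  qed
qed

lemma no_solution_large_viscosity:
  assumes c: "c \<in> {c_cj q0<..<c_star q0 Ti}" and \<beta>: "\<beta> \<ge> \<beta>1 c"
  shows "\<not> (\<exists>T Z. strong_solution q0 K \<alpha> Ti \<phi> \<beta> c T Z)"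
    "\<not> (\<exists>T Z. solution q0 K \<alpha> Ti \<phi> \<beta> c T Z \<and> \<not> (\<beta> = \<beta>1 c \<and> weak_special q0 K \<alpha> Ti \<phi> \<beta> c T Z))"
proof -
  have r: "T_1 q0 c < T_0 q0 c" using disc_pos[OF q0, of c] c by (simp add: T_0_def T_1_def)
  have lim: "(T \<longlongrightarrow> T_1 q0 c) at_bot" if "\<forall>\<xi>\<le>-l. T \<xi> = T_1 q0 c" for T :: "real \<Rightarrow> real" and l
  proof (rule Lim_transform_eventually[OF tendsto_const])
    show "\<forall>\<^sub>F \<xi> in at_bot. T_1 q0 c = T \<xi>"
      using eventually_le_at_bot[of "- l"] by eventually_elim (use that in simp)
  qed
  show "\<not> (\<exists>T Z. strong_solution q0 K \<alpha> Ti \<phi> \<beta> c T Z)"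
  proof
    assume "\<exists>T Z. strong_solution q0 K \<alpha> Ti \<phi> \<beta> c T Z"
    then obtain T Z l where w: "wave q0 K \<alpha> Ti \<phi> \<beta> c l T Z" "(T \<longlongrightarrow> T_0 q0 c) at_bot"
      unfolding strong_solution_def solution_def by blast
    have "(T \<longlongrightarrow> T_1 q0 c) at_bot" using lim wave_large_viscosity[OF w(1) c \<beta>] by blast
    hence "T_0 q0 c = T_1 q0 c" using w(2) by (intro tendsto_unique) auto
    thus False using r by simp
  qed
  show "\<not> (\<exists>T Z. solution q0 K \<alpha> Ti \<phi> \<beta> c T Z \<and> \<not> (\<beta> = \<beta>1 c \<and> weak_special q0 K \<alpha> Ti \<phi> \<beta> c T Z))"
  proof clarify
    fix T Z assume s: "solution q0 K \<alpha> Ti \<phi> \<beta> c T Z" and n: "\<not> (\<beta> = \<beta>1 c \<and> weak_special q0 K \<alpha> Ti \<phi> \<beta> c T Z)"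
    then obtain l where w: "wave q0 K \<alpha> Ti \<phi> \<beta> c l T Z" unfolding solution_def by blast
    from wave_large_viscosity[OF this c \<beta>] have "\<beta> = \<beta>1 c" "\<forall>\<xi>\<le>-l. T \<xi> = T_1 q0 c" by auto
    thus False using n s w lim unfolding weak_special_def weak_solution_def by blast
  qed
qed

end

text \<open>Near infinity \<open>\<phi>\<close> is close to \<open>\<psi> 0 > 0\<close>; the remaining part of \<open>[Ti, \<infinity>)\<close> is compact.\<close>
lemma ignition_rate_bounds:
  assumes "ignition_rate Ti n \<phi>" "0 < Ti"
  shows "\<exists>m M. m > 0 \<and> (\<forall>T\<ge>Ti. m \<le> \<phi> T \<and> \<phi> T \<le> M)"
proof -
  have pos: "\<And>T. T \<ge> Ti \<Longrightarrow> \<phi> T > 0" and cont: "continuous_on {Ti..} \<phi>"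
    using assms Ck_on_continuous unfolding ignition_rate_def by auto
  obtain \<psi> \<delta> where \<psi>: "\<delta> > 0" "\<And>V. V > 0 \<Longrightarrow> \<psi> V = \<phi> (1 / V)" "\<psi> 0 > 0" "continuous_on {0..<\<delta>} \<psi>"
    using assms Ck_on_continuous unfolding ignition_rate_def by blast
  from \<psi>(4)[unfolded continuous_on_iff, rule_format, of 0 "\<psi> 0 / 2"] \<psi>(1,3)
  obtain e where e: "e > 0" "\<And>V. 0 \<le> V \<Longrightarrow> V < \<delta> \<Longrightarrow> V < e \<Longrightarrow> \<bar>\<psi> V - \<psi> 0\<bar> < \<psi> 0 / 2"
    by (auto simp: dist_real_def)
  define X where "X = max Ti (2 / min \<delta> e)"
  have X: "X \<ge> Ti" "X \<ge> 2 / min \<delta> e" by (auto simp: X_def)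
  have far: "\<psi> 0 / 2 \<le> \<phi> T \<and> \<phi> T \<le> 2 * \<psi> 0" if "T > X" for T
  proof -
    have T: "T > 0" "T > 2 / min \<delta> e" using that X assms by auto
    have me: "min \<delta> e > 0" using \<psi>(1) e(1) by simp
    have "2 < T * min \<delta> e" using T(2) me by (simp only: divide_less_eq if_True)
    hence "1 / T < min \<delta> e" using T(1) by (simp only: divide_less_eq if_True mult.commute)
    hence "\<bar>\<psi> (1 / T) - \<psi> 0\<bar> < \<psi> 0 / 2" using T(1) by (intro e(2)) auto
    moreover have "\<psi> (1 / T) = \<phi> T" using \<psi>(2)[of "1 / T"] T by simp
    ultimately show ?thesis using \<psi>(3) by (intro conjI) linarith+
  qed
  have c: "continuous_on {Ti..X} \<phi>" using cont by (rule continuous_on_subset) auto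
  have ne: "{Ti..X} \<noteq> {}" using X by simp
  obtain x where x: "x \<in> {Ti..X}" "\<And>T. T \<in> {Ti..X} \<Longrightarrow> \<phi> x \<le> \<phi> T"
    using continuous_attains_inf[OF compact_Icc ne c] by blast
  obtain z where z: "z \<in> {Ti..X}" "\<And>T. T \<in> {Ti..X} \<Longrightarrow> \<phi> T \<le> \<phi> z"
    using continuous_attains_sup[OF compact_Icc ne c] by blast
  define m where "m = min (\<phi> x) (\<psi> 0 / 2)"
  define M where "M = max (\<phi> z) (2 * \<psi> 0)"
  have "m > 0" using pos[of x] x \<psi>(3) by (simp add: m_def)
  moreover have "m \<le> \<phi> T \<and> \<phi> T \<le> M" if "T \<ge> Ti" for T
  proof (cases "T > X")
    case True thus ?thesis using far[OF True] by (simp add: m_def M_def min_le_iff_disj le_max_iff_disj)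
  next
    case False
    hence "\<phi> x \<le> \<phi> T" "\<phi> T \<le> \<phi> z" using x(2)[of T] z(2)[of T] that by auto
    thus ?thesis by (simp add: m_def M_def min_le_iff_disj le_max_iff_disj)
  qed
  ultimately show ?thesis by blast
qed

theorem theorem1p2:
  fixes q0 K \<alpha> Ti :: real
  assumes "q0 > 0" and "K > 0" and "0 \<le> \<alpha>" and "\<alpha> < 1"
    and "0 < Ti" and "Ti < sqrt (2 * q0)"
  shows "\<exists>N. \<forall>\<phi>. ignition_rate Ti N \<phi> \<longrightarrow>
    (\<exists>\<beta>0 \<beta>1 :: real \<Rightarrow> real.
       \<comment> \<open>(i)\<close>
       (\<forall>c\<ge>c_cj q0. \<beta>0 c > 0) \<and>
       class_Ck_speed (nat \<lfloor>1 / (1 - \<alpha>)\<rfloor>) \<beta>0 {c_cj q0..} \<and>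
       (\<forall>c\<ge>c_cj q0. \<exists>T Z. strong_special q0 K \<alpha> Ti \<phi> (\<beta>0 c) c T Z) \<and>
       \<comment> \<open>(ii)\<close>
       (\<forall>c\<in>{c_cj q0..<c_star q0 Ti}. \<beta>1 c > 0) \<and>
       class_Ck_speed (nat \<lfloor>1 / (1 - \<alpha>)\<rfloor>) \<beta>1 {c_cj q0..<c_star q0 Ti} \<and>
       (\<forall>c\<in>{c_cj q0..<c_star q0 Ti}. \<exists>T Z. weak_special q0 K \<alpha> Ti \<phi> (\<beta>1 c) c T Z) \<and>
       \<comment> \<open>(iii)\<close>
       (\<forall>c\<in>{c_cj q0<..<c_star q0 Ti}. \<beta>0 c < \<beta>1 c) \<and>
       filterlim \<beta>0 at_top at_top \<and>
       (\<forall>c\<in>{c_cj q0<..<c_star q0 Ti}. deriv \<beta>1 c > 0) \<and>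
       filterlim \<beta>1 at_top (at_left (c_star q0 Ti)) \<and>
       \<comment> \<open>(iv)\<close>
       (\<forall>c>c_cj q0. \<forall>\<beta>. 0 < \<beta> \<and> \<beta> < \<beta>0 c \<longrightarrow>
          (\<exists>T Z. strong_bump q0 K \<alpha> Ti \<phi> \<beta> c T Z)) \<and>
       (\<forall>c\<in>{c_cj q0<..<c_star q0 Ti}. \<forall>\<beta>. \<beta>0 c < \<beta> \<and> \<beta> < \<beta>1 c \<longrightarrow>
          (\<exists>T Z. strong_monotonic q0 K \<alpha> Ti \<phi> \<beta> c T Z)) \<and>
       \<comment> \<open>at \<beta> = \<beta>1 c the wave of (ii) exists, so no solution other than it is claimed there\<close>
       (\<forall>c\<in>{c_cj q0<..<c_star q0 Ti}. \<forall>\<beta>\<ge>\<beta>1 c.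
          \<not> (\<exists>T Z. strong_solution q0 K \<alpha> Ti \<phi> \<beta> c T Z) \<and>
          \<not> (\<exists>T Z. solution q0 K \<alpha> Ti \<phi> \<beta> c T Z \<and>
                 \<not> (\<beta> = \<beta>1 c \<and> weak_special q0 K \<alpha> Ti \<phi> \<beta> c T Z))))"
  (* the curves inherit the order of smoothness of the ignition rate *)
  apply (intro exI[of _ "nat \<lfloor>1 / (1 - \<alpha>)\<rfloor>"] allI impI)
  subgoal premises ign for \<phi>
  proof -
    obtain m M where mM: "m > 0" "\<And>T. T \<ge> Ti \<Longrightarrow> m \<le> \<phi> T" "\<And>T. T \<ge> Ti \<Longrightarrow> \<phi> T \<le> M"
      using ignition_rate_bounds[OF ign assms(5)] by blast
    have Ck: "Ck_on (nat \<lfloor>1 / (1 - \<alpha>)\<rfloor>) \<phi> {Ti..}" using ign unfolding ignition_rate_def by blast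
    interpret reactive_flow q0 K \<alpha> Ti m M \<phi>
      by unfold_locales (use assms mM Ck_on_continuous[OF Ck] in auto)
    show ?thesis
      by (rule exI[of _ \<beta>0], rule exI[of _ \<beta>1], intro conjI ballI allI impI)
        (blast intro: \<beta>0_pos \<beta>0_class[OF Ck] strong_special_exists \<beta>1_pos \<beta>1_class[OF Ck]
          weak_special_exists \<beta>0_less_\<beta>1 \<beta>0_at_top \<beta>1_deriv_pos \<beta>1_at_c_star bump_exists
          monotonic_exists dest: no_solution_large_viscosity)+
  qed
  done

end
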